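(* Let $j\in\{1,\dots,d\}$. If $\xi_1,\dots,\xi_j$ are independent integrable random vectors in $\mathbb{R}^d$, then $$V\big(\mathbf{E}[0,\xi_1],\dots,\mathbf{E}[0,\xi_j],B^d[d-j]\big)=\frac{(d-j)!}{d!}\,\kappa_{d-j}\,\mathbf{E}\,D_j(\xi_1,\dots,\xi_j).$$
   Context: A convex body is a non-empty compact convex set in $\mathbb{R}^d$; its support function is $h(K,u)=\sup\{\langle x,u\rangle:x\in K\}$, $u\in\mathbb{R}^d$. For an integrable random vector $\xi$ in $\mathbb{R}^d$, $[0,\xi]$ is the random segment with end-points $0$ and $\xi$, and $\mathbf{E}[0,\xi]$ is its selection expectation, i.e. the convex body with support function $u\mapsto\mathbf{E}\,h([0,\xi],u)$. The mixed volume $V(K_1,\dots,K_d)$ of convex bodies is the symmetric functional such that $V_d(t_1K_1+\dots+t_mK_m)=\sum_{i_1,\dots,i_d=1}^m t_{i_1}\cdots t_{i_d}V(K_{i_1},\dots,K_{i_d})$ for all convex bodies $K_1,\dots,K_m$ and $t_1,\dots,t_m\ge 0$, where $V_d$ is Lebesgue measure and the sum is the Minkowski sum; $K[j]$ stands for $j$ arguments all equal to $K$. $B^d$ is the centred closed unit ball in $\mathbb{R}^d$, $\kappa_{m}$ is the $m$-dimensional volume of the unit ball $B^m$ (with $\kappa_0=1$), and $D_j(u_1,\dots,u_j)$ is the $j$-dimensional volume of the parallelepiped spanned by $u_1,\dots,u_j\in\mathbb{R}^d$. *)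

theory Defs
  imports "HOL-Probability.Probability" "HOL-Analysis.Ball_Volume" "HOL-Library.Set_Algebras"
begin

definition convex_body :: "'a::euclidean_space set \<Rightarrow> bool" where
  "convex_body K \<longleftrightarrow> K \<noteq> {} \<and> compact K \<and> convex K"

definition support_fun :: "'a::euclidean_space set \<Rightarrow> 'a \<Rightarrow> real" where
  "support_fun K u = (SUP x\<in>K. x \<bullet> u)"

definition selection_expectation :: "'w measure \<Rightarrow> ('w \<Rightarrow> 'a::euclidean_space set) \<Rightarrow> 'a set" where
  "selection_expectation M X =
     (THE K. convex_body K \<and> (\<forall>u. support_fun K u = (LINT \<omega>|M. support_fun (X \<omega>) u)))"

text \<open>
  A \<open>d\<close>-tuple of convex bodies in a space of dimension \<open>d\<close> is a list of length \<open>d\<close>. The sum of sets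
  on the left-hand side of the expansion is the Minkowski sum; the sum on the right-hand side
  runs over all \<open>d\<close>-tuples of indices from \<open>{1..m}\<close>.
\<close>

definition is_mixed_volume :: "('a::euclidean_space set list \<Rightarrow> real) \<Rightarrow> bool" where
  "is_mixed_volume V \<longleftrightarrow>
     (\<forall>Ks Ls. length Ks = DIM('a) \<and> (\<forall>K\<in>set Ks. convex_body K) \<and> mset Ks = mset Ls \<longrightarrow> V Ks = V Ls) \<and>
     (\<forall>m (K :: nat \<Rightarrow> 'a set) (t :: nat \<Rightarrow> real).
        (\<forall>i\<in>{1..m}. convex_body (K i) \<and> 0 \<le> t i) \<longrightarrow>
        measure lebesgue (\<Sum>i\<in>{1..m}. (\<lambda>x. t i *\<^sub>R x) ` K i) =
        (\<Sum>ixs | length ixs = DIM('a) \<and> set ixs \<subseteq> {1..m}.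
           prod_list (map t ixs) * V (map K ixs)))"

text \<open>
  The properties above determine \<open>V\<close> on \<open>d\<close>-tuples of convex bodies only, so the description
  picks out the value at the given tuple instead of the functional itself.
\<close>

definition mixed_volume :: "'a::euclidean_space set list \<Rightarrow> real" where
  "mixed_volume Ks = (THE v. \<exists>V. is_mixed_volume V \<and> v = V Ks)"

definition orthonormal_family :: "nat \<Rightarrow> (nat \<Rightarrow> 'a::euclidean_space) \<Rightarrow> bool" where
  "orthonormal_family j b \<longleftrightarrow>
     (\<forall>i\<in>{1..j}. \<forall>k\<in>{1..j}. b i \<bullet> b k = (if i = k then 1 else 0))"

text \<open>
  \<open>j\<close>-dimensional volume of a set lying in some \<open>j\<close>-dimensional linear subspace: the
  \<open>j\<close>-dimensional Lebesgue measure of the set of its coordinate vectors with respect to an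
  orthonormal basis of such a subspace. The value does not depend on the basis, nor on the
  subspace (if there are several, the volume is \<open>0\<close>).
\<close>

definition volume_dim :: "nat \<Rightarrow> 'a::euclidean_space set \<Rightarrow> real" where
  "volume_dim j A =
     (THE v. \<exists>b. orthonormal_family j b \<and> A \<subseteq> span (b ` {1..j}) \<and>
        v = measure (Pi\<^sub>M {1..j} (\<lambda>_. lborel))
              {x \<in> {1..j} \<rightarrow>\<^sub>E UNIV. (\<Sum>i=1..j. x i *\<^sub>R b i) \<in> A})"

definition parallelepiped :: "nat \<Rightarrow> (nat \<Rightarrow> 'a::euclidean_space) \<Rightarrow> 'a set" where
  "parallelepiped j u = {\<Sum>i=1..j. c i *\<^sub>R u i | c. \<forall>i\<in>{1..j}. 0 \<le> c i \<and> c i \<le> 1}"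

definition parallelepiped_volume :: "nat \<Rightarrow> (nat \<Rightarrow> 'a::euclidean_space) \<Rightarrow> real" where
  "parallelepiped_volume j u = volume_dim j (parallelepiped j u)"

end

theory Submission imports Defs begin

text \<open>
  Mixed volumes exist because \<open>vol (t\<^sub>1 K\<^sub>1 + \<dots> + t\<^sub>m K\<^sub>m)\<close> is a homogeneous polynomial in
  \<open>t \<ge> 0\<close>. For polytopes with interior points this follows from a change of variables that goes
  back to Gromov: the gradient of \<open>\<Sum>\<^sub>i t\<^sub>i ln (\<Sum>\<^sub>a exp (x \<bullet> a))\<close>, where \<open>a\<close> ranges over the vertices of
  \<open>K\<^sub>i\<close>, maps the space bijectively onto a set lying between \<open>\<Sum>\<^sub>i t\<^sub>i K\<^sub>i\<close> and its interior, and its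
  Jacobian is the determinant of a linear combination of matrices with coefficients \<open>t\<^sub>i\<close>. The general
  case follows by approximation, and the polarization formula recovers the mixed volume from
  volumes of Minkowski sums, whence it is unique, multilinear and continuous.

  For deterministic segments, let \<open>P\<close> be the parallelepiped spanned by \<open>u\<^sub>1, \<dots>, u\<^sub>j\<close>. The limit of
  \<open>vol (B + n P) / n\<^sup>j\<close> is \<open>\<kappa>\<^bsub>d-j\<^esub>\<close> times the \<open>j\<close>-dimensional volume of \<open>P\<close>, and it is also the
  leading coefficient \<open>d! / (d-j)! V([0,u\<^sub>1], \<dots>, [0,u\<^sub>j], B[d-j])\<close>, since mixed volumes with a
  repeated segment vanish.

  If the \<open>\<xi>\<^sub>i\<close> take finitely many values, \<open>E [0,\<xi>\<^sub>i]\<close> is a Minkowski combination of segments, and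
  multilinearity and independence give the theorem; integrable vectors are approximated by such ones.
\<close>

section \<open>Polarization of homogeneous polynomials\<close>

text \<open>The obstacle is polynomiality, which for polytopes is classically an induction over
  faces. Gromov's substitution replaces it by an integral over the whole space, a domain independent
  of \<open>t\<close>, of a determinant that is polynomial in \<open>t\<close>. Polynomiality is
  therefore encoded as an identity that survives finite sums, integrals and pointwise limits.

  The resulting polynomials do further work. Their coefficients are uniformly bounded for bodies in
  a fixed ball, which gives continuity of volume from below. Their second difference along a segment
  vanishes, which kills repeated segments. The coefficient of \<open>n ^ j\<close> refers to no
  basis, so its equality with the limit shows that the coordinate measure in
  \<open>volume_dim\<close> is the same for every admissible orthonormal family: the definite
  description is justified by the same computation that evaluates it.

  For the passage to integrable vectors, \<open>D_j\<close> is treated as a constant times a mixed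
  volume of segments and balls. Multilinearity bounds it by a constant times the product of the
  lengths, which is integrable by independence, and continuity of mixed volumes yields its
  measurability.\<close>

lemma sum_Pow_insert:
  fixes f :: "'b set \<Rightarrow> 'c::comm_monoid_add"
  assumes "finite A" "a \<notin> A"
  shows "(\<Sum>S\<in>Pow (insert a A). f S) = (\<Sum>S\<in>Pow A. f S) + (\<Sum>S\<in>Pow A. f (insert a S))"
proof -
  have "inj_on (insert a) (Pow A)"
    using assms(2) by (auto simp: inj_on_def)
  moreover have "Pow A \<inter> insert a ` Pow A = {}"
    using assms(2) by auto
  ultimately show ?thesis
    using assms(1) by (simp add: Pow_insert sum.union_disjoint sum.reindex)
qed

text \<open>Adding or removing an element of \<open>U\<close> outside \<open>X\<close> changes the
  sign but not the truth of \<open>X \<subseteq> S\<close>, so the terms cancel in pairs unless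
  \<open>X = U\<close>.\<close>

lemma alternating_sum_supersets:
  fixes U X :: "'b set"
  assumes "finite U" "X \<subseteq> U"
  shows "(\<Sum>S\<in>Pow U. (-1) ^ (card U - card S) * of_bool (X \<subseteq> S)) = (of_bool (X = U) :: real)"
proof (cases "X = U")
  case True
  have "(\<Sum>S\<in>Pow U. (-1) ^ (card U - card S) * of_bool (X \<subseteq> S) :: real)
      = (\<Sum>S\<in>{U}. (-1) ^ (card U - card S) * of_bool (X \<subseteq> S))"
    using assms True by (intro sum.mono_neutral_right) auto
  then show ?thesis using True by simp
next
  case False
  then obtain a where a: "a \<in> U" "a \<notin> X" using assms(2) by auto
  define A where "A = U - {a}"
  have U: "U = insert a A" "a \<notin> A" "finite A" using a assms(1) by (auto simp: A_def)
  have "(\<Sum>S\<in>Pow U. (-1) ^ (card U - card S) * of_bool (X \<subseteq> S) :: real)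
      = (\<Sum>S\<in>Pow A. (-1) ^ (card U - card S) * of_bool (X \<subseteq> S)
          + (-1) ^ (card U - card (insert a S)) * of_bool (X \<subseteq> insert a S))"
    unfolding U(1) using U(2,3) by (subst sum_Pow_insert) (simp_all add: sum.distrib)
  also have "\<dots> = 0"
  proof (rule sum.neutral, safe)
    fix S assume S: "S \<subseteq> A"
    then have fS: "finite S" "a \<notin> S" using U finite_subset by auto
    have "card S \<le> card A" using S U card_mono by blast
    then have "card U - card S = Suc (card U - card (insert a S))" using U fS by simp
    moreover have "X \<subseteq> insert a S \<longleftrightarrow> X \<subseteq> S" using a by auto
    ultimately show "(-1) ^ (card U - card S) * of_bool (X \<subseteq> S)
          + (-1) ^ (card U - card (insert a S)) * of_bool (X \<subseteq> insert a S) = (0::real)"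
      by simp
  qed
  finally show ?thesis using False by simp
qed

text \<open>Two encodings of a bijection meet here: \<open>permutes\<close> fixes every point
  outside \<open>U\<close>, while a map in the dependent product is \<open>undefined\<close> there.
  On a finite set surjective self-maps are bijective.\<close>

lemma permutes_eq_PiE_surj:
  assumes "finite U"
  shows "bij_betw (\<lambda>\<sigma>. restrict \<sigma> U) {\<sigma>. \<sigma> permutes U} {g \<in> U \<rightarrow>\<^sub>E U. g ` U = U}"
proof (rule bij_betwI')
  fix \<sigma> \<tau> assume "\<sigma> \<in> {\<sigma>. \<sigma> permutes U}" "\<tau> \<in> {\<sigma>. \<sigma> permutes U}"
  then have p: "\<sigma> permutes U" "\<tau> permutes U" by auto
  show "(restrict \<sigma> U = restrict \<tau> U) = (\<sigma> = \<tau>)"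
  proof
    assume eq: "restrict \<sigma> U = restrict \<tau> U"
    show "\<sigma> = \<tau>"
    proof
      fix x show "\<sigma> x = \<tau> x"
        using p eq by (cases "x \<in> U") (metis restrict_apply', simp add: permutes_not_in)
    qed
  qed simp
next
  fix \<sigma> assume "\<sigma> \<in> {\<sigma>. \<sigma> permutes U}"
  then show "restrict \<sigma> U \<in> {g \<in> U \<rightarrow>\<^sub>E U. g ` U = U}"
    by (auto simp: permutes_in_image permutes_image)
next
  fix g assume "g \<in> {g \<in> U \<rightarrow>\<^sub>E U. g ` U = U}"
  then have g: "g \<in> U \<rightarrow>\<^sub>E U" "g ` U = U" by auto
  then have "bij_betw g U U"
    using assms by (simp add: bij_betw_def eq_card_imp_inj_on)
  define \<sigma> where "\<sigma> = (\<lambda>x. if x \<in> U then g x else x)"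
  have "bij_betw \<sigma> U U"
    using \<open>bij_betw g U U\<close> by (subst bij_betw_cong[of U \<sigma> g]) (auto simp: \<sigma>_def)
  then have "\<sigma> permutes U"
    by (rule bij_imp_permutes) (auto simp: \<sigma>_def)
  moreover have "g = restrict \<sigma> U"
    using g by (auto simp: \<sigma>_def fun_eq_iff PiE_def extensional_def)
  ultimately show "\<exists>\<sigma>\<in>{\<sigma>. \<sigma> permutes U}. g = restrict \<sigma> U" by blast
qed

text \<open>Ryser's formula for the permanent. Each product expands into a sum over maps
  \<open>g\<close> with values in \<open>S\<close>; inclusion-exclusion over \<open>S\<close>
  retains only the surjective ones, that is, the permutations.\<close>

lemma Ryser:
  fixes a :: "'b \<Rightarrow> 'b \<Rightarrow> real"
  assumes fin: "finite U"
  shows "(\<Sum>S\<in>Pow U. (-1) ^ (card U - card S) * (\<Prod>k\<in>U. \<Sum>l\<in>S. a k l))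
       = (\<Sum>\<sigma> | \<sigma> permutes U. \<Prod>k\<in>U. a k (\<sigma> k))"
proof -
  have fS: "finite S" if "S \<in> Pow U" for S using that fin finite_subset by auto
  have "(\<Prod>k\<in>U. \<Sum>l\<in>S. a k l) = (\<Sum>g\<in>U \<rightarrow>\<^sub>E U. of_bool (g ` U \<subseteq> S) * (\<Prod>k\<in>U. a k (g k)))"
    if S: "S \<in> Pow U" for S
  proof -
    have "(\<Prod>k\<in>U. \<Sum>l\<in>S. a k l) = (\<Sum>g\<in>U \<rightarrow>\<^sub>E S. \<Prod>k\<in>U. a k (g k))"
      using fin fS[OF S] by (simp add: prod_sum_PiE)
    also have "\<dots> = (\<Sum>g\<in>U \<rightarrow>\<^sub>E U. of_bool (g ` U \<subseteq> S) * (\<Prod>k\<in>U. a k (g k)))"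
    proof (rule sum.mono_neutral_cong_left)
      show "U \<rightarrow>\<^sub>E S \<subseteq> U \<rightarrow>\<^sub>E U" using S by (auto simp: PiE_def Pi_def)
    qed (use fin in \<open>auto intro!: finite_PiE simp: image_subset_iff PiE_iff\<close>)
    finally show ?thesis .
  qed
  then have "(\<Sum>S\<in>Pow U. (-1) ^ (card U - card S) * (\<Prod>k\<in>U. \<Sum>l\<in>S. a k l))
      = (\<Sum>S\<in>Pow U. \<Sum>g\<in>U \<rightarrow>\<^sub>E U.
          (-1) ^ (card U - card S) * of_bool (g ` U \<subseteq> S) * (\<Prod>k\<in>U. a k (g k)))"
    by (simp add: sum_distrib_left mult.assoc)
  also have "\<dots> = (\<Sum>g\<in>U \<rightarrow>\<^sub>E U.
      (\<Sum>S\<in>Pow U. (-1) ^ (card U - card S) * of_bool (g ` U \<subseteq> S)) * (\<Prod>k\<in>U. a k (g k)))"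
    by (subst sum.swap) (simp add: sum_distrib_right)
  also have "\<dots> = (\<Sum>g\<in>U \<rightarrow>\<^sub>E U. of_bool (g ` U = U) * (\<Prod>k\<in>U. a k (g k)))"
    by (intro sum.cong refl, subst alternating_sum_supersets) (use fin in auto)
  also have "\<dots> = (\<Sum>g\<in>{g \<in> U \<rightarrow>\<^sub>E U. g ` U = U}. \<Prod>k\<in>U. a k (g k))"
    using fin by (intro sum.mono_neutral_cong_right) (auto intro!: finite_PiE)
  also have "\<dots> = (\<Sum>\<sigma> | \<sigma> permutes U. \<Prod>k\<in>U. a k (\<sigma> k))"
    by (subst sum.reindex_bij_betw[OF permutes_eq_PiE_surj[OF fin], symmetric]) simp
  finally show ?thesis .
qed

lemma sum_PiE_permute:
  fixes f :: "('b \<Rightarrow> 'c) \<Rightarrow> real"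
  assumes "\<sigma> permutes U"
  shows "(\<Sum>g\<in>U \<rightarrow>\<^sub>E I. f (g \<circ> \<sigma>)) = (\<Sum>g\<in>U \<rightarrow>\<^sub>E I. f g)"
proof (rule sum.reindex_bij_witness[where i = "\<lambda>g. g \<circ> inv \<sigma>" and j = "\<lambda>g. g \<circ> \<sigma>"])
  have in1: "g \<circ> \<tau> \<in> U \<rightarrow>\<^sub>E I" if "g \<in> U \<rightarrow>\<^sub>E I" "\<tau> permutes U" for g \<tau>
    using that by (auto simp: PiE_iff extensional_def permutes_in_image)
  fix g assume g: "g \<in> U \<rightarrow>\<^sub>E I"
  show "g \<circ> \<sigma> \<in> U \<rightarrow>\<^sub>E I" "g \<circ> inv \<sigma> \<in> U \<rightarrow>\<^sub>E I"
    using in1 g assms permutes_inv by blast+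
  show "g \<circ> \<sigma> \<circ> inv \<sigma> = g" "g \<circ> inv \<sigma> \<circ> \<sigma> = g"
    using assms by (simp_all add: comp_assoc permutes_inv_o)
qed simp

text \<open>If \<open>G S\<close> is the value of a homogeneous polynomial of degree
  \<open>d\<close> at the sum of the vectors \<open>x k\<close> with \<open>k \<in> S\<close>, this
  is the associated symmetric \<open>d\<close>-linear form evaluated at \<open>x 0\<close>, ...,
  \<open>x (d - 1)\<close>.\<close>

definition polarize :: "nat \<Rightarrow> (nat set \<Rightarrow> real) \<Rightarrow> real" where
  "polarize d G = (\<Sum>S\<in>Pow {..<d}. (-1) ^ (d - card S) * G S) / fact d"

lemma polarize_sum:
  "polarize d (\<lambda>S. \<Sum>i\<in>A. G i S) = (\<Sum>i\<in>A. polarize d (G i))"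
  unfolding polarize_def sum_distrib_left sum_divide_distrib by (rule sum.swap)

lemma polarize_cmult: "polarize d (\<lambda>S. c * G S) = c * polarize d G"
  unfolding polarize_def by (simp add: sum_distrib_left mult_ac)

lemma polarize_cong: "(\<And>S. S \<subseteq> {..<d} \<Longrightarrow> G S = H S) \<Longrightarrow> polarize d G = polarize d H"
  unfolding polarize_def by (auto intro!: sum.cong arg_cong[where f = "\<lambda>x. x / fact d"])

lemma polarize_prod:
  "polarize d (\<lambda>S. \<Prod>k<d. \<Sum>l\<in>S. a k l) = (\<Sum>\<sigma> | \<sigma> permutes {..<d}. \<Prod>k<d. a k (\<sigma> k)) / fact d"
  unfolding polarize_def using Ryser[of "{..<d}" a] by simp

lemma polarize_permute:
  assumes "\<sigma> permutes {..<d}"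
  shows "polarize d (\<lambda>S. G (\<sigma> ` S)) = polarize d G"
proof -
  have i: "inj \<sigma>" using assms permutes_inj by blast
  have "(\<Sum>S\<in>Pow {..<d}. (-1) ^ (d - card S) * G (\<sigma> ` S))
      = (\<Sum>S\<in>Pow {..<d}. (-1) ^ (d - card S) * G S)"
  proof (rule sum.reindex_bij_witness[where j = "\<lambda>S. \<sigma> ` S" and i = "\<lambda>S. inv \<sigma> ` S"])
    show "\<sigma> ` S \<in> Pow {..<d}" "inv \<sigma> ` S \<in> Pow {..<d}" if "S \<in> Pow {..<d}" for S
      using that assms permutes_in_image[OF assms] permutes_in_image[OF permutes_inv[OF assms]] by auto
    show "inv \<sigma> ` \<sigma> ` S = S" "\<sigma> ` inv \<sigma> ` S = S" for S
      using assms by (simp_all add: image_comp permutes_inv_o)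
    show "(- 1) ^ (d - card (\<sigma> ` S)) * G (\<sigma> ` S) = (- 1) ^ (d - card S) * G (\<sigma> ` S)" for S
      using i by (simp add: card_image inj_on_subset)
  qed
  then show ?thesis by (simp add: polarize_def)
qed

text \<open>
  Equivalently, \<open>F\<close> agrees on the nonnegative orthant with a homogeneous polynomial of degree \<open>d\<close>.
  Since the condition is linear in \<open>F\<close> and only involves finitely many values of \<open>F\<close> for each
  \<open>t\<close>, it is inherited by pointwise limits and by integrals over parameters.
\<close>
definition hom_poly_on_orthant :: "nat \<Rightarrow> 'i set \<Rightarrow> (('i \<Rightarrow> real) \<Rightarrow> real) \<Rightarrow> bool" where
  "hom_poly_on_orthant d I F \<longleftrightarrow>
     (\<forall>t. (\<forall>i\<in>I. 0 \<le> t i) \<longrightarrow>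
       F t = (\<Sum>g\<in>{..<d} \<rightarrow>\<^sub>E I. (\<Prod>k<d. t (g k)) * polarize d (\<lambda>S. F (\<lambda>i. \<Sum>k\<in>S. of_bool (g k = i)))))"

text \<open>The base case from which all polynomiality is derived: a determinant is a combination of
  such products. Polarizing a product of linear forms yields a permanent divided by
  \<open>fact d\<close>, and summing over all \<open>g\<close> restores the expanded
  product.\<close>

lemma hom_poly_prod_linear:
  fixes I :: "'i set"
  assumes "finite I"
  shows "hom_poly_on_orthant d I (\<lambda>t. \<Prod>k<d. \<Sum>i\<in>I. t i * a k i)"
  unfolding hom_poly_on_orthant_def
proof (intro allI impI)
  fix t :: "'i \<Rightarrow> real"
  let ?U = "{..<d}"
  let ?P = "{\<sigma>. \<sigma> permutes ?U}"
  have "polarize d (\<lambda>S. \<Prod>k<d. \<Sum>i\<in>I. (\<Sum>l\<in>S. of_bool (g l = i)) * a k i)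
      = (\<Sum>\<sigma>\<in>?P. \<Prod>k<d. a k (g (\<sigma> k))) / fact d" if g: "g \<in> ?U \<rightarrow>\<^sub>E I" for g
  proof -
    have "(\<Sum>i\<in>I. (\<Sum>l\<in>S. of_bool (g l = i)) * a k i) = (\<Sum>l\<in>S. a k (g l))" if "S \<subseteq> ?U" for S k
    proof -
      have "(\<Sum>i\<in>I. (\<Sum>l\<in>S. of_bool (g l = i)) * a k i) = (\<Sum>l\<in>S. \<Sum>i\<in>I. of_bool (g l = i) * a k i)"
        by (subst sum.swap) (simp add: sum_distrib_right)
      also have "\<dots> = (\<Sum>l\<in>S. a k (g l))"
      proof (rule sum.cong[OF refl])
        fix l assume "l \<in> S"
        then have "g l \<in> I" using that g by (auto simp: PiE_iff)
        have "(\<Sum>i\<in>I. of_bool (g l = i) * a k i) = (\<Sum>i\<in>I. if g l = i then a k i else 0)"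
          by (intro sum.cong) auto
        then show "(\<Sum>i\<in>I. of_bool (g l = i) * a k i) = a k (g l)"
          using \<open>g l \<in> I\<close> assms by simp
      qed
      finally show ?thesis .
    qed
    then have "polarize d (\<lambda>S. \<Prod>k<d. \<Sum>i\<in>I. (\<Sum>l\<in>S. of_bool (g l = i)) * a k i)
        = polarize d (\<lambda>S. \<Prod>k<d. \<Sum>l\<in>S. a k (g l))"
      by (intro polarize_cong) simp
    then show ?thesis by (simp add: polarize_prod)
  qed
  then have "(\<Sum>g\<in>?U \<rightarrow>\<^sub>E I. (\<Prod>k<d. t (g k)) *
        polarize d (\<lambda>S. \<Prod>k<d. \<Sum>i\<in>I. (\<Sum>l\<in>S. of_bool (g l = i)) * a k i))
      = (\<Sum>g\<in>?U \<rightarrow>\<^sub>E I. \<Sum>\<sigma>\<in>?P. (\<Prod>k<d. t (g k)) * (\<Prod>k<d. a k (g (\<sigma> k))) / fact d)"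
    by (simp add: sum_distrib_left sum_divide_distrib cong: sum.cong)
  also have "\<dots> = (\<Sum>\<sigma>\<in>?P. \<Sum>g\<in>?U \<rightarrow>\<^sub>E I. (\<Prod>k<d. t (g k)) * (\<Prod>k<d. a k (g (\<sigma> k))) / fact d)"
    by (rule sum.swap)
  \<comment> \<open>The product of the \<open>t (g k)\<close> is invariant under permuting the
    slots, so each summand depends on \<open>g\<close> through \<open>g \<circ> \<sigma>\<close>
    only and every permutation contributes the same amount.\<close>
  also have "\<dots> = (\<Sum>\<sigma>\<in>?P. \<Sum>g\<in>?U \<rightarrow>\<^sub>E I. (\<Prod>k<d. t ((g \<circ> \<sigma>) k) * a k ((g \<circ> \<sigma>) k)) / fact d)"
  proof (intro sum.cong refl)
    fix \<sigma> g assume "\<sigma> \<in> ?P"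
    then have "(\<Prod>k<d. t (g k)) = (\<Prod>k<d. t (g (\<sigma> k)))"
      using prod.permute[of \<sigma> ?U "\<lambda>k. t (g k)"] by (simp add: o_def)
    then show "(\<Prod>k<d. t (g k)) * (\<Prod>k<d. a k (g (\<sigma> k))) / fact d
        = (\<Prod>k<d. t ((g \<circ> \<sigma>) k) * a k ((g \<circ> \<sigma>) k)) / fact d"
      by (simp add: prod.distrib)
  qed
  also have "\<dots> = (\<Sum>\<sigma>\<in>?P. \<Sum>g\<in>?U \<rightarrow>\<^sub>E I. (\<Prod>k<d. t (g k) * a k (g k)) / fact d)"
  proof (rule sum.cong[OF refl])
    fix \<sigma> assume "\<sigma> \<in> ?P"
    then show "(\<Sum>g\<in>?U \<rightarrow>\<^sub>E I. (\<Prod>k<d. t ((g \<circ> \<sigma>) k) * a k ((g \<circ> \<sigma>) k)) / fact d)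
        = (\<Sum>g\<in>?U \<rightarrow>\<^sub>E I. (\<Prod>k<d. t (g k) * a k (g k)) / fact d)"
      using sum_PiE_permute[of \<sigma> ?U "\<lambda>h. (\<Prod>k<d. t (h k) * a k (h k)) / fact d" I] by simp
  qed
  also have "\<dots> = (\<Sum>g\<in>?U \<rightarrow>\<^sub>E I. \<Prod>k<d. t (g k) * a k (g k))"
    by (simp add: card_permutations sum_divide_distrib[symmetric])
  also have "\<dots> = (\<Prod>k<d. \<Sum>i\<in>I. t i * a k i)"
    using assms by (subst prod_sum_PiE) auto
  finally show "(\<Prod>k<d. \<Sum>i\<in>I. t i * a k i) = (\<Sum>g\<in>?U \<rightarrow>\<^sub>E I. (\<Prod>k<d. t (g k)) *
        polarize d (\<lambda>S. \<Prod>k<d. \<Sum>i\<in>I. (\<Sum>l\<in>S. of_bool (g l = i)) * a k i))"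
    by simp
qed

lemma hom_poly_weighted_sum:
  fixes I :: "'i set"
  assumes "\<And>p. p \<in> A \<Longrightarrow> hom_poly_on_orthant d I (F p)"
  shows "hom_poly_on_orthant d I (\<lambda>t. \<Sum>p\<in>A. c p * F p t)"
  unfolding hom_poly_on_orthant_def
proof (intro allI impI)
  fix t :: "'i \<Rightarrow> real" assume t: "\<forall>i\<in>I. 0 \<le> t i"
  let ?w = "\<lambda>g::nat \<Rightarrow> 'i. \<lambda>S i. \<Sum>k\<in>S. (of_bool (g k = i) :: real)"
  have "(\<Sum>p\<in>A. c p * F p t) = (\<Sum>p\<in>A. c p * (\<Sum>g\<in>{..<d} \<rightarrow>\<^sub>E I. (\<Prod>k<d. t (g k)) *
      polarize d (\<lambda>S. F p (?w g S))))"
    using assms t unfolding hom_poly_on_orthant_def by (intro sum.cong) auto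
  also have "\<dots> = (\<Sum>g\<in>{..<d} \<rightarrow>\<^sub>E I. (\<Prod>k<d. t (g k)) * (\<Sum>p\<in>A. c p * polarize d (\<lambda>S. F p (?w g S))))"
    unfolding sum_distrib_left by (subst sum.swap) (simp add: mult_ac)
  also have "\<dots> = (\<Sum>g\<in>{..<d} \<rightarrow>\<^sub>E I. (\<Prod>k<d. t (g k)) * polarize d (\<lambda>S. \<Sum>p\<in>A. c p * F p (?w g S)))"
    by (simp add: polarize_sum polarize_cmult)
  finally show "(\<Sum>p\<in>A. c p * F p t) = \<dots>" .
qed

lemma hom_poly_LIMSEQ:
  fixes I :: "'i set"
  assumes "\<And>n. hom_poly_on_orthant d I (F n)"
    and "\<And>t. (\<And>i. 0 \<le> t i) \<Longrightarrow> (\<lambda>n. F n t) \<longlonglongrightarrow> G t"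
    and "\<And>t t' n. (\<And>i. i \<in> I \<Longrightarrow> t i = t' i) \<Longrightarrow> F n t = F n t'"
    and "\<And>t t'. (\<And>i. i \<in> I \<Longrightarrow> t i = t' i) \<Longrightarrow> G t = G t'"
  shows "hom_poly_on_orthant d I G"
  unfolding hom_poly_on_orthant_def
proof (intro allI impI)
  fix t :: "'i \<Rightarrow> real" assume t: "\<forall>i\<in>I. 0 \<le> t i"
  let ?w = "\<lambda>g::nat \<Rightarrow> 'i. \<lambda>S i. \<Sum>k\<in>S. (of_bool (g k = i) :: real)"
  \<comment> \<open>The weights are nonnegative on \<open>I\<close> only, whereas convergence is
    assumed for weights nonnegative everywhere; truncation outside \<open>I\<close> changes neither
    \<open>F n\<close> nor \<open>G\<close>.\<close>
  let ?t = "\<lambda>i. max 0 (t i)"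
  have "F n t = (\<Sum>g\<in>{..<d} \<rightarrow>\<^sub>E I. (\<Prod>k<d. t (g k)) * polarize d (\<lambda>S. F n (?w g S)))" for n
    using assms(1) t unfolding hom_poly_on_orthant_def by blast
  moreover have "(\<lambda>n. \<Sum>g\<in>{..<d} \<rightarrow>\<^sub>E I. (\<Prod>k<d. t (g k)) * polarize d (\<lambda>S. F n (?w g S)))
     \<longlonglongrightarrow> (\<Sum>g\<in>{..<d} \<rightarrow>\<^sub>E I. (\<Prod>k<d. t (g k)) * polarize d (\<lambda>S. G (?w g S)))"
    unfolding polarize_def by (intro tendsto_intros assms(2)) (auto intro: sum_nonneg)
  moreover have "(\<lambda>n. F n t) \<longlonglongrightarrow> G t"
  proof -
    have "F n t = F n ?t" for n by (rule assms(3)) (use t in auto)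
    moreover have "G t = G ?t" by (rule assms(4)) (use t in auto)
    ultimately show ?thesis using assms(2)[of ?t] by simp
  qed
  ultimately show "G t = (\<Sum>g\<in>{..<d} \<rightarrow>\<^sub>E I. (\<Prod>k<d. t (g k)) * polarize d (\<lambda>S. G (?w g S)))"
    using LIMSEQ_unique by simp
qed

section \<open>Volumes of Minkowski combinations of polytopes\<close>

lemma hom_poly_has_integral:
  fixes I :: "'i set" and f :: "'n::euclidean_space \<Rightarrow> ('i \<Rightarrow> real) \<Rightarrow> real"
  assumes "\<And>x. hom_poly_on_orthant d I (f x)"
    and int: "\<And>t. (\<And>i. i \<in> I \<Longrightarrow> 0 \<le> t i) \<Longrightarrow> ((\<lambda>x. f x t) has_integral F t) S"
  shows "hom_poly_on_orthant d I F"
  unfolding hom_poly_on_orthant_def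
proof (intro allI impI)
  fix t :: "'i \<Rightarrow> real" assume t: "\<forall>i\<in>I. 0 \<le> t i"
  let ?w = "\<lambda>g::nat \<Rightarrow> 'i. \<lambda>S i. \<Sum>k\<in>S. (of_bool (g k = i) :: real)"
  have "((\<lambda>x. \<Sum>g\<in>{..<d} \<rightarrow>\<^sub>E I. (\<Prod>k<d. t (g k)) * polarize d (\<lambda>S. f x (?w g S)))
     has_integral (\<Sum>g\<in>{..<d} \<rightarrow>\<^sub>E I. (\<Prod>k<d. t (g k)) * polarize d (\<lambda>S. F (?w g S)))) S"
    unfolding polarize_def
  \<comment> \<open>If the set of maps is infinite, both sums are \<open>0\<close> by convention and
    the claim is that \<open>0\<close> integrates to \<open>0\<close>.\<close>
  proof (cases "finite ({..<d} \<rightarrow>\<^sub>E I)")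
    case True
    then show "((\<lambda>x. \<Sum>g\<in>{..<d} \<rightarrow>\<^sub>E I. (\<Prod>k<d. t (g k)) *
          ((\<Sum>S\<in>Pow {..<d}. (-1) ^ (d - card S) * f x (?w g S)) / fact d))
     has_integral (\<Sum>g\<in>{..<d} \<rightarrow>\<^sub>E I. (\<Prod>k<d. t (g k)) *
          ((\<Sum>S\<in>Pow {..<d}. (-1) ^ (d - card S) * F (?w g S)) / fact d))) S"
      by (intro has_integral_sum has_integral_mult_right has_integral_divide int) (auto intro: sum_nonneg)
  qed simp
  moreover have "f x t = (\<Sum>g\<in>{..<d} \<rightarrow>\<^sub>E I. (\<Prod>k<d. t (g k)) * polarize d (\<lambda>S. f x (?w g S)))" for x
    using assms(1)[of x] t unfolding hom_poly_on_orthant_def by blast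
  ultimately have "((\<lambda>x. f x t) has_integral
      (\<Sum>g\<in>{..<d} \<rightarrow>\<^sub>E I. (\<Prod>k<d. t (g k)) * polarize d (\<lambda>S. F (?w g S)))) S"
    by simp
  moreover have "((\<lambda>x. f x t) has_integral F t) S" using int t by blast
  ultimately show "F t = (\<Sum>g\<in>{..<d} \<rightarrow>\<^sub>E I. (\<Prod>k<d. t (g k)) * polarize d (\<lambda>S. F (?w g S)))"
    using has_integral_unique by blast
qed

section \<open>Minkowski combinations\<close>

definition minkowski_comb :: "'i set \<Rightarrow> ('i \<Rightarrow> real) \<Rightarrow> ('i \<Rightarrow> 'a::euclidean_space set) \<Rightarrow> 'a set" where
  "minkowski_comb I t K = (\<Sum>i\<in>I. (\<lambda>x. t i *\<^sub>R x) ` K i)"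

lemma mem_minkowski_comb:
  assumes "finite I"
  shows "x \<in> minkowski_comb I t K \<longleftrightarrow> (\<exists>s. (\<forall>i\<in>I. s i \<in> K i) \<and> x = (\<Sum>i\<in>I. t i *\<^sub>R s i))"
proof
  assume "x \<in> minkowski_comb I t K"
  then obtain s where s: "\<forall>i\<in>I. s i \<in> (\<lambda>x. t i *\<^sub>R x) ` K i" "x = sum s I"
    unfolding minkowski_comb_def set_sum_alt[OF assms] by auto
  then have "\<forall>i\<in>I. \<exists>y. y \<in> K i \<and> s i = t i *\<^sub>R y" by auto
  then obtain r where "\<forall>i\<in>I. r i \<in> K i \<and> s i = t i *\<^sub>R r i" by metis
  then show "\<exists>s. (\<forall>i\<in>I. s i \<in> K i) \<and> x = (\<Sum>i\<in>I. t i *\<^sub>R s i)" using s by auto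
qed (auto simp: minkowski_comb_def set_sum_alt[OF assms])

lemma compact_set_plus:
  fixes K L :: "'a::euclidean_space set"
  assumes "compact K" "compact L"
  shows "compact (K + L)"
proof -
  have "K + L = {x + y |x y. x \<in> K \<and> y \<in> L}" unfolding set_plus_def by blast
  then show ?thesis using compact_sums[OF assms] by simp
qed

lemma convex_body_set_plus: "convex_body K \<Longrightarrow> convex_body L \<Longrightarrow> convex_body (K + L)"
  using compact_set_plus[of K L] convex_set_plus[of K L] by (auto simp: convex_body_def set_plus_def)

lemma convex_body_singleton: "convex_body {x}"
  by (simp add: convex_body_def)

lemma convex_body_sum: "(\<And>i. i \<in> I \<Longrightarrow> convex_body (K i)) \<Longrightarrow> convex_body (\<Sum>i\<in>I. K i)"
proof (induction I rule: infinite_finite_induct)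
  case (insert x F)
  then show ?case by (simp add: convex_body_set_plus)
qed (use convex_body_singleton[of 0] in \<open>simp_all add: set_zero\<close>)

lemma convex_body_scale: "convex_body K \<Longrightarrow> convex_body ((\<lambda>x. c *\<^sub>R x) ` K)"
  by (simp add: convex_body_def compact_scaling convex_scaling)

lemma convex_body_minkowski_comb:
  "(\<And>i. i \<in> I \<Longrightarrow> convex_body (K i)) \<Longrightarrow> convex_body (minkowski_comb I t K)"
  unfolding minkowski_comb_def by (intro convex_body_sum convex_body_scale)

lemma convex_body_hull: "finite A \<Longrightarrow> A \<noteq> {} \<Longrightarrow> convex_body (convex hull A)"
  by (simp add: convex_body_def finite_imp_compact_convex_hull)

section \<open>Gibbs distributions on a vertex set and the gradient of log-sum-exp\<close>

definition gibbs :: "'a::euclidean_space set \<Rightarrow> 'a \<Rightarrow> 'a \<Rightarrow> real" where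
  "gibbs A x a = exp (x \<bullet> a) / (\<Sum>b\<in>A. exp (x \<bullet> b))"

text \<open>The mean of the probability distribution on \<open>A\<close> with weights proportional
  to \<open>exp (x \<bullet> a)\<close>; it is the gradient at \<open>x\<close> of the logarithm of
  the partition function.\<close>

definition gibbs_mean :: "'a::euclidean_space set \<Rightarrow> 'a \<Rightarrow> 'a" where
  "gibbs_mean A x = (\<Sum>a\<in>A. gibbs A x a *\<^sub>R a)"

text \<open>The covariance matrix of the Gibbs distribution applied to \<open>h\<close>, hence the
  Hessian of log-sum-exp. Only one of the two factors is centred; this form is what differentiating
  the weights produces directly.\<close>

definition gibbs_cov :: "'a::euclidean_space set \<Rightarrow> 'a \<Rightarrow> 'a \<Rightarrow> 'a" where
  "gibbs_cov A x h = (\<Sum>a\<in>A. (gibbs A x a * ((a - gibbs_mean A x) \<bullet> h)) *\<^sub>R a)"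

lemma sum_exp_pos: "finite A \<Longrightarrow> A \<noteq> {} \<Longrightarrow> 0 < (\<Sum>b\<in>A. exp (x \<bullet> b :: real))"
  by (intro sum_pos) auto

lemma gibbs_pos: "finite A \<Longrightarrow> A \<noteq> {} \<Longrightarrow> 0 < gibbs A x a"
  unfolding gibbs_def using sum_exp_pos by (intro divide_pos_pos) auto

lemma sum_gibbs: "finite A \<Longrightarrow> A \<noteq> {} \<Longrightarrow> (\<Sum>a\<in>A. gibbs A x a) = 1"
  unfolding gibbs_def using sum_exp_pos[of A x] by (simp flip: sum_divide_distrib)

lemma gibbs_mean_in_hull: "finite A \<Longrightarrow> A \<noteq> {} \<Longrightarrow> gibbs_mean A x \<in> convex hull A"
  unfolding gibbs_mean_def
  by (intro convex_sum) (auto simp: sum_gibbs less_imp_le[OF gibbs_pos] hull_inc)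

lemma has_derivative_log_sum_exp:
  assumes "finite A" "A \<noteq> {}"
  shows "((\<lambda>x. ln (\<Sum>b\<in>A. exp (x \<bullet> b))) has_derivative (\<lambda>h. h \<bullet> gibbs_mean A x)) (at x)"
proof -
  define Z where "Z = (\<Sum>b\<in>A. exp (x \<bullet> b))"
  have Z: "Z > 0" using sum_exp_pos[OF assms] by (simp add: Z_def)
  have "((\<lambda>x. \<Sum>b\<in>A. exp (x \<bullet> b)) has_derivative (\<lambda>h. \<Sum>b\<in>A. exp (x \<bullet> b) * (h \<bullet> b))) (at x)"
    by (auto intro!: derivative_eq_intros simp: mult.commute)
  then have "((\<lambda>x. ln (\<Sum>b\<in>A. exp (x \<bullet> b))) has_derivative
      (\<lambda>h. (\<Sum>b\<in>A. exp (x \<bullet> b) * (h \<bullet> b)) * inverse Z)) (at x)"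
    unfolding Z_def by (intro has_derivative_ln) (use Z in \<open>simp_all add: Z_def\<close>)
  moreover have "(\<Sum>b\<in>A. exp (x \<bullet> b) * (h \<bullet> b)) * inverse Z = h \<bullet> gibbs_mean A x" for h
    by (simp add: gibbs_mean_def gibbs_def Z_def inner_sum_right sum_distrib_left divide_inverse mult_ac)
  ultimately show ?thesis by simp
qed

lemma has_derivative_gibbs:
  assumes "finite A" "A \<noteq> {}"
  shows "((\<lambda>x. gibbs A x a) has_derivative (\<lambda>h. gibbs A x a * ((a - gibbs_mean A x) \<bullet> h))) (at x)"
proof -
  have eq: "gibbs A y a = exp (y \<bullet> a - ln (\<Sum>b\<in>A. exp (y \<bullet> b)))" for y
    using sum_exp_pos[OF assms, of y] by (simp add: gibbs_def exp_diff)
  have "((\<lambda>x. exp (x \<bullet> a - ln (\<Sum>b\<in>A. exp (x \<bullet> b)))) has_derivative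
      (\<lambda>h. gibbs A x a * (h \<bullet> a - h \<bullet> gibbs_mean A x))) (at x)"
    unfolding eq
    by (rule has_derivative_eq_rhs, rule has_derivative_exp, rule has_derivative_diff,
        rule has_derivative_inner_left, rule has_derivative_ident, rule has_derivative_log_sum_exp[OF assms])
       (simp add: mult.commute)
  moreover have "h \<bullet> a - h \<bullet> gibbs_mean A x = (a - gibbs_mean A x) \<bullet> h" for h
    by (metis inner_diff_left inner_commute)
  ultimately show ?thesis by (simp add: eq)
qed

lemma has_derivative_gibbs_mean:
  assumes "finite A" "A \<noteq> {}"
  shows "(gibbs_mean A has_derivative gibbs_cov A x) (at x)"
proof -
  have "((\<lambda>x. \<Sum>a\<in>A. gibbs A x a *\<^sub>R a) has_derivative
      (\<lambda>h. \<Sum>a\<in>A. (gibbs A x a * ((a - gibbs_mean A x) \<bullet> h)) *\<^sub>R a)) (at x)"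
    by (intro has_derivative_sum has_derivative_scaleR_left has_derivative_gibbs assms)
  then show ?thesis by (simp add: gibbs_mean_def[abs_def] gibbs_cov_def[abs_def])
qed

text \<open>The centred variable has mean \<open>0\<close>, so replacing the other factor
  \<open>a \<bullet> h\<close> by its centred version does not change the sum; the quadratic form is
  the variance of \<open>a \<bullet> h\<close>.\<close>

lemma inner_gibbs_cov:
  assumes "finite A" "A \<noteq> {}"
  shows "h \<bullet> gibbs_cov A x h = (\<Sum>a\<in>A. gibbs A x a * ((a - gibbs_mean A x) \<bullet> h)\<^sup>2)"
proof -
  let ?m = "gibbs_mean A x"
  have "(\<Sum>a\<in>A. gibbs A x a * ((a - ?m) \<bullet> h)) = (\<Sum>a\<in>A. gibbs A x a *\<^sub>R a) \<bullet> h - (\<Sum>a\<in>A. gibbs A x a) * (?m \<bullet> h)"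
    by (simp add: inner_diff_left inner_sum_left algebra_simps sum_subtractf sum_distrib_right)
  also have "\<dots> = 0"
    using sum_gibbs[OF assms] by (simp add: gibbs_mean_def)
  finally have 0: "(\<Sum>a\<in>A. gibbs A x a * ((a - ?m) \<bullet> h)) = 0" .
  have "h \<bullet> gibbs_cov A x h = (\<Sum>a\<in>A. gibbs A x a * ((a - ?m) \<bullet> h) * (a \<bullet> h))"
    by (simp add: gibbs_cov_def inner_sum_right inner_commute)
  also have "\<dots> = (\<Sum>a\<in>A. gibbs A x a * ((a - ?m) \<bullet> h)\<^sup>2 + (?m \<bullet> h) * (gibbs A x a * ((a - ?m) \<bullet> h)))"
    by (intro sum.cong refl) (simp add: power2_eq_square inner_diff_left algebra_simps)
  also have "\<dots> = (\<Sum>a\<in>A. gibbs A x a * ((a - ?m) \<bullet> h)\<^sup>2)"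
    using 0 by (simp add: sum.distrib flip: sum_distrib_left)
  finally show ?thesis .
qed

lemma inner_gibbs_cov_nonneg:
  assumes "finite A" "A \<noteq> {}"
  shows "0 \<le> h \<bullet> gibbs_cov A x h"
  unfolding inner_gibbs_cov[OF assms] using less_imp_le[OF gibbs_pos[OF assms]] by (intro sum_nonneg) auto

text \<open>All weights are positive, so a vanishing variance makes \<open>a \<bullet> h\<close>
  constant on \<open>A\<close>. The hull would then lie in a hyperplane and have empty
  interior.\<close>

lemma inner_gibbs_cov_pos:
  assumes "finite A" "interior (convex hull A) \<noteq> {}" "h \<noteq> 0"
  shows "0 < h \<bullet> gibbs_cov A x h"
proof (rule ccontr)
  have ne: "A \<noteq> {}" using assms(2) by auto
  assume "\<not> 0 < h \<bullet> gibbs_cov A x h"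
  then have "(\<Sum>a\<in>A. gibbs A x a * ((a - gibbs_mean A x) \<bullet> h)\<^sup>2) = 0"
    using inner_gibbs_cov_nonneg[OF assms(1) ne, of h x] inner_gibbs_cov[OF assms(1) ne, of h x] by linarith
  then have "\<forall>a\<in>A. gibbs A x a * ((a - gibbs_mean A x) \<bullet> h)\<^sup>2 = 0"
    using less_imp_le[OF gibbs_pos[OF assms(1) ne]] assms(1) by (subst (asm) sum_nonneg_eq_0_iff) auto
  then have "A \<subseteq> {y. h \<bullet> y = h \<bullet> gibbs_mean A x}"
    using less_imp_neq[OF gibbs_pos[OF assms(1) ne, of x]] by (auto simp: inner_diff_left inner_commute[of h])
  then have "convex hull A \<subseteq> {y. h \<bullet> y = h \<bullet> gibbs_mean A x}"
    by (intro hull_minimal convex_hyperplane)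
  then have "interior (convex hull A) \<subseteq> interior {y. h \<bullet> y = h \<bullet> gibbs_mean A x}"
    by (rule interior_mono)
  then show False using assms(2,3) by (simp add: interior_hyperplane)
qed

lemma inner_le_log_sum_exp:
  assumes "finite A" "c \<in> convex hull A"
  shows "x \<bullet> c \<le> ln (\<Sum>a\<in>A. exp (x \<bullet> a))"
proof -
  have ne: "A \<noteq> {}" using assms by auto
  have "A \<subseteq> {y. x \<bullet> y \<le> ln (\<Sum>a\<in>A. exp (x \<bullet> a))}"
  proof safe
    fix a assume "a \<in> A"
    then have "exp (x \<bullet> a) \<le> (\<Sum>a\<in>A. exp (x \<bullet> a))"
      using assms(1) by (intro member_le_sum) auto
    then show "x \<bullet> a \<le> ln (\<Sum>a\<in>A. exp (x \<bullet> a))"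
      using sum_exp_pos[OF assms(1) ne, of x] by (simp add: ln_ge_iff)
  qed
  then have "convex hull A \<subseteq> {y. x \<bullet> y \<le> ln (\<Sum>a\<in>A. exp (x \<bullet> a))}"
    by (intro hull_minimal convex_halfspace_le)
  then show ?thesis using assms(2) by auto
qed

text \<open>The equation says that \<open>x\<close> is a critical point of the potential
  \<open>\<Psi>\<close>, which is the combined log-sum-exp minus the linear form
  \<open>x \<bullet> z\<close>. Since \<open>z\<close> is interior, \<open>\<Psi>\<close> grows at
  least linearly and attains a minimum.\<close>

lemma interior_subset_range_gibbs_mean:
  fixes A :: "'i \<Rightarrow> 'a::euclidean_space set"
  assumes I: "finite I" and A: "\<And>i. i \<in> I \<Longrightarrow> finite (A i) \<and> A i \<noteq> {}"
    and t: "\<And>i. i \<in> I \<Longrightarrow> 0 \<le> t i"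
    and z: "z \<in> interior (minkowski_comb I t (\<lambda>i. convex hull (A i)))"
  shows "\<exists>x. (\<Sum>i\<in>I. t i *\<^sub>R gibbs_mean (A i) x) = z"
proof -
  define C where "C = minkowski_comb I t (\<lambda>i. convex hull (A i))"
  define \<Psi> where "\<Psi> = (\<lambda>x. (\<Sum>i\<in>I. t i * ln (\<Sum>a\<in>A i. exp (x \<bullet> a))) - x \<bullet> z)"
  obtain r where r: "r > 0" "cball z r \<subseteq> C"
    using z by (auto simp: C_def mem_interior_cball)
  have coercive: "r * norm x \<le> \<Psi> x" for x
  proof -
    \<comment> \<open>Testing against the point of \<open>C\<close> at distance \<open>r\<close>
      from \<open>z\<close> in the direction of \<open>x\<close> produces the linear growth:
      log-sum-exp dominates the support function of each hull.\<close>
    have "z + r *\<^sub>R sgn x \<in> C"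
      using r by (intro subsetD[OF r(2)]) (simp add: dist_norm norm_sgn)
    then obtain s where s: "\<forall>i\<in>I. s i \<in> convex hull (A i)" "z + r *\<^sub>R sgn x = (\<Sum>i\<in>I. t i *\<^sub>R s i)"
      unfolding C_def mem_minkowski_comb[OF I] by auto
    have "x \<bullet> sgn x = norm x"
      by (simp add: sgn_div_norm power2_norm_eq_inner[symmetric] power2_eq_square divide_simps)
    then have "x \<bullet> z + r * norm x = x \<bullet> (z + r *\<^sub>R sgn x)"
      by (simp add: inner_add_right)
    also have "\<dots> = (\<Sum>i\<in>I. t i * (x \<bullet> s i))"
      by (simp add: s(2) inner_sum_right)
    also have "\<dots> \<le> (\<Sum>i\<in>I. t i * ln (\<Sum>a\<in>A i. exp (x \<bullet> a)))"
      using s(1) A t by (intro sum_mono mult_left_mono inner_le_log_sum_exp) auto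
    finally show ?thesis by (simp add: \<Psi>_def)
  qed
  have der: "(\<Psi> has_derivative (\<lambda>h. h \<bullet> ((\<Sum>i\<in>I. t i *\<^sub>R gibbs_mean (A i) x) - z))) (at x)" for x
  proof -
    have "(\<Psi> has_derivative (\<lambda>h. (\<Sum>i\<in>I. t i * (h \<bullet> gibbs_mean (A i) x)) - h \<bullet> z)) (at x)"
      unfolding \<Psi>_def using A
      by (intro has_derivative_diff has_derivative_sum has_derivative_mult_right has_derivative_log_sum_exp
          has_derivative_inner_left has_derivative_ident) auto
    then show ?thesis by (simp add: inner_diff_right inner_sum_right)
  qed
  \<comment> \<open>With this radius, coercivity gives
    \<open>\<Psi> y \<ge> \<bar>\<Psi> 0\<bar> + 1\<close> outside the ball, so a minimum over the
    ball is global.\<close>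
  define R where "R = (\<bar>\<Psi> 0\<bar> + 1) / r"
  have R: "R > 0" using r by (simp add: R_def)
  have "continuous_on (cball 0 R) \<Psi>"
    using der by (meson continuous_at_imp_continuous_on has_derivative_continuous)
  then obtain x where x: "x \<in> cball 0 R" "\<And>y. y \<in> cball 0 R \<Longrightarrow> \<Psi> x \<le> \<Psi> y"
    using continuous_attains_inf[of "cball 0 R" \<Psi>] R by auto
  have min: "\<Psi> x \<le> \<Psi> y" for y
  proof (cases "y \<in> cball 0 R")
    case False
    then have "r * R \<le> r * norm y" using r by auto
    then have "\<Psi> 0 \<le> \<Psi> y" using coercive[of y] r by (simp add: R_def)
    then show ?thesis using x(2)[of 0] R by simp
  qed (use x in auto)
  then have "(\<lambda>h. h \<bullet> ((\<Sum>i\<in>I. t i *\<^sub>R gibbs_mean (A i) x) - z)) = (\<lambda>h. 0)"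
    by (intro differential_zero_maxmin[of x UNIV \<Psi>] der) auto
  then have "(\<Sum>i\<in>I. t i *\<^sub>R gibbs_mean (A i) x) - z = 0"
    by (meson inner_eq_zero_iff)
  then show ?thesis by auto
qed

text \<open>Along the segment from \<open>x\<close> to \<open>y\<close> with direction
  \<open>h\<close>, the function \<open>h \<bullet> f\<close> has positive derivative, so its values
  at the two ends differ.\<close>

lemma inj_positive_derivative:
  fixes f :: "'a::euclidean_space \<Rightarrow> 'a"
  assumes der: "\<And>x. (f has_derivative f' x) (at x)"
    and pos: "\<And>x h. h \<noteq> 0 \<Longrightarrow> 0 < h \<bullet> f' x h"
  shows "inj f"
proof (rule injI, rule ccontr)
  fix x y assume eq: "f x = f y" "x \<noteq> y"
  define h where "h = y - x"
  have h: "h \<noteq> 0" using eq by (simp add: h_def)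
  have d: "((\<lambda>s. h \<bullet> f (x + s *\<^sub>R h)) has_derivative (\<lambda>u. h \<bullet> f' (x + s *\<^sub>R h) (u *\<^sub>R h))) (at s)" for s
    by (intro has_derivative_inner_right has_derivative_compose[OF _ der, where f="\<lambda>s. x + s *\<^sub>R h"]
        derivative_eq_intros refl) auto
  have "((\<lambda>s. h \<bullet> f (x + s *\<^sub>R h)) has_real_derivative (h \<bullet> f' (x + s *\<^sub>R h) h)) (at s)" for s
    unfolding has_field_derivative_def
    by (rule has_derivative_eq_rhs[OF d])
      (simp add: fun_eq_iff linear_scale[OF bounded_linear.linear[OF has_derivative_bounded_linear[OF der]]])
  then have "h \<bullet> f (x + 0 *\<^sub>R h) < h \<bullet> f (x + 1 *\<^sub>R h)"
    using pos[OF h] by (intro DERIV_pos_imp_increasing[of 0 1 "\<lambda>s. h \<bullet> f (x + s *\<^sub>R h)"]) auto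
  then show False using eq by (simp add: h_def)
qed

lemma continuous_on_det:
  fixes M :: "'x::topological_space \<Rightarrow> real^'n^'n"
  assumes "continuous_on S M"
  shows "continuous_on S (\<lambda>x. det (M x))"
  unfolding det_def by (intro continuous_intros assms)

text \<open>On the line segment of matrices from the identity to \<open>N\<close> every matrix is
  positive definite, hence has trivial kernel. The determinant starts at \<open>1\<close> and cannot
  reach \<open>0\<close>.\<close>

lemma det_pos_of_positive_definite:
  fixes N :: "real^'n^'n"
  assumes "\<And>h. h \<noteq> 0 \<Longrightarrow> 0 < h \<bullet> (N *v h)"
  shows "0 < det N"
proof (rule ccontr)
  assume neg: "\<not> 0 < det N"
  define P where "P = (\<lambda>s::real. (1 - s) *\<^sub>R mat 1 + s *\<^sub>R N)"
  have "continuous_on {0..1} (\<lambda>s. det (P s))"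
    unfolding P_def by (intro continuous_on_det continuous_intros)
  moreover have "det (P 0) = 1" "det (P 1) \<le> 0" using neg by (simp_all add: P_def)
  ultimately obtain s where s: "0 \<le> s" "s \<le> 1" "det (P s) = 0"
    using IVT2'[of "\<lambda>s. det (P s)" 1 0 0] by auto
  then obtain h where h: "h \<noteq> 0" "P s *v h = 0"
    by (metis invertible_det_nz invertible_left_inverse matrix_left_invertible_ker)
  have "h \<bullet> (P s *v h) = (1 - s) * (h \<bullet> h) + s * (h \<bullet> (N *v h))"
    by (simp add: P_def matrix_vector_mult_add_rdistrib inner_add_right scaleR_matrix_vector_assoc[symmetric])
  moreover have "0 < h \<bullet> h" "0 < h \<bullet> (N *v h)" using h assms by auto
  ultimately have "0 < h \<bullet> (P s *v h)"
    using s by (cases "s = 0") (auto intro!: add_nonneg_pos)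
  then show False using h by simp
qed

lemma measure_convex_combination_hulls:
  fixes A :: "'i \<Rightarrow> (real^'n::{finite,wellorder}) set"
  assumes I: "finite I" and A: "\<And>i. i \<in> I \<Longrightarrow> finite (A i) \<and> interior (convex hull (A i)) \<noteq> {}"
    and t: "\<And>i. i \<in> I \<Longrightarrow> 0 \<le> t i"
  shows "((\<lambda>x. det (matrix (\<lambda>h. \<Sum>i\<in>I. t i *\<^sub>R gibbs_cov (A i) x h))) has_integral
    measure lebesgue (minkowski_comb I t (\<lambda>i. convex hull (A i)))) UNIV"
proof (cases "\<exists>i\<in>I. t i > 0")
  \<comment> \<open>All weights vanish: the combination lies in \<open>{0}\<close> and every matrix
    is zero, so both sides are \<open>0\<close>. A positive weight is what makes the gradient map
    injective in the other case.\<close>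
  case False
  then have t0: "t i = 0" if "i \<in> I" for i using t that by force
  have "minkowski_comb I t (\<lambda>i. convex hull (A i)) \<subseteq> {0}"
    using t0 by (auto simp: mem_minkowski_comb[OF I] intro!: sum.neutral)
  then have "measure lebesgue (minkowski_comb I t (\<lambda>i. convex hull (A i))) = 0"
    by (metis negligible_imp_measure0 negligible_sing negligible_subset)
  moreover have "det (0 :: real^('n::{finite,wellorder})^('n::{finite,wellorder})) = 0"
    using det_0[where 'a=real and 'n='n] by (simp add: mat_def vec_eq_iff flip: zero_vec_def)
  then have "(\<lambda>x. det (matrix (\<lambda>h. \<Sum>i\<in>I. t i *\<^sub>R gibbs_cov (A i) x h))) = (\<lambda>x. 0)"
    using t0 by (simp add: matrix_def flip: zero_vec_def)
  ultimately show ?thesis by simp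
next
  case True
  define C where "C = minkowski_comb I t (\<lambda>i. convex hull (A i))"
  define f where "f = (\<lambda>x. \<Sum>i\<in>I. t i *\<^sub>R gibbs_mean (A i) x)"
  define f' where "f' = (\<lambda>x h. \<Sum>i\<in>I. t i *\<^sub>R gibbs_cov (A i) x h)"
  have A': "finite (A i)" "A i \<noteq> {}" "interior (convex hull (A i)) \<noteq> {}" if "i \<in> I" for i
    using A[OF that] by auto
  have der: "(f has_derivative f' x) (at x)" for x
    unfolding f_def f'_def
    by (intro has_derivative_sum has_derivative_scaleR_right has_derivative_gibbs_mean A')
  have pos: "0 < h \<bullet> f' x h" if "h \<noteq> 0" for h x
  proof -
    obtain i where i: "i \<in> I" "t i > 0" using True by auto
    show ?thesis unfolding f'_def inner_sum_right
    proof (rule sum_pos2[OF I i(1)])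
      show "0 < h \<bullet> t i *\<^sub>R gibbs_cov (A i) x h"
        using i A' that by (simp add: inner_gibbs_cov_pos)
      show "0 \<le> h \<bullet> t i *\<^sub>R gibbs_cov (A i) x h" if "i \<in> I" for i
        using that t A' by (simp add: inner_gibbs_cov_nonneg)
    qed
  qed
  have inj: "inj f" by (rule inj_positive_derivative[OF der pos])
  have det: "0 < det (matrix (f' x))" for x
    using pos[of _ x] bounded_linear.linear[OF has_derivative_bounded_linear[OF der]]
    by (intro det_pos_of_positive_definite) (simp add: matrix_works)
  have C: "compact C" "convex C"
    using convex_body_minkowski_comb[of I "\<lambda>i. convex hull (A i)" t] A'
    by (auto simp: C_def convex_body_def finite_imp_compact_convex_hull)
  have sub1: "interior C \<subseteq> range f"
  proof
    fix z assume "z \<in> interior C"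
    then have "\<exists>x. f x = z"
      unfolding f_def C_def using A' t by (intro interior_subset_range_gibbs_mean[OF I]) simp_all
    then show "z \<in> range f" by auto
  qed
  have sub2: "range f \<subseteq> C"
  proof clarify
    fix x
    show "f x \<in> C"
      unfolding C_def f_def mem_minkowski_comb[OF I]
      by (rule exI[of _ "\<lambda>i. gibbs_mean (A i) x"]) (simp add: gibbs_mean_in_hull A')
  qed
  \<comment> \<open>The range of \<open>f\<close> is known only to lie between
    \<open>interior C\<close> and \<open>C\<close>; for a convex set these differ by a null
    set.\<close>
  have "negligible (frontier C)" by (rule negligible_convex_frontier[OF C(2)])
  then have neg: "negligible (C - range f)"
    by (rule negligible_subset) (use sub1 closure_subset[of C] in \<open>auto simp: frontier_def\<close>)
  have Cm: "C \<in> lmeasurable" using C(1) by (rule lmeasurable_compact)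
  have "C - range f \<union> (range f - C) = C - range f" using sub2 by auto
  then have rm: "range f \<in> lmeasurable" "measure lebesgue (range f) = measure lebesgue C"
    using neg by (auto intro: lmeasurable_negligible_symdiff[OF Cm] measure_negligible_symdiff[OF Cm])
  have "((\<lambda>x. \<bar>det (matrix (f' x))\<bar>) has_integral measure lebesgue C) UNIV"
    using has_measure_differentiable_image[of UNIV f f' "measure lebesgue C"] inj der rm by auto
  then show ?thesis using det by (simp add: f'_def[abs_def] C_def abs_of_pos)
qed

text \<open>In the Leibniz formula each permutation contributes a product with one linear form in
  \<open>t\<close> per row. The enumeration \<open>e\<close> turns row indices into the slots
  \<open>{..<d}\<close>.\<close>

lemma hom_poly_det:
  fixes L :: "'i \<Rightarrow> real^'n \<Rightarrow> real^'n"
  assumes "finite I"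
  shows "hom_poly_on_orthant CARD('n) I (\<lambda>t. det (matrix (\<lambda>h. \<Sum>i\<in>I. t i *\<^sub>R L i h)))"
proof -
  obtain e where e: "bij_betw e {..<CARD('n)} (UNIV :: 'n set)"
    using ex_bij_betw_nat_finite[of "UNIV :: 'n set"] by (auto simp: atLeast0LessThan)
  have "det (matrix (\<lambda>h. \<Sum>i\<in>I. t i *\<^sub>R L i h)) =
     (\<Sum>p | p permutes (UNIV :: 'n set). of_int (sign p) *
        (\<Prod>k<CARD('n). \<Sum>i\<in>I. t i * (L i (axis (p (e k)) 1) $ e k)))" for t
    unfolding det_def matrix_def
    by (subst prod.reindex_bij_betw[OF e, symmetric]) simp
  then show ?thesis
    using assms by (simp only:) (intro hom_poly_weighted_sum hom_poly_prod_linear)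
qed

lemma hom_poly_measure_hulls:
  fixes A :: "'i \<Rightarrow> (real^'n::{finite,wellorder}) set"
  assumes "finite I" "\<And>i. i \<in> I \<Longrightarrow> finite (A i) \<and> interior (convex hull (A i)) \<noteq> {}"
  shows "hom_poly_on_orthant CARD('n) I (\<lambda>t. measure lebesgue (minkowski_comb I t (\<lambda>i. convex hull (A i))))"
  by (rule hom_poly_has_integral[OF hom_poly_det measure_convex_combination_hulls]) (use assms in auto)

section \<open>Volumes of Minkowski combinations of convex bodies\<close>

lemma lborel_distr_basis_map:
  fixes h :: "'a::euclidean_space \<Rightarrow> 'b::euclidean_space"
  assumes h: "bij_betw h Basis Basis"
  defines "f \<equiv> \<lambda>x. \<Sum>b\<in>Basis. (x \<bullet> b) *\<^sub>R h b"
  shows "distr lborel borel f = lborel"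
proof (rule lborel_eqI[symmetric])
  have hin: "h b \<in> Basis" if "b \<in> Basis" for b using h that by (auto simp: bij_betw_def)
  have hinj: "h b = h c \<longleftrightarrow> b = c" if "b \<in> Basis" "c \<in> Basis" for b c
    using h that by (auto simp: bij_betw_def inj_on_def)
  have comp: "f x \<bullet> h c = x \<bullet> c" if "c \<in> Basis" for x c
  proof -
    have "f x \<bullet> h c = (\<Sum>b\<in>Basis. (x \<bullet> b) * (if b = c then 1 else 0))"
      unfolding f_def inner_sum_left using that hin hinj by (intro sum.cong) (auto simp: inner_Basis)
    then show ?thesis using that by (simp add: if_distrib cong: if_cong)
  qed
  have img: "(\<forall>b\<in>Basis. P b) \<longleftrightarrow> (\<forall>b\<in>Basis. P (h b))" for P
    using h by (metis bij_betw_def image_iff)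
  have meas: "f \<in> borel_measurable borel" unfolding f_def by measurable
  fix l u :: 'b assume lu: "\<And>b. b \<in> Basis \<Longrightarrow> l \<bullet> b \<le> u \<bullet> b"
  define l' where "l' = (\<Sum>b\<in>Basis. (l \<bullet> h b) *\<^sub>R b)"
  define u' where "u' = (\<Sum>b\<in>Basis. (u \<bullet> h b) *\<^sub>R b)"
  have "f -` box l u = box l' u'"
    by (auto simp: mem_box img[of "\<lambda>b. l \<bullet> b < _ \<bullet> b \<and> _ \<bullet> b < u \<bullet> b"] comp l'_def u'_def)
  then have "emeasure (distr lborel borel f) (box l u) = emeasure lborel (box l' u')"
    using meas by (subst emeasure_distr) auto
  also have "\<dots> = (\<Prod>b\<in>Basis. (u' - l') \<bullet> b)"
    using lu hin by (intro emeasure_lborel_box) (auto simp: l'_def u'_def)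
  also have "(\<Prod>b\<in>Basis. (u' - l') \<bullet> b) = (\<Prod>b\<in>Basis. (u - l) \<bullet> h b)"
    by (intro prod.cong) (auto simp: l'_def u'_def inner_diff_left)
  also have "\<dots> = (\<Prod>b\<in>Basis. (u - l) \<bullet> b)"
    by (rule prod.reindex_bij_betw[OF h])
  finally show "emeasure (distr lborel borel f) (box l u) = ennreal (\<Prod>b\<in>Basis. (u - l) \<bullet> b)" .
qed simp

lemma measure_lebesgue_compact:
  fixes S :: "'a::euclidean_space set"
  shows "compact S \<Longrightarrow> measure lebesgue S = measure lborel S"
  by (simp add: measure_def borel_compact)

lemma measure_compact_mono:
  fixes S T :: "'a::euclidean_space set"
  assumes "compact S" "compact T" "S \<subseteq> T"
  shows "measure lebesgue S \<le> measure lebesgue T"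
  using assms by (intro measure_mono_fmeasurable) (auto simp: lmeasurable_compact fmeasurableD)

lemma measure_lebesgue_distr_image:
  fixes f :: "'a::euclidean_space \<Rightarrow> 'b::euclidean_space"
  assumes f: "linear f" "inj f" "distr lborel borel f = lborel" and S: "compact S"
  shows "measure lebesgue (f ` S) = measure lebesgue S"
proof -
  have meas: "f \<in> borel_measurable borel"
    using f(1) by (intro borel_measurable_continuous_onI linear_continuous_on linear_linear[THEN iffD1])
      (simp add: linear_conv_bounded_linear)
  have c: "compact (f ` S)"
    using f(1) S by (intro compact_continuous_image linear_continuous_on) (simp_all add: linear_conv_bounded_linear)
  have "measure lebesgue (f ` S) = measure (distr lborel borel f) (f ` S)"
    using c f(3) by (simp add: measure_lebesgue_compact)
  also have "\<dots> = measure lborel (f -` f ` S)"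
    using meas c by (subst measure_distr) (auto simp: borel_compact)
  also have "f -` f ` S = S" using f(2) by (simp add: inj_vimage_image_eq)
  finally show ?thesis using S by (simp add: measure_lebesgue_compact)
qed

text \<open>
  The change of variables theorem is available on \<^typ>\<open>real^'n\<close> for well-ordered index types only,
  so a Euclidean space is identified with such a space over an index type of the right cardinality.
\<close>
typedef (overloaded) 'a basis_index = "{..<DIM('a::euclidean_space)}"
  morphisms index_nat nat_index
  by (rule exI[of _ 0]) (simp add: DIM_positive)

instantiation basis_index :: (euclidean_space) wellorder
begin

definition "i \<le> j \<longleftrightarrow> index_nat i \<le> index_nat j"
definition "i < j \<longleftrightarrow> index_nat i < index_nat j"

instance
proof
  fix P :: "'a basis_index \<Rightarrow> bool" and a
  assume *: "\<And>x. (\<And>y. y < x \<Longrightarrow> P y) \<Longrightarrow> P x"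
  show "P a"
    by (induction "index_nat a" arbitrary: a rule: less_induct) (rule *, simp add: less_basis_index_def)
qed (auto simp: less_eq_basis_index_def less_basis_index_def index_nat_inject)

end

instance basis_index :: (euclidean_space) finite
proof
  have "inj (index_nat :: 'a basis_index \<Rightarrow> nat)" by (simp add: inj_def index_nat_inject)
  moreover have "finite (range (index_nat :: 'a basis_index \<Rightarrow> nat))"
    by (rule finite_subset[of _ "{..<DIM('a)}"]) (use index_nat in auto)
  ultimately show "finite (UNIV :: 'a basis_index set)" using finite_imageD by blast
qed

lemma card_basis_index: "CARD('a::euclidean_space basis_index) = DIM('a)"
  using type_definition.card[OF type_definition_basis_index] by simp

lemma exists_cart_isometry:
  "\<exists>f :: 'a::euclidean_space \<Rightarrow> real^('a basis_index).
     linear f \<and> (\<forall>x. norm (f x) = norm x) \<and> surj f \<and> distr lborel borel f = lborel"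
proof -
  have "card (Basis :: 'a set) = card (Basis :: (real^('a basis_index)) set)"
    using card_basis_index[where 'a='a] by simp
  then obtain h where h: "bij_betw h (Basis :: 'a set) (Basis :: (real^('a basis_index)) set)"
    using finite_same_card_bij[OF finite_Basis finite_Basis] by blast
  define f where "f = (\<lambda>x::'a. \<Sum>b\<in>Basis. (x \<bullet> b) *\<^sub>R h b)"
  have lin: "linear f"
    unfolding f_def by (intro linear_compose_sum ballI linearI) (auto simp: inner_add_left scaleR_add_left)
  have coord: "f x \<bullet> h c = x \<bullet> c" if c: "c \<in> Basis" for x c
  proof -
    have "f x \<bullet> h c = (\<Sum>b\<in>Basis. (x \<bullet> b) * (if b = c then 1 else 0))"
      unfolding f_def inner_sum_left
    proof (intro sum.cong refl)
      fix b :: 'a assume b: "b \<in> Basis"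
      have "h b \<in> Basis" "h c \<in> Basis" "h b = h c \<longleftrightarrow> b = c"
        using h b c by (auto simp: bij_betw_def inj_on_def)
      then show "(x \<bullet> b) *\<^sub>R h b \<bullet> h c = (x \<bullet> b) * (if b = c then 1 else 0)"
        using inner_Basis[of "h b" "h c"] by simp
    qed
    then show ?thesis using c by (simp add: if_distrib cong: if_cong)
  qed
  have "f x \<bullet> f x = x \<bullet> x" for x
  proof -
    have "f x \<bullet> f x = (\<Sum>b\<in>Basis. (f x \<bullet> h b) * (f x \<bullet> h b))"
      using euclidean_inner[of "f x" "f x"] sum.reindex_bij_betw[OF h, of "\<lambda>b. (f x \<bullet> b) * (f x \<bullet> b)"] by linarith
    also have "\<dots> = (\<Sum>b\<in>Basis. (x \<bullet> b) * (x \<bullet> b))"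
      by (intro sum.cong refl) (simp add: coord)
    also have "\<dots> = x \<bullet> x" by (rule euclidean_inner[symmetric])
    finally show ?thesis .
  qed
  then have "norm (f x) = norm x" for x by (simp add: norm_eq_sqrt_inner)
  moreover have "surj f"
  proof (rule surjI)
    fix y :: "real^('a basis_index)"
    have "f (\<Sum>b\<in>Basis. (y \<bullet> h b) *\<^sub>R b) = (\<Sum>b\<in>Basis. (y \<bullet> h b) *\<^sub>R h b)"
      by (simp add: f_def)
    also have "\<dots> = (\<Sum>b\<in>Basis. (y \<bullet> b) *\<^sub>R b)"
      by (rule sum.reindex_bij_betw[OF h])
    finally show "f (\<Sum>b\<in>Basis. (y \<bullet> h b) *\<^sub>R b) = y" by (simp add: euclidean_representation)
  qed
  ultimately show ?thesis using lin lborel_distr_basis_map[OF h] unfolding f_def by blast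
qed

lemma isometry_inj: "linear f \<Longrightarrow> (\<And>x. norm (f x) = norm x) \<Longrightarrow> inj f"
  by (metis linear_injective_0 norm_eq_zero)

text \<open>Invariance under orthogonal maps of coordinate space is carried over by conjugating
  \<open>f\<close> with a measure-preserving isometry \<open>J\<close>.\<close>

lemma measure_orthogonal_image_euclidean:
  fixes f :: "'a::euclidean_space \<Rightarrow> 'a"
  assumes f: "orthogonal_transformation f" and S: "compact S"
  shows "measure lebesgue (f ` S) = measure lebesgue S"
proof -
  obtain J :: "'a \<Rightarrow> real^('a basis_index)" where
    J: "linear J" "\<And>x. norm (J x) = norm x" "surj J" "distr lborel borel J = lborel"
    using exists_cart_isometry by blast
  have inj: "inj J" by (rule isometry_inj[OF J(1,2)])
  obtain J' where J': "linear J'" "J' \<circ> J = id"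
    using linear_injective_left_inverse[OF J(1) inj] by blast
  have l: "J' (J x) = x" for x using J'(2) by (metis comp_apply id_apply)
  have r: "J (J' y) = y" for y using J(3) l by (metis surj_def)
  have lin: "linear f" "\<And>x. norm (f x) = norm x" using f by (auto simp: orthogonal_transformation)
  have fS: "compact (f ` S)" "compact (J ` S)"
    using S lin(1) J(1) by (auto intro!: compact_continuous_image linear_continuous_on simp: linear_conv_bounded_linear)
  have "orthogonal_transformation (J \<circ> f \<circ> J')"
    unfolding orthogonal_transformation
  proof (intro conjI allI)
    show "linear (J \<circ> f \<circ> J')" by (intro linear_compose J' lin J)
    show "norm ((J \<circ> f \<circ> J') v) = norm v" for v
      using J(2)[of "J' v"] by (simp add: J(2) lin r)
  qed
  then have "measure lebesgue ((J \<circ> f \<circ> J') ` (J ` S)) = measure lebesgue (J ` S)"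
    using fS by (intro measure_orthogonal_image) (auto simp: lmeasurable_compact)
  moreover have "(J \<circ> f \<circ> J') ` (J ` S) = J ` (f ` S)" by (simp add: image_image l)
  ultimately show ?thesis
    using measure_lebesgue_distr_image[OF J(1) inj J(4)] fS S by metis
qed

lemma linear_image_set_plus:
  assumes "linear f"
  shows "f ` (A + B) = f ` A + f ` B"
proof
  show "f ` A + f ` B \<subseteq> f ` (A + B)"
  proof
    fix y assume "y \<in> f ` A + f ` B"
    then obtain a b where "a \<in> A" "b \<in> B" "y = f (a + b)"
      using linear_add[OF assms] by (auto elim!: set_plus_elim)
    then show "y \<in> f ` (A + B)" by blast
  qed
  show "f ` (A + B) \<subseteq> f ` A + f ` B"
    using linear_add[OF assms] by (auto elim!: set_plus_elim intro!: set_plus_intro)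
qed

lemma linear_image_set_sum:
  assumes "linear f"
  shows "f ` (\<Sum>i\<in>I. K i) = (\<Sum>i\<in>I. f ` K i)"
  by (induction I rule: infinite_finite_induct)
    (simp_all add: linear_image_set_plus[OF assms] set_zero linear_0[OF assms])

lemma linear_image_minkowski_comb:
  assumes "linear f"
  shows "f ` minkowski_comb I t K = minkowski_comb I t (\<lambda>i. f ` K i)"
  unfolding minkowski_comb_def linear_image_set_sum[OF assms]
  by (simp add: image_comp o_def linear_scale[OF assms])

lemma convex_body_linear_image: "linear f \<Longrightarrow> convex_body K \<Longrightarrow> convex_body (f ` K)"
  by (auto simp: convex_body_def convex_linear_image linear_conv_bounded_linear
      intro!: compact_continuous_image linear_continuous_on)

lemma convex_body_cball: "0 \<le> r \<Longrightarrow> convex_body (cball x r)"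
  by (simp add: convex_body_def)

section \<open>Parallel bodies and outer approximation by polytopes\<close>

lemma set_plus_subset_self:
  fixes K :: "'a::euclidean_space set"
  shows "0 \<le> r \<Longrightarrow> K \<subseteq> K + cball 0 r"
  by (force simp: set_plus_def)

text \<open>Parallel bodies of radii \<open>1 / (n + 1)\<close> decrease to \<open>C\<close> because
  \<open>C\<close> is closed, so their volumes converge by continuity of measure from above;
  monotonicity in the radius handles an arbitrary null sequence \<open>e\<close>.\<close>

lemma measure_parallel_body_tendsto:
  fixes C :: "'a::euclidean_space set"
  assumes C: "compact C" and e: "e \<longlonglongrightarrow> 0" "\<And>n. 0 \<le> e n"
  shows "(\<lambda>n. measure lebesgue (C + cball 0 (e n))) \<longlonglongrightarrow> measure lebesgue C"
proof -
  have comp: "compact (C + cball 0 r)" for r :: real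
    using C by (intro compact_set_plus) auto
  let ?T = "\<lambda>n::nat. C + cball 0 (inverse (real (Suc n)))"
  have mono: "C + cball 0 r \<subseteq> C + cball 0 s" if "r \<le> s" for r s :: real
    using that by (intro set_plus_mono2) (auto simp: subset_iff)
  have "decseq ?T" by (intro antimonoI mono) (simp add: divide_simps)
  have "(\<Inter>n. ?T n) = C"
  proof
    show "C \<subseteq> (\<Inter>n. ?T n)" by (intro INT_greatest set_plus_subset_self) simp
    show "(\<Inter>n. ?T n) \<subseteq> C"
    proof
      fix x assume x: "x \<in> (\<Inter>n. ?T n)"
      have "\<exists>y\<in>C. dist y x < \<epsilon>" if \<epsilon>: "\<epsilon> > 0" for \<epsilon>
      proof -
        obtain n where n: "inverse (real (Suc n)) < \<epsilon>" using reals_Archimedean[OF \<epsilon>] by auto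
        have "x \<in> ?T n" using x by blast
        then obtain y z where "y \<in> C" "norm z \<le> inverse (real (Suc n))" "x = y + z"
          by (auto simp: set_plus_def)
        then show ?thesis using n by (intro bexI[of _ y]) (auto simp: dist_norm)
      qed
      then have "x \<in> closure C" by (simp add: closure_approachable)
      then show "x \<in> C" using C by (simp add: compact_imp_closed)
    qed
  qed
  moreover have "(\<lambda>n. measure lebesgue (?T n)) \<longlonglongrightarrow> measure lebesgue (\<Inter>n. ?T n)"
    using \<open>decseq ?T\<close> fmeasurableD[OF lmeasurable_compact[OF comp]]
      fmeasurableD2[OF lmeasurable_compact[OF comp]]
    by (intro Lim_measure_decseq) (auto simp only: infinity_ennreal_def)
  ultimately have lim: "(\<lambda>n. measure lebesgue (?T n)) \<longlonglongrightarrow> measure lebesgue C" by simp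
  show ?thesis
  proof (rule LIMSEQ_I)
    fix \<eta> :: real assume "\<eta> > 0"
    then obtain N where N: "norm (measure lebesgue (?T N) - measure lebesgue C) < \<eta>"
      using LIMSEQ_D[OF lim] by blast
    obtain n0 where n0: "\<And>n. n \<ge> n0 \<Longrightarrow> norm (e n - 0) < inverse (real (Suc N))"
      using LIMSEQ_D[OF e(1), of "inverse (real (Suc N))"] by auto
    show "\<exists>no. \<forall>n\<ge>no. norm (measure lebesgue (C + cball 0 (e n)) - measure lebesgue C) < \<eta>"
    proof (intro exI allI impI)
      fix n assume "n \<ge> n0"
      then have "e n \<le> inverse (real (Suc N))" using n0[of n] by auto
      then have "measure lebesgue (C + cball 0 (e n)) \<le> measure lebesgue (?T N)"
        by (intro measure_compact_mono comp mono)
      moreover have "measure lebesgue C \<le> measure lebesgue (C + cball 0 (e n))"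
        by (intro measure_compact_mono comp C set_plus_subset_self e)
      ultimately show "norm (measure lebesgue (C + cball 0 (e n)) - measure lebesgue C) < \<eta>"
        using N by auto
    qed
  qed
qed

lemma minkowski_comb_parallel_subset:
  fixes K L :: "'i \<Rightarrow> 'a::euclidean_space set"
  assumes I: "finite I" and t: "\<And>i. i \<in> I \<Longrightarrow> 0 \<le> t i"
    and sub: "\<And>i. i \<in> I \<Longrightarrow> L i \<subseteq> K i + cball 0 r"
  shows "minkowski_comb I t L \<subseteq> minkowski_comb I t K + cball 0 ((\<Sum>i\<in>I. t i) * r)"
proof
  fix x assume "x \<in> minkowski_comb I t L"
  then obtain s where s: "\<forall>i\<in>I. s i \<in> L i" "x = (\<Sum>i\<in>I. t i *\<^sub>R s i)"
    by (auto simp: mem_minkowski_comb[OF I])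
  then have "\<forall>i\<in>I. \<exists>y z. y \<in> K i \<and> norm z \<le> r \<and> s i = y + z"
    using sub by (fastforce simp: set_plus_def)
  then obtain y z where yz: "\<forall>i\<in>I. y i \<in> K i \<and> norm (z i) \<le> r \<and> s i = y i + z i" by metis
  have "norm (\<Sum>i\<in>I. t i *\<^sub>R z i) \<le> (\<Sum>i\<in>I. t i * r)"
    using yz t by (intro sum_norm_le) (auto intro: mult_left_mono)
  then have "(\<Sum>i\<in>I. t i *\<^sub>R z i) \<in> cball 0 ((\<Sum>i\<in>I. t i) * r)"
    by (simp add: sum_distrib_right)
  moreover have "(\<Sum>i\<in>I. t i *\<^sub>R y i) \<in> minkowski_comb I t K"
    using yz by (auto simp: mem_minkowski_comb[OF I])
  moreover have "x = (\<Sum>i\<in>I. t i *\<^sub>R y i) + (\<Sum>i\<in>I. t i *\<^sub>R z i)"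
    using s yz by (simp add: sum.distrib[symmetric] scaleR_add_right cong: sum.cong)
  ultimately show "x \<in> minkowski_comb I t K + cball 0 ((\<Sum>i\<in>I. t i) * r)"
    using set_plus_intro by metis
qed

text \<open>The polytope is the hull of a finite \<open>\<delta>\<close>-net of \<open>K\<close>,
  enlarged by a small cube. The cube contains a ball of radius \<open>\<delta>\<close>, so the sum
  covers \<open>K\<close> and has interior points.\<close>

lemma outer_polytope_approximation:
  fixes K :: "'a::euclidean_space set"
  assumes K: "convex_body K" and \<epsilon>: "\<epsilon> > 0"
  shows "\<exists>A. finite A \<and> interior (convex hull A) \<noteq> {} \<and> K \<subseteq> convex hull A \<and> convex hull A \<subseteq> K + cball 0 \<epsilon>"
proof -
  define D where "D = real DIM('a)"
  have D: "D \<ge> 1" by (simp add: D_def DIM_positive Suc_leI)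
  \<comment> \<open>Half the side of the cube. The Euclidean norm is at most the sum of the
    \<open>D\<close> absolute coordinates, so this cube lies in the ball of radius
    \<open>\<epsilon>\<close>.\<close>
  define \<delta> where "\<delta> = \<epsilon> / D"
  have \<delta>: "\<delta> > 0" using \<epsilon> D by (simp add: \<delta>_def)
  define c where "c = cbox (0 - (\<Sum>i\<in>Basis. \<delta> *\<^sub>R i)) (0 + (\<Sum>i\<in>Basis. \<delta> *\<^sub>R i) :: 'a)"
  obtain s where s: "finite s" "c = convex hull s"
    using cube_convex_hull[OF \<delta>, of 0] unfolding c_def by blast
  have c_iff: "x \<in> c \<longleftrightarrow> (\<forall>i\<in>Basis. \<bar>x \<bullet> i\<bar> \<le> \<delta>)" for x
    by (auto simp: c_def mem_box abs_le_iff minus_le_iff)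
  have ball_c: "ball 0 \<delta> \<subseteq> c"
    using order_trans[OF Basis_le_norm less_imp_le] by (auto simp: c_iff)
  have c_cball: "c \<subseteq> cball 0 \<epsilon>"
  proof
    fix x assume "x \<in> c"
    then have "(\<Sum>i\<in>Basis. \<bar>x \<bullet> i\<bar>) \<le> (\<Sum>i\<in>(Basis::'a set). \<delta>)"
      by (intro sum_mono) (auto simp: c_iff)
    then have "norm x \<le> \<epsilon>"
      using norm_le_l1[of x] D by (simp add: \<delta>_def D_def)
    then show "x \<in> cball 0 \<epsilon>" by simp
  qed
  have "compact K" "K \<noteq> {}" using K by (auto simp: convex_body_def)
  then obtain N where N: "finite N" "N \<subseteq> K" "K \<subseteq> (\<Union>x\<in>N. ball x \<delta>)"
    using compactE_image[of K K "\<lambda>x. ball x \<delta>"] \<delta> by (metis UN_I centre_in_ball open_ball subsetI)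
  then have "N \<noteq> {}" using \<open>K \<noteq> {}\<close> by auto
  define A where "A = N + s"
  have hull: "convex hull A = convex hull N + c"
    by (simp add: A_def convex_hull_set_plus s(2))
  have "finite A" by (simp add: A_def finite_set_plus N s)
  moreover have sub: "ball x \<delta> \<subseteq> convex hull A" if "x \<in> N" for x
  proof
    fix y assume "y \<in> ball x \<delta>"
    then have "y - x \<in> c" using ball_c by (auto simp: dist_norm norm_minus_commute)
    then have "x + (y - x) \<in> convex hull N + c"
      using that by (intro set_plus_intro) (auto simp: hull_inc)
    then show "y \<in> convex hull A" by (simp add: hull)
  qed
  moreover have "interior (convex hull A) \<noteq> {}"
    using sub \<open>N \<noteq> {}\<close> \<delta> by (metis all_not_in_conv centre_in_ball interior_maximal open_ball subsetD)
  moreover have "K \<subseteq> convex hull A" using N(3) sub by blast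
  moreover have "convex hull A \<subseteq> K + cball 0 \<epsilon>"
    unfolding hull using K N(2) c_cball
    by (intro set_plus_mono2 hull_minimal) (auto simp: convex_body_def)
  ultimately show ?thesis by blast
qed

lemma minkowski_comb_cong:
  "(\<And>i. i \<in> I \<Longrightarrow> t i = t' i) \<Longrightarrow> minkowski_comb I t K = minkowski_comb I t' K"
  unfolding minkowski_comb_def by (intro sum.cong) auto

lemma minkowski_comb_mono:
  assumes "finite I" "\<And>i. i \<in> I \<Longrightarrow> K i \<subseteq> L i"
  shows "minkowski_comb I t K \<subseteq> minkowski_comb I t L"
  using assms(2) by (fastforce simp: mem_minkowski_comb[OF assms(1)])

text \<open>The approximating polytopes contain the bodies, so volumes converge by a squeeze:
  monotonicity from below, parallel bodies of the fixed combination from above.\<close>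

lemma hom_poly_measure_cart:
  fixes K :: "'i \<Rightarrow> (real^'n::{finite,wellorder}) set"
  assumes I: "finite I" and K: "\<And>i. i \<in> I \<Longrightarrow> convex_body (K i)"
  shows "hom_poly_on_orthant CARD('n) I (\<lambda>t. measure lebesgue (minkowski_comb I t K))"
proof -
  have "\<forall>n. \<forall>i\<in>I. \<exists>A. finite A \<and> interior (convex hull A) \<noteq> {} \<and> K i \<subseteq> convex hull A \<and>
      convex hull A \<subseteq> K i + cball 0 (inverse (real (Suc n)))"
    using K by (intro allI ballI outer_polytope_approximation) auto
  then obtain A where A: "\<And>n i. i \<in> I \<Longrightarrow> finite (A n i)"
      "\<And>n i. i \<in> I \<Longrightarrow> interior (convex hull (A n i)) \<noteq> {}"
      "\<And>n i. i \<in> I \<Longrightarrow> K i \<subseteq> convex hull (A n i)"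
      "\<And>n i. i \<in> I \<Longrightarrow> convex hull (A n i) \<subseteq> K i + cball 0 (inverse (real (Suc n)))"
    by metis
  have Ane: "A n i \<noteq> {}" if "i \<in> I" for n i using A(2)[OF that, of n] by auto
  show ?thesis
  proof (rule hom_poly_LIMSEQ[where F = "\<lambda>n t. measure lebesgue (minkowski_comb I t (\<lambda>i. convex hull (A n i)))"])
    show "hom_poly_on_orthant CARD('n) I (\<lambda>t. measure lebesgue (minkowski_comb I t (\<lambda>i. convex hull (A n i))))" for n
      by (rule hom_poly_measure_hulls[OF I]) (use A in auto)
  next
    fix t :: "'i \<Rightarrow> real" assume t: "\<And>i. 0 \<le> t i"
    let ?C = "minkowski_comb I t K"
    let ?e = "\<lambda>n. (\<Sum>i\<in>I. t i) * inverse (real (Suc n))"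
    have C: "convex_body ?C" by (rule convex_body_minkowski_comb) (rule K)
    have e: "?e \<longlonglongrightarrow> 0" "0 \<le> ?e n" for n
      using t tendsto_mult_right_zero[OF LIMSEQ_inverse_real_of_nat, of "\<Sum>i\<in>I. t i"]
      by (auto intro!: mult_nonneg_nonneg sum_nonneg)
    have cb: "compact (minkowski_comb I t (\<lambda>i. convex hull (A n i)))" for n
      using convex_body_minkowski_comb[of I "\<lambda>i. convex hull (A n i)" t] A(1) Ane
      by (simp add: convex_body_hull) (simp add: convex_body_def)
    have cc: "compact (?C + cball 0 (?e n))" "compact ?C" for n
      using convex_body_set_plus[OF C convex_body_cball[OF e(2)]] C by (auto simp: convex_body_def)
    show "(\<lambda>n. measure lebesgue (minkowski_comb I t (\<lambda>i. convex hull (A n i)))) \<longlonglongrightarrow> measure lebesgue ?C"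
    proof (rule tendsto_sandwich[where f = "\<lambda>_. measure lebesgue ?C"])
      show "(\<lambda>n. measure lebesgue (?C + cball 0 (?e n))) \<longlonglongrightarrow> measure lebesgue ?C"
        by (rule measure_parallel_body_tendsto) (use e cc in auto)
      show "\<forall>\<^sub>F n in sequentially. measure lebesgue ?C
          \<le> measure lebesgue (minkowski_comb I t (\<lambda>i. convex hull (A n i)))"
        by (intro always_eventually allI measure_compact_mono cb cc minkowski_comb_mono I A(3))
      show "\<forall>\<^sub>F n in sequentially. measure lebesgue (minkowski_comb I t (\<lambda>i. convex hull (A n i)))
          \<le> measure lebesgue (?C + cball 0 (?e n))"
        by (intro always_eventually allI measure_compact_mono cb cc minkowski_comb_parallel_subset I A(4) t)
    qed simp
  next
    fix t t' :: "'i \<Rightarrow> real" assume eq: "\<And>i. i \<in> I \<Longrightarrow> t i = t' i"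
    then show "measure lebesgue (minkowski_comb I t K) = measure lebesgue (minkowski_comb I t' K)"
      using minkowski_comb_cong[of I t t' K] by simp
    show "measure lebesgue (minkowski_comb I t (\<lambda>i. convex hull (A n i)))
        = measure lebesgue (minkowski_comb I t' (\<lambda>i. convex hull (A n i)))" for n
      using minkowski_comb_cong[of I t t' "\<lambda>i. convex hull (A n i)"] eq by simp
  qed
qed

lemma hom_poly_measure_minkowski_comb:
  fixes K :: "'i \<Rightarrow> 'a::euclidean_space set"
  assumes I: "finite I" and K: "\<And>i. i \<in> I \<Longrightarrow> convex_body (K i)"
  shows "hom_poly_on_orthant DIM('a) I (\<lambda>t. measure lebesgue (minkowski_comb I t K))"
proof -
  obtain f :: "'a \<Rightarrow> real^('a basis_index)" where
    f: "linear f" "inj f" "distr lborel borel f = lborel"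
    using exists_cart_isometry isometry_inj by metis
  have "measure lebesgue (minkowski_comb I t K) = measure lebesgue (minkowski_comb I t (\<lambda>i. f ` K i))" for t
    using measure_lebesgue_distr_image[OF f] convex_body_minkowski_comb[of I K t] K
    by (simp add: linear_image_minkowski_comb[OF f(1), symmetric] convex_body_def)
  moreover have "hom_poly_on_orthant CARD('a basis_index) I
      (\<lambda>t. measure lebesgue (minkowski_comb I t (\<lambda>i. f ` K i)))"
    by (intro hom_poly_measure_cart I convex_body_linear_image f K)
  ultimately show ?thesis by (simp add: card_basis_index)
qed

section \<open>Existence, uniqueness and multilinearity of mixed volumes\<close>

text \<open>Convexity enters in the inclusion from right to left:
  \<open>a *\<^sub>R x + b *\<^sub>R y\<close> is \<open>a + b\<close> times a weighted mean of
  \<open>x\<close> and \<open>y\<close>.\<close>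

lemma scaleR_image_add_convex:
  fixes K :: "'a::euclidean_space set"
  assumes "convex K" "0 \<le> a" "0 \<le> b"
  shows "(\<lambda>x. (a + b) *\<^sub>R x) ` K = (\<lambda>x. a *\<^sub>R x) ` K + (\<lambda>x. b *\<^sub>R x) ` K"
proof
  show "(\<lambda>x. (a + b) *\<^sub>R x) ` K \<subseteq> (\<lambda>x. a *\<^sub>R x) ` K + (\<lambda>x. b *\<^sub>R x) ` K"
    by (auto simp: scaleR_add_left intro!: set_plus_intro)
  show "(\<lambda>x. a *\<^sub>R x) ` K + (\<lambda>x. b *\<^sub>R x) ` K \<subseteq> (\<lambda>x. (a + b) *\<^sub>R x) ` K"
  proof
    fix z assume "z \<in> (\<lambda>x. a *\<^sub>R x) ` K + (\<lambda>x. b *\<^sub>R x) ` K"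
    then obtain x y where xy: "x \<in> K" "y \<in> K" "z = a *\<^sub>R x + b *\<^sub>R y"
      by (auto elim!: set_plus_elim)
    show "z \<in> (\<lambda>x. (a + b) *\<^sub>R x) ` K"
    proof (cases "a + b = 0")
      case True
      then have "a = 0" "b = 0" using assms by auto
      then show ?thesis using xy by auto
    next
      case False
      define w where "w = (a / (a + b)) *\<^sub>R x + (b / (a + b)) *\<^sub>R y"
      have "w \<in> K"
        unfolding w_def using assms xy False by (intro convexD) (auto simp: add_divide_distrib[symmetric])
      moreover have "z = (a + b) *\<^sub>R w" using False by (simp add: w_def xy scaleR_add_right)
      ultimately show ?thesis by blast
    qed
  qed
qed

lemma scaleR_image_sum_convex:
  fixes K :: "'a::euclidean_space set"
  assumes "convex K" "K \<noteq> {}" "finite S" "\<And>k. k \<in> S \<Longrightarrow> 0 \<le> w k"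
  shows "(\<lambda>x. (\<Sum>k\<in>S. w k) *\<^sub>R x) ` K = (\<Sum>k\<in>S. (\<lambda>x. w k *\<^sub>R x) ` K)"
  using assms(3,4)
proof (induction S rule: finite_induct)
  case empty
  then show ?case using assms(2) by (auto simp: set_zero)
next
  case (insert k S)
  then have "(\<lambda>x. (\<Sum>k\<in>insert k S. w k) *\<^sub>R x) ` K = (\<lambda>x. (w k + (\<Sum>k\<in>S. w k)) *\<^sub>R x) ` K" by simp
  also have "\<dots> = (\<lambda>x. w k *\<^sub>R x) ` K + (\<lambda>x. (\<Sum>k\<in>S. w k) *\<^sub>R x) ` K"
    using insert.prems by (intro scaleR_image_add_convex assms(1) sum_nonneg) auto
  finally show ?case using insert by simp
qed

text \<open>This translates addition of weight vectors, the operation in the polarization formula,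
  into Minkowski addition of bodies.\<close>

lemma minkowski_comb_sum_weights:
  assumes "\<And>i. i \<in> I \<Longrightarrow> convex_body (K i)" "finite S" "\<And>k i. k \<in> S \<Longrightarrow> i \<in> I \<Longrightarrow> 0 \<le> w k i"
  shows "minkowski_comb I (\<lambda>i. \<Sum>k\<in>S. w k i) K = (\<Sum>k\<in>S. minkowski_comb I (w k) K)"
proof -
  have "minkowski_comb I (\<lambda>i. \<Sum>k\<in>S. w k i) K = (\<Sum>i\<in>I. \<Sum>k\<in>S. (\<lambda>x. w k i *\<^sub>R x) ` K i)"
    unfolding minkowski_comb_def
    using assms by (intro sum.cong refl scaleR_image_sum_convex) (auto simp: convex_body_def)
  then show ?thesis unfolding minkowski_comb_def by (subst sum.swap) simp
qed

lemma minkowski_comb_single: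
  assumes "finite I" "j \<in> I" "\<And>i. i \<in> I \<Longrightarrow> K i \<noteq> {}"
  shows "minkowski_comb I (\<lambda>i. of_bool (j = i)) K = K j"
proof -
  have "minkowski_comb I (\<lambda>i. of_bool (j = i)) K = (\<Sum>i\<in>I. if i = j then K j else 0)"
    unfolding minkowski_comb_def using assms(3) by (intro sum.cong refl) (auto simp: set_zero)
  then show ?thesis using assms by simp
qed

text \<open>The polarization formula for the mixed volume, taken here as the definition. Only the
  arguments with index below the dimension matter.\<close>

definition polar_volume :: "(nat \<Rightarrow> 'a::euclidean_space set) \<Rightarrow> real" where
  "polar_volume K = polarize DIM('a) (\<lambda>S. measure lebesgue (\<Sum>k\<in>S. K k))"

lemma polar_volume_cong:
  fixes K L :: "nat \<Rightarrow> 'a::euclidean_space set"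
  assumes "\<And>k. k < DIM('a) \<Longrightarrow> K k = L k"
  shows "polar_volume K = polar_volume L"
  unfolding polar_volume_def
  by (intro polarize_cong arg_cong[where f = "measure lebesgue"] sum.cong) (use assms in auto)

lemma polar_volume_permute:
  fixes K :: "nat \<Rightarrow> 'a::euclidean_space set"
  assumes "\<sigma> permutes {..<DIM('a)}"
  shows "polar_volume (\<lambda>k. K (\<sigma> k)) = polar_volume K"
proof -
  have "(\<Sum>k\<in>S. K (\<sigma> k)) = (\<Sum>k\<in>\<sigma> ` S. K k)" for S
    using permutes_inj[OF assms] by (subst sum.reindex) (auto simp: inj_on_def)
  then show ?thesis
    unfolding polar_volume_def using polarize_permute[OF assms, of "\<lambda>S. measure lebesgue (\<Sum>k\<in>S. K k)"] by simp
qed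

lemma measure_minkowski_comb:
  fixes K :: "'i \<Rightarrow> 'a::euclidean_space set"
  assumes I: "finite I" and K: "\<And>i. i \<in> I \<Longrightarrow> convex_body (K i)" and t: "\<And>i. i \<in> I \<Longrightarrow> 0 \<le> t i"
  shows "measure lebesgue (minkowski_comb I t K)
    = (\<Sum>g\<in>{..<DIM('a)} \<rightarrow>\<^sub>E I. (\<Prod>k<DIM('a). t (g k)) * polar_volume (\<lambda>k. K (g k)))"
proof -
  have "measure lebesgue (minkowski_comb I t K)
      = (\<Sum>g\<in>{..<DIM('a)} \<rightarrow>\<^sub>E I. (\<Prod>k<DIM('a). t (g k)) *
        polarize DIM('a) (\<lambda>S. measure lebesgue (minkowski_comb I (\<lambda>i. \<Sum>k\<in>S. of_bool (g k = i)) K)))"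
    using hom_poly_measure_minkowski_comb[OF I, of K] K t unfolding hom_poly_on_orthant_def by blast
  also have "\<dots> = (\<Sum>g\<in>{..<DIM('a)} \<rightarrow>\<^sub>E I. (\<Prod>k<DIM('a). t (g k)) * polar_volume (\<lambda>k. K (g k)))"
  proof (intro sum.cong refl arg_cong2[where f = "(*)"])
    fix g assume g: "g \<in> {..<DIM('a)} \<rightarrow>\<^sub>E I"
    show "polarize DIM('a) (\<lambda>S. measure lebesgue (minkowski_comb I (\<lambda>i. \<Sum>k\<in>S. of_bool (g k = i)) K))
        = polar_volume (\<lambda>k. K (g k))"
      unfolding polar_volume_def
    proof (intro polarize_cong arg_cong[where f = "measure lebesgue"])
      fix S assume S: "S \<subseteq> {..<DIM('a)}"
      \<comment> \<open>The weight of \<open>i\<close> counts the slots in \<open>S\<close> to which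
        \<open>g\<close> assigns \<open>i\<close>; multiplicities become repeated Minkowski
        summands.\<close>
      have "minkowski_comb I (\<lambda>i. \<Sum>k\<in>S. of_bool (g k = i)) K = (\<Sum>k\<in>S. minkowski_comb I (\<lambda>i. of_bool (g k = i)) K)"
        using K finite_subset[OF S] by (intro minkowski_comb_sum_weights) auto
      also have "\<dots> = (\<Sum>k\<in>S. K (g k))"
        using I K g S by (intro sum.cong refl minkowski_comb_single) (auto simp: convex_body_def)
      finally show "minkowski_comb I (\<lambda>i. \<Sum>k\<in>S. of_bool (g k = i)) K = (\<Sum>k\<in>S. K (g k))" .
    qed
  qed
  finally show ?thesis .
qed

text \<open>All slots draw from one family \<open>K\<close>, each with its own weights. A partial
  sum of the slots is again a combination of \<open>K\<close>, with added weights; polarizing its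
  volume expansion averages over permutations of the slots, and symmetry of the coefficients makes
  all these permutations contribute equally.\<close>

lemma polar_volume_multilinear:
  fixes K :: "'i \<Rightarrow> 'a::euclidean_space set"
  assumes I: "finite I" and K: "\<And>i. i \<in> I \<Longrightarrow> convex_body (K i)"
    and w: "\<And>k i. k < DIM('a) \<Longrightarrow> i \<in> I \<Longrightarrow> 0 \<le> w k i"
  shows "polar_volume (\<lambda>k. minkowski_comb I (w k) K)
    = (\<Sum>g\<in>{..<DIM('a)} \<rightarrow>\<^sub>E I. (\<Prod>k<DIM('a). w k (g k)) * polar_volume (\<lambda>k. K (g k)))"
proof -
  let ?d = "DIM('a)"
  let ?E = "{..<?d} \<rightarrow>\<^sub>E I"
  let ?P = "{\<sigma>. \<sigma> permutes {..<?d}}"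
  define v where "v g = polar_volume (\<lambda>k. K (g k))" for g
  have "measure lebesgue (\<Sum>k\<in>S. minkowski_comb I (w k) K)
      = (\<Sum>g\<in>?E. v g * (\<Prod>k<?d. \<Sum>l\<in>S. w l (g k)))" if S: "S \<subseteq> {..<?d}" for S
  proof -
    have "(\<Sum>k\<in>S. minkowski_comb I (w k) K) = minkowski_comb I (\<lambda>i. \<Sum>k\<in>S. w k i) K"
      using K w S finite_subset[OF S] by (intro minkowski_comb_sum_weights[symmetric]) auto
    then show ?thesis
      using S by (simp add: measure_minkowski_comb[OF I] K w sum_nonneg subset_iff v_def mult.commute)
  qed
  then have "polar_volume (\<lambda>k. minkowski_comb I (w k) K)
      = polarize ?d (\<lambda>S. \<Sum>g\<in>?E. v g * (\<Prod>k<?d. \<Sum>l\<in>S. w l (g k)))"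
    unfolding polar_volume_def by (intro polarize_cong)
  also have "\<dots> = (\<Sum>g\<in>?E. v g * ((\<Sum>\<sigma>\<in>?P. \<Prod>k<?d. w (\<sigma> k) (g k)) / fact ?d))"
    unfolding polarize_sum polarize_cmult by (simp add: polarize_prod)
  also have "\<dots> = (\<Sum>\<sigma>\<in>?P. (\<Sum>g\<in>?E. v g * (\<Prod>k<?d. w (\<sigma> k) (g k)))) / fact ?d"
    unfolding sum_divide_distrib sum_distrib_left by (subst sum.swap) simp
  also have "\<dots> = (\<Sum>\<sigma>\<in>?P. (\<Sum>g\<in>?E. v g * (\<Prod>k<?d. w k (g k)))) / fact ?d"
  proof (rule arg_cong[where f = "\<lambda>x. x / fact ?d"], rule sum.cong[OF refl])
    fix \<sigma> assume "\<sigma> \<in> ?P"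
    then have \<sigma>: "\<sigma> permutes {..<?d}" by simp
    have "(\<Sum>g\<in>?E. v g * (\<Prod>k<?d. w (\<sigma> k) (g k)))
        = (\<Sum>g\<in>?E. v (g \<circ> \<sigma>) * (\<Prod>k<?d. w (\<sigma> k) ((g \<circ> \<sigma>) k)))"
      using sum_PiE_permute[OF \<sigma>, of "\<lambda>g. v g * (\<Prod>k<?d. w (\<sigma> k) (g k))" I] by simp
    also have "\<dots> = (\<Sum>g\<in>?E. v g * (\<Prod>k<?d. w k (g k)))"
    proof (intro sum.cong refl arg_cong2[where f = "(*)"])
      fix g
      show "v (g \<circ> \<sigma>) = v g"
        unfolding v_def using polar_volume_permute[OF \<sigma>, of "\<lambda>k. K (g k)"] by simp
      show "(\<Prod>k<?d. w (\<sigma> k) ((g \<circ> \<sigma>) k)) = (\<Prod>k<?d. w k (g k))"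
        using prod.permute[OF \<sigma>, of "\<lambda>k. w k (g k)"] by (simp add: o_def)
    qed
    finally show "(\<Sum>g\<in>?E. v g * (\<Prod>k<?d. w (\<sigma> k) (g k))) = (\<Sum>g\<in>?E. v g * (\<Prod>k<?d. w k (g k)))" .
  qed
  also have "\<dots> = (\<Sum>g\<in>?E. v g * (\<Prod>k<?d. w k (g k)))"
    by (simp add: card_permutations)
  finally show ?thesis by (simp add: v_def mult.commute)
qed

section \<open>Existence and uniqueness of the mixed volume functional\<close>

lemma bij_betw_PiE_lists:
  assumes "inj_on f A"
  shows "bij_betw (\<lambda>g. map (\<lambda>k. f (g k)) [0..<d]) ({..<d} \<rightarrow>\<^sub>E A) {xs. length xs = d \<and> set xs \<subseteq> f ` A}"
proof (rule bij_betwI')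
  fix g h assume g: "g \<in> {..<d} \<rightarrow>\<^sub>E A" and h: "h \<in> {..<d} \<rightarrow>\<^sub>E A"
  show "(map (\<lambda>k. f (g k)) [0..<d] = map (\<lambda>k. f (h k)) [0..<d]) = (g = h)"
  proof
    assume eq: "map (\<lambda>k. f (g k)) [0..<d] = map (\<lambda>k. f (h k)) [0..<d]"
    show "g = h"
    proof (rule PiE_ext[OF g h])
      fix k assume k: "k \<in> {..<d}"
      then have "f (g k) = f (h k)" using eq by (simp add: map_eq_conv)
      then show "g k = h k" using assms g h k by (auto simp: inj_on_def PiE_iff)
    qed
  qed simp
next
  fix g assume "g \<in> {..<d} \<rightarrow>\<^sub>E A"
  then show "map (\<lambda>k. f (g k)) [0..<d] \<in> {xs. length xs = d \<and> set xs \<subseteq> f ` A}" by auto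
next
  fix xs assume "xs \<in> {xs. length xs = d \<and> set xs \<subseteq> f ` A}"
  then have xs: "length xs = d" "set xs \<subseteq> f ` A" by auto
  let ?g = "\<lambda>k\<in>{..<d}. inv_into A f (xs ! k)"
  have x: "xs ! k \<in> f ` A" if "k < d" for k using xs that nth_mem by blast
  have "?g \<in> {..<d} \<rightarrow>\<^sub>E A" using x by (auto intro: inv_into_into)
  moreover have "xs = map (\<lambda>k. f (?g k)) [0..<d]"
    using xs x by (intro nth_equalityI) (auto simp: f_inv_into_f)
  ultimately show "\<exists>g\<in>{..<d} \<rightarrow>\<^sub>E A. xs = map (\<lambda>k. f (g k)) [0..<d]" by blast
qed

lemma prod_list_map_upt: "prod_list (map f [0..<d]) = (\<Prod>k<d. f k)" for f :: "nat \<Rightarrow> real"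
  by (simp add: prod.list_conv_set_nth atLeast0LessThan)

lemma is_mixed_volume_polar_volume: "is_mixed_volume (\<lambda>Ks :: 'a::euclidean_space set list. polar_volume ((!) Ks))"
  unfolding is_mixed_volume_def
proof (intro conjI allI impI)
  fix Ks Ls :: "'a set list"
  assume "length Ks = DIM('a) \<and> (\<forall>K\<in>set Ks. convex_body K) \<and> mset Ks = mset Ls"
  then have len: "length Ls = DIM('a)" and "mset Ks = mset Ls" by (auto dest: mset_eq_length)
  then obtain p where p: "p permutes {..<length Ls}" "permute_list p Ls = Ks"
    by (metis mset_eq_permutation)
  have "polar_volume ((!) Ks) = polar_volume (\<lambda>k. Ls ! p k)"
    using p len by (intro polar_volume_cong) (metis permute_list_nth)
  then show "polar_volume ((!) Ks) = polar_volume ((!) Ls)"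
    using polar_volume_permute[of p "(!) Ls"] p len by simp
next
  fix m and K :: "nat \<Rightarrow> 'a set" and t :: "nat \<Rightarrow> real"
  let ?d = "DIM('a)"
  assume *: "\<forall>i\<in>{1..m}. convex_body (K i) \<and> 0 \<le> t i"
  have "measure lebesgue (\<Sum>i\<in>{1..m}. (\<lambda>x. t i *\<^sub>R x) ` K i)
      = (\<Sum>g\<in>{..<?d} \<rightarrow>\<^sub>E {1..m}. (\<Prod>k<?d. t (g k)) * polar_volume (\<lambda>k. K (g k)))"
    using measure_minkowski_comb[of "{1..m}" K t] * by (simp add: minkowski_comb_def)
  also have "\<dots> = (\<Sum>g\<in>{..<?d} \<rightarrow>\<^sub>E {1..m}. prod_list (map t (map (\<lambda>k. g k) [0..<?d]))
      * polar_volume ((!) (map K (map (\<lambda>k. g k) [0..<?d]))))"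
    by (intro sum.cong refl arg_cong2[where f = "(*)"] polar_volume_cong) (simp_all add: prod_list_map_upt o_def)
  also have "\<dots> = (\<Sum>ixs | length ixs = ?d \<and> set ixs \<subseteq> {1..m}. prod_list (map t ixs) * polar_volume ((!) (map K ixs)))"
    using bij_betw_PiE_lists[of "\<lambda>i. i" "{1..m}" ?d]
    by (intro sum.reindex_bij_betw) simp
  finally show "measure lebesgue (\<Sum>i\<in>{1..m}. (\<lambda>x. t i *\<^sub>R x) ` K i)
      = (\<Sum>ixs | length ixs = ?d \<and> set ixs \<subseteq> {1..m}. prod_list (map t ixs) * polar_volume ((!) (map K ixs)))" .
qed

text \<open>With weights \<open>0\<close> and \<open>1\<close> the required expansion gives the
  volumes of all partial sums of \<open>Ks\<close> in terms of \<open>V\<close>. Polarizing them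
  leaves only the maps \<open>g\<close> that are permutations, and by symmetry each contributes
  \<open>V Ks\<close>.\<close>

lemma is_mixed_volume_unique:
  fixes V :: "'a::euclidean_space set list \<Rightarrow> real"
  assumes V: "is_mixed_volume V" and len: "length Ks = DIM('a)" and cb: "\<forall>K\<in>set Ks. convex_body K"
  shows "V Ks = polar_volume ((!) Ks)"
proof -
  let ?d = "DIM('a)"
  let ?U = "{..<?d}"
  let ?L = "\<lambda>g. map (\<lambda>k. Ks ! g k) [0..<?d]"
  have V_sym: "V Ks = V Ls" if "mset Ks = mset Ls" for Ls
    using V len cb that unfolding is_mixed_volume_def by blast
  have vol: "measure lebesgue (\<Sum>k\<in>S. Ks ! k) = (\<Sum>g\<in>?U \<rightarrow>\<^sub>E ?U. V (?L g) * of_bool (g ` ?U \<subseteq> S))"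
    if S: "S \<subseteq> ?U" for S
  proof -
    define K where "K i = Ks ! (i - 1)" for i
    \<comment> \<open>The expansion numbers bodies from \<open>1\<close>, list positions start at
      \<open>0\<close>; hence the shift here and in \<open>K\<close>.\<close>
    define t where "t i = (of_bool (i - 1 \<in> S) :: real)" for i
    have Kcb: "convex_body (K i)" if "i \<in> {1..?d}" for i
      using cb len that by (auto simp: K_def)
    have Suc_U: "Suc ` ?U = {1..?d}" by (simp add: lessThan_atLeast0 image_Suc_atLeastLessThan atLeastLessThanSuc_atLeastAtMost)
    have "(\<Sum>i\<in>{1..?d}. (\<lambda>x. t i *\<^sub>R x) ` K i) = (\<Sum>i\<in>Suc ` ?U. (\<lambda>x. t i *\<^sub>R x) ` K i)" by (simp add: Suc_U)
    also have "\<dots> = (\<Sum>k\<in>?U. (\<lambda>x. t (Suc k) *\<^sub>R x) ` K (Suc k))"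
      by (subst sum.reindex) auto
    also have "\<dots> = (\<Sum>k\<in>?U. if k \<in> S then Ks ! k else 0)"
    proof (intro sum.cong refl)
      fix k assume "k \<in> ?U"
      then have "Ks ! k \<noteq> {}" using cb len by (auto simp: convex_body_def)
      then show "(\<lambda>x. t (Suc k) *\<^sub>R x) ` K (Suc k) = (if k \<in> S then Ks ! k else 0)"
        by (auto simp: t_def K_def set_zero)
    qed
    also have "\<dots> = (\<Sum>k\<in>S. Ks ! k)"
      using S by (simp add: sum.inter_restrict[symmetric] Int_absorb1)
    finally have sum_eq: "(\<Sum>i\<in>{1..?d}. (\<lambda>x. t i *\<^sub>R x) ` K i) = (\<Sum>k\<in>S. Ks ! k)" .
    have "(\<forall>i\<in>{1..?d}. convex_body (K i) \<and> 0 \<le> t i) \<longrightarrow>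
        measure lebesgue (\<Sum>i\<in>{1..?d}. (\<lambda>x. t i *\<^sub>R x) ` K i) =
        (\<Sum>ixs | length ixs = ?d \<and> set ixs \<subseteq> {1..?d}. prod_list (map t ixs) * V (map K ixs))"
      using V unfolding is_mixed_volume_def by blast
    then have "measure lebesgue (\<Sum>k\<in>S. Ks ! k)
        = (\<Sum>ixs | length ixs = ?d \<and> set ixs \<subseteq> Suc ` ?U. prod_list (map t ixs) * V (map K ixs))"
      using Kcb unfolding Suc_U sum_eq by (simp add: t_def)
    also have "\<dots> = (\<Sum>g\<in>?U \<rightarrow>\<^sub>E ?U. prod_list (map t (map (\<lambda>k. Suc (g k)) [0..<?d])) * V (map K (map (\<lambda>k. Suc (g k)) [0..<?d])))"
      by (rule sum.reindex_bij_betw[OF bij_betw_PiE_lists, symmetric]) simp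
    also have "\<dots> = (\<Sum>g\<in>?U \<rightarrow>\<^sub>E ?U. V (?L g) * of_bool (g ` ?U \<subseteq> S))"
    proof (intro sum.cong refl)
      fix g
      have "(\<Prod>k<?d. t (Suc (g k))) = of_bool (g ` ?U \<subseteq> S)"
      proof (cases "g ` ?U \<subseteq> S")
        case False
        then obtain k where "k < ?d" "g k \<notin> S" by auto
        then show ?thesis using False by (auto simp: t_def intro!: prod_zero)
      qed (auto simp: t_def intro!: prod.neutral)
      then show "prod_list (map t (map (\<lambda>k. Suc (g k)) [0..<?d])) * V (map K (map (\<lambda>k. Suc (g k)) [0..<?d]))
          = V (?L g) * of_bool (g ` ?U \<subseteq> S)"
        by (simp add: o_def prod_list_map_upt K_def)
    qed
    finally show ?thesis .
  qed
  have "polar_volume ((!) Ks) = polarize ?d (\<lambda>S. \<Sum>g\<in>?U \<rightarrow>\<^sub>E ?U. V (?L g) * of_bool (g ` ?U \<subseteq> S))"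
    unfolding polar_volume_def by (intro polarize_cong vol)
  also have "\<dots> = (\<Sum>g\<in>?U \<rightarrow>\<^sub>E ?U. V (?L g) * (of_bool (g ` ?U = ?U) / fact ?d))"
    unfolding polarize_sum polarize_cmult
  proof (intro sum.cong refl arg_cong2[where f = "(*)"])
    fix g assume "g \<in> ?U \<rightarrow>\<^sub>E ?U"
    then have "g ` ?U \<subseteq> ?U" by auto
    then show "polarize ?d (\<lambda>S. of_bool (g ` ?U \<subseteq> S)) = of_bool (g ` ?U = ?U) / fact ?d"
      unfolding polarize_def using alternating_sum_supersets[of ?U "g ` ?U"] by simp
  qed
  also have "\<dots> = (\<Sum>g\<in>{g \<in> ?U \<rightarrow>\<^sub>E ?U. g ` ?U = ?U}. V (?L g) / fact ?d)"
    by (intro sum.mono_neutral_cong_right) (auto intro!: finite_PiE)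
  also have "\<dots> = (\<Sum>\<sigma> | \<sigma> permutes ?U. V (?L (restrict \<sigma> ?U)) / fact ?d)"
    by (rule sum.reindex_bij_betw[OF permutes_eq_PiE_surj, symmetric]) simp
  also have "\<dots> = (\<Sum>\<sigma> | \<sigma> permutes ?U. V Ks / fact ?d)"
  proof (intro sum.cong refl)
    fix \<sigma> assume "\<sigma> \<in> {\<sigma>. \<sigma> permutes ?U}"
    then have \<sigma>: "\<sigma> permutes {..<length Ks}" using len by simp
    have "?L (restrict \<sigma> ?U) = permute_list \<sigma> Ks" using len by (simp add: permute_list_def)
    then have "mset Ks = mset (?L (restrict \<sigma> ?U))" using mset_permute_list[OF \<sigma>] by simp
    then have "V Ks = V (?L (restrict \<sigma> ?U))" by (rule V_sym)
    then show "V (?L (restrict \<sigma> ?U)) / fact ?d = V Ks / fact ?d" by simp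
  qed
  also have "\<dots> = V Ks" by (simp add: card_permutations)
  finally show ?thesis by simp
qed

lemma mixed_volume_eq_polar_volume:
  fixes Ks :: "'a::euclidean_space set list"
  assumes "length Ks = DIM('a)" "\<forall>K\<in>set Ks. convex_body K"
  shows "mixed_volume Ks = polar_volume ((!) Ks)"
  unfolding mixed_volume_def
proof (rule the_equality)
  show "\<exists>V. is_mixed_volume V \<and> polar_volume ((!) Ks) = V Ks"
    by (rule exI[of _ "\<lambda>Ks. polar_volume ((!) Ks)"]) (simp add: is_mixed_volume_polar_volume)
qed (use is_mixed_volume_unique assms in blast)

section \<open>Continuity of mixed volumes\<close>

lemma mem_segment_zero: "x \<in> closed_segment 0 u \<longleftrightarrow> (\<exists>a. 0 \<le> a \<and> a \<le> 1 \<and> x = a *\<^sub>R u)"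
  by (auto simp: in_segment)

lemma convex_body_segment: "convex_body (closed_segment a b)"
  by (simp add: convex_body_def)

text \<open>With \<open>P = s + Q\<close>, the set \<open>s + P\<close> is the union of
  \<open>P\<close> and its translate by \<open>u\<close>, and these two overlap exactly in the
  translate of \<open>Q\<close>. Thus volume has vanishing second difference along a
  segment.\<close>

lemma measure_plus_segment_twice:
  fixes Q :: "'a::euclidean_space set" and u :: 'a
  assumes Q: "convex_body Q"
  defines "s \<equiv> closed_segment 0 u"
  shows "measure lebesgue (s + (s + Q)) = 2 * measure lebesgue (s + Q) - measure lebesgue Q"
proof -
  define P where "P = s + Q"
  have mem_P: "x \<in> P \<longleftrightarrow> (\<exists>a q. 0 \<le> a \<and> a \<le> 1 \<and> q \<in> Q \<and> x = a *\<^sub>R u + q)" for x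
    by (auto simp: P_def set_plus_def s_def Bex_def mem_segment_zero)
  have cb: "convex_body P" unfolding P_def s_def by (intro convex_body_set_plus convex_body_segment Q)
  have un: "s + P = P \<union> (+) u ` P"
  proof
    show "s + P \<subseteq> P \<union> (+) u ` P"
    proof
      fix x assume "x \<in> s + P"
      then obtain y z where yz: "y \<in> s" "z \<in> P" "x = y + z" by (auto elim!: set_plus_elim)
      then obtain a b q where ab: "0 \<le> a" "a \<le> 1" "0 \<le> b" "b \<le> 1" "q \<in> Q" "x = a *\<^sub>R u + (b *\<^sub>R u + q)"
        by (auto simp: s_def mem_segment_zero mem_P)
      show "x \<in> P \<union> (+) u ` P"
      proof (cases "a + b \<le> 1")
        case True
        then have "x \<in> P" unfolding mem_P using ab
          by (intro exI[of _ "a + b"] exI[of _ q]) (auto simp: algebra_simps)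
        then show ?thesis by simp
      next
        case False
        then have "x - u \<in> P" unfolding mem_P using ab
          by (intro exI[of _ "a + b - 1"] exI[of _ q]) (auto simp: algebra_simps)
        then have "u + (x - u) \<in> (+) u ` P" by (rule imageI)
        then show ?thesis by simp
      qed
    qed
    have "0 \<in> s" "u \<in> s" by (auto simp: s_def)
    then show "P \<union> (+) u ` P \<subseteq> s + P"
      by (auto intro: set_plus_intro) (metis add.left_neutral set_plus_intro)
  qed
  have int: "P \<inter> (+) u ` P = (+) u ` Q"
  proof
    show "(+) u ` Q \<subseteq> P \<inter> (+) u ` P"
    proof safe
      fix q assume "q \<in> Q"
      then show "u + q \<in> P" unfolding mem_P by (intro exI[of _ 1] exI[of _ q]) auto
      have "q \<in> P" unfolding mem_P using \<open>q \<in> Q\<close> by (intro exI[of _ 0] exI[of _ q]) auto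
      then show "u + q \<in> (+) u ` P" by simp
    qed
    show "P \<inter> (+) u ` P \<subseteq> (+) u ` Q"
    proof
      fix x assume "x \<in> P \<inter> (+) u ` P"
      then obtain a q b r where
        a: "0 \<le> a" "a \<le> 1" "q \<in> Q" "x = a *\<^sub>R u + q" and
        b: "0 \<le> b" "b \<le> 1" "r \<in> Q" "x = u + (b *\<^sub>R u + r)"
        by (auto simp: mem_P)
      \<comment> \<open>The points \<open>q\<close> and \<open>r\<close> lie on a line parallel to
        \<open>u\<close>, on opposite sides of \<open>x - u\<close>. Weights proportional to
        \<open>b\<close> and \<open>1 - a\<close> cancel the two displacements; if both weights
        vanish, \<open>r\<close> itself equals \<open>x - u\<close>.\<close>
      have q: "q = (x - u) + (1 - a) *\<^sub>R u" and r: "r = (x - u) - b *\<^sub>R u"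
        using a b by (simp_all add: algebra_simps)
      have "x - u \<in> Q"
      proof (cases "b + (1 - a) = 0")
        case True
        then have "b = 0" using a b by linarith
        then show ?thesis using r b by simp
      next
        case False
        define c where "c = b + (1 - a)"
        have c: "c > 0" using False a b by (simp add: c_def)
        have "(b / c) *\<^sub>R q + ((1 - a) / c) *\<^sub>R r \<in> Q"
          using Q a b c by (intro convexD) (auto simp: convex_body_def c_def add_divide_distrib[symmetric])
        moreover have "(b / c) *\<^sub>R q + ((1 - a) / c) *\<^sub>R r = ((b + (1 - a)) / c) *\<^sub>R (x - u)"
          unfolding q r by (simp add: algebra_simps add_divide_distrib diff_divide_distrib)
        ultimately show ?thesis using c by (simp add: c_def)
      qed
      then have "u + (x - u) \<in> (+) u ` Q" by (rule imageI)
      then show "x \<in> (+) u ` Q" by simp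
    qed
  qed
  have "P \<in> lmeasurable" using cb by (simp add: convex_body_def lmeasurable_compact)
  then have "measure lebesgue (s + P) = measure lebesgue P + measure lebesgue P - measure lebesgue Q"
    unfolding un by (subst measure_Un3) (auto simp: int measure_translation measurable_translation)
  then show ?thesis by (simp add: P_def)
qed

text \<open>Index sets that differ only in \<open>k\<close> and \<open>l\<close> are grouped in
  fours; up to sign each group is the second difference of volume along the segment.\<close>

lemma polar_volume_repeated_segment:
  fixes K :: "nat \<Rightarrow> 'a::euclidean_space set"
  assumes k: "k < DIM('a)" "l < DIM('a)" "k \<noteq> l"
    and seg: "K k = closed_segment 0 u" "K l = closed_segment 0 u"
    and cb: "\<And>i. i < DIM('a) \<Longrightarrow> convex_body (K i)"
  shows "polar_volume K = 0"
proof -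
  let ?d = "DIM('a)"
  define W where "W = {..<?d} - {k, l}"
  have U: "{..<?d} = insert k (insert l W)" "k \<notin> insert l W" "l \<notin> W" "finite W"
    using k by (auto simp: W_def)
  define f where "f S = (-1) ^ (?d - card S) * measure lebesgue (\<Sum>i\<in>S. K i)" for S
  have "(\<Sum>S\<in>Pow {..<?d}. f S) = (\<Sum>S\<in>Pow W. f S + f (insert l S) + (f (insert k S) + f (insert k (insert l S))))"
    unfolding U(1) using U by (simp add: sum_Pow_insert sum.distrib)
  also have "\<dots> = 0"
  proof (rule sum.neutral, safe)
    fix S assume S: "S \<subseteq> W"
    then have fin: "finite S" "k \<notin> S" "l \<notin> S" using U finite_subset by auto
    have "card S \<le> card W" using S U card_mono by blast
    moreover have "?d = Suc (Suc (card W))" using U by (metis card_insert_disjoint card_lessThan finite_insert)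
    ultimately obtain m where m: "?d = Suc (Suc (m + card S))"
      by (metis add.commute le_add_diff_inverse2)
    have "convex_body (\<Sum>i\<in>S. K i)" using S cb by (intro convex_body_sum) (auto simp: W_def)
    note 2 = measure_plus_segment_twice[OF this, of u]
    show "f S + f (insert l S) + (f (insert k S) + f (insert k (insert l S))) = 0"
      unfolding f_def using fin k seg 2 by (simp add: m) (simp add: right_diff_distrib)
  qed
  finally show ?thesis unfolding polar_volume_def polarize_def f_def by simp
qed

section \<open>Uniform bounds and continuity in the Hausdorff sense\<close>

lemma sum_subset_cball:
  fixes K :: "'i \<Rightarrow> 'a::euclidean_space set"
  assumes "finite S" "\<And>k. k \<in> S \<Longrightarrow> K k \<subseteq> cball 0 R"
  shows "(\<Sum>k\<in>S. K k) \<subseteq> cball 0 (real (card S) * R)"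
proof
  fix x assume "x \<in> (\<Sum>k\<in>S. K k)"
  then obtain s where s: "x = sum s S" "\<forall>i\<in>S. s i \<in> K i" unfolding set_sum_alt[OF assms(1)] by auto
  have "norm x \<le> (\<Sum>i\<in>S. R)" unfolding s(1) using s(2) assms(2) by (intro sum_norm_le) force
  then show "x \<in> cball 0 (real (card S) * R)" by simp
qed

text \<open>There are \<open>2 ^ d\<close> partial sums, each inside the ball of radius
  \<open>d * R\<close>. The estimate is crude; what matters is that it is uniform over all bodies in
  a fixed ball.\<close>

lemma polar_volume_bound:
  fixes K :: "nat \<Rightarrow> 'a::euclidean_space set"
  assumes "0 \<le> R" and cb: "\<And>k. k < DIM('a) \<Longrightarrow> convex_body (K k)"
    and sub: "\<And>k. k < DIM('a) \<Longrightarrow> K k \<subseteq> cball 0 R"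
  shows "\<bar>polar_volume K\<bar> \<le> 2 ^ DIM('a) * measure lebesgue (cball (0::'a) (real DIM('a) * R))"
proof -
  let ?d = "DIM('a)"
  let ?B = "measure lebesgue (cball (0::'a) (real ?d * R))"
  have "\<bar>\<Sum>S\<in>Pow {..<?d}. (-1) ^ (?d - card S) * measure lebesgue (\<Sum>k\<in>S. K k)\<bar>
      \<le> (\<Sum>S\<in>Pow {..<?d}. ?B)"
  proof (rule order_trans[OF sum_abs sum_mono])
    fix S assume S: "S \<in> Pow {..<?d}"
    then have fin: "finite S" "card S \<le> ?d" using finite_subset subset_eq_atLeast0_lessThan_card
      by (auto simp: atLeast0LessThan)
    have "convex_body (\<Sum>k\<in>S. K k)" using S cb by (intro convex_body_sum) auto
    moreover have "(\<Sum>k\<in>S. K k) \<subseteq> cball 0 (real ?d * R)"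
    proof -
      have "(\<Sum>k\<in>S. K k) \<subseteq> cball 0 (real (card S) * R)" using S sub fin by (intro sum_subset_cball) auto
      also have "\<dots> \<subseteq> cball 0 (real ?d * R)" using fin assms(1) by (intro subset_cball mult_right_mono) auto
      finally show ?thesis .
    qed
    ultimately have "measure lebesgue (\<Sum>k\<in>S. K k) \<le> ?B"
      by (intro measure_compact_mono) (auto simp: convex_body_def)
    then show "\<bar>(-1) ^ (?d - card S) * measure lebesgue (\<Sum>k\<in>S. K k)\<bar> \<le> ?B"
      by (simp add: abs_mult)
  qed
  also have "\<dots> = 2 ^ ?d * ?B" by (simp add: card_Pow)
  finally have *: "\<bar>\<Sum>S\<in>Pow {..<?d}. (-1) ^ (?d - card S) * measure lebesgue (\<Sum>k\<in>S. K k)\<bar> \<le> 2 ^ ?d * ?B" .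
  have "\<bar>polar_volume K\<bar> = \<bar>\<Sum>S\<in>Pow {..<?d}. (-1) ^ (?d - card S) * measure lebesgue (\<Sum>k\<in>S. K k)\<bar> / fact ?d"
    by (simp add: polar_volume_def polarize_def abs_divide)
  also have "\<dots> \<le> \<bar>\<Sum>S\<in>Pow {..<?d}. (-1) ^ (?d - card S) * measure lebesgue (\<Sum>k\<in>S. K k)\<bar> / 1"
    by (intro divide_left_mono) (auto simp: fact_ge_1)
  finally show ?thesis using * by simp
qed

lemma cball_eq_scaleR_image: "0 \<le> r \<Longrightarrow> cball (0::'a::euclidean_space) r = (\<lambda>x. r *\<^sub>R x) ` cball 0 1"
  using cball_scale[of r "0::'a" 1] by (cases "r = 0") (auto simp: image_iff intro!: exI[of _ 0])

lemma minkowski_comb_ball: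
  fixes C :: "'a::euclidean_space set"
  assumes "0 \<le> \<epsilon>"
  shows "minkowski_comb UNIV (\<lambda>b. if b then 1 else \<epsilon>) (\<lambda>b. if b then C else cball 0 1) = C + cball 0 \<epsilon>"
  by (simp add: minkowski_comb_def UNIV_bool cball_eq_scaleR_image[OF assms, symmetric] add.commute)

text \<open>The constant depends on \<open>R\<close> but not on \<open>C\<close>. Volume of the
  parallel body is a polynomial in \<open>\<epsilon>\<close> whose coefficients are mixed volumes of
  \<open>C\<close> and the unit ball; both bodies lie in the ball of radius \<open>R\<close>, so the
  coefficients are uniformly bounded.\<close>

lemma measure_parallel_body_bound:
  fixes R :: real
  assumes R: "1 \<le> R"
  shows "\<exists>c. \<forall>C :: 'a::euclidean_space set. \<forall>\<epsilon>. convex_body C \<and> C \<subseteq> cball 0 R \<and> 0 \<le> \<epsilon> \<and> \<epsilon> \<le> 1 \<longrightarrow>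
    measure lebesgue (C + cball 0 \<epsilon>) \<le> measure lebesgue C + c * \<epsilon>"
proof -
  let ?d = "DIM('a)"
  define B where "B = 2 ^ ?d * measure lebesgue (cball (0::'a) (real ?d * R))"
  have B: "0 \<le> B" by (simp add: B_def)
  show ?thesis
  proof (intro exI[of _ "2 ^ ?d * B"] allI impI, elim conjE)
    fix C :: "'a set" and \<epsilon> :: real
    assume C: "convex_body C" "C \<subseteq> cball 0 R" and \<epsilon>: "0 \<le> \<epsilon>" "\<epsilon> \<le> 1"
    let ?K = "\<lambda>b. if b then C else cball 0 1"
    let ?t = "\<lambda>\<epsilon> b. if b then 1 else \<epsilon> :: real"
    let ?E = "{..<?d} \<rightarrow>\<^sub>E (UNIV :: bool set)"
    define v where "v g = polar_volume (\<lambda>k. ?K (g k))" for g :: "nat \<Rightarrow> bool"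
    have exp: "measure lebesgue (C + cball 0 \<epsilon>) = (\<Sum>g\<in>?E. (\<Prod>k<?d. ?t \<epsilon> (g k)) * v g)" if "0 \<le> \<epsilon>" for \<epsilon>
      unfolding minkowski_comb_ball[OF that, symmetric] v_def
      using C that by (intro measure_minkowski_comb) (auto simp: convex_body_cball)
    have vB: "\<bar>v g\<bar> \<le> B" for g
      unfolding v_def B_def using C R by (intro polar_volume_bound) (auto simp: convex_body_cball)
    \<comment> \<open>If some slot holds the ball, the product at \<open>0\<close> vanishes and the
      product at \<open>\<epsilon>\<close> is at most \<open>\<epsilon>\<close>, because
      \<open>\<epsilon> \<le> 1\<close>.\<close>
    have tle: "\<bar>(\<Prod>k<?d. ?t \<epsilon> (g k)) - (\<Prod>k<?d. ?t 0 (g k))\<bar> \<le> \<epsilon>" for g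
    proof (cases "\<forall>k<?d. g k")
      case True
      then show ?thesis using \<epsilon> by simp
    next
      case False
      then obtain k where k: "k < ?d" "\<not> g k" by auto
      have "(\<Prod>k<?d. ?t 0 (g k)) = 0" using k by auto
      moreover have "(\<Prod>k<?d. ?t \<epsilon> (g k)) = \<epsilon> * (\<Prod>k\<in>{..<?d}-{k}. ?t \<epsilon> (g k))"
        using k by (subst prod.remove[of _ k]) auto
      moreover have "(\<Prod>k\<in>{..<?d}-{k}. ?t \<epsilon> (g k)) \<le> 1" using \<epsilon> by (intro prod_le_1) auto
      moreover have "0 \<le> (\<Prod>k\<in>{..<?d}-{k}. ?t \<epsilon> (g k))" using \<epsilon> by (intro prod_nonneg) auto
      ultimately show ?thesis using \<epsilon> by (simp only:) (simp add: abs_mult mult_left_le)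
    qed
    have "measure lebesgue (C + cball 0 \<epsilon>) - measure lebesgue (C + cball 0 0)
        = (\<Sum>g\<in>?E. ((\<Prod>k<?d. ?t \<epsilon> (g k)) - (\<Prod>k<?d. ?t 0 (g k))) * v g)"
      using exp[OF \<epsilon>(1)] exp[of 0] by (simp add: sum_subtractf left_diff_distrib)
    also have "\<dots> \<le> (\<Sum>g\<in>?E. \<epsilon> * B)"
    proof (rule sum_mono)
      fix g
      have "((\<Prod>k<?d. ?t \<epsilon> (g k)) - (\<Prod>k<?d. ?t 0 (g k))) * v g
          \<le> \<bar>(\<Prod>k<?d. ?t \<epsilon> (g k)) - (\<Prod>k<?d. ?t 0 (g k))\<bar> * \<bar>v g\<bar>"
        by (metis abs_ge_self abs_mult)
      also have "\<dots> \<le> \<epsilon> * B" using tle vB \<epsilon> by (intro mult_mono) auto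
      finally show "((\<Prod>k<?d. ?t \<epsilon> (g k)) - (\<Prod>k<?d. ?t 0 (g k))) * v g \<le> \<epsilon> * B" .
    qed
    also have "\<dots> = 2 ^ ?d * B * \<epsilon>" by (simp add: card_PiE UNIV_bool)
    finally show "measure lebesgue (C + cball 0 \<epsilon>) \<le> measure lebesgue C + 2 ^ ?d * B * \<epsilon>"
      by (simp flip: set_zero)
  qed
qed

text \<open>From above, the parallel bodies of the fixed body \<open>D\<close> suffice. From below,
  \<open>D\<close> lies in parallel bodies of the varying \<open>C n\<close>, and there the constant
  must be uniform in \<open>n\<close>.\<close>

lemma measure_convex_body_tendsto:
  fixes D :: "'a::euclidean_space set"
  assumes D: "convex_body D" and C: "\<And>n. convex_body (C n)" and r: "r \<longlonglongrightarrow> 0" "\<And>n. 0 \<le> r n"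
    and sub: "\<And>n. C n \<subseteq> D + cball 0 (r n)" "\<And>n. D \<subseteq> C n + cball 0 (r n)"
  shows "(\<lambda>n. measure lebesgue (C n)) \<longlonglongrightarrow> measure lebesgue D"
proof -
  have "bounded D" using D by (simp add: convex_body_def compact_imp_bounded)
  then obtain R0 where R0: "D \<subseteq> cball 0 R0" "R0 > 0" by (metis bounded_subset_ballD ball_subset_cball order_trans)
  \<comment> \<open>Large enough to contain \<open>C n\<close> as soon as
    \<open>r n \<le> 1\<close>.\<close>
  define R where "R = R0 + 1"
  obtain c where c: "\<And>C \<epsilon>. convex_body C \<Longrightarrow> (C::'a set) \<subseteq> cball 0 R \<Longrightarrow> 0 \<le> \<epsilon> \<Longrightarrow> \<epsilon> \<le> 1 \<Longrightarrow>
      measure lebesgue (C + cball 0 \<epsilon>) \<le> measure lebesgue C + c * \<epsilon>"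
  proof -
    obtain c where "\<forall>C :: 'a set. \<forall>\<epsilon>. convex_body C \<and> C \<subseteq> cball 0 R \<and> 0 \<le> \<epsilon> \<and> \<epsilon> \<le> 1 \<longrightarrow>
        measure lebesgue (C + cball 0 \<epsilon>) \<le> measure lebesgue C + c * \<epsilon>"
      using measure_parallel_body_bound[of R, where 'a='a] R0 by (auto simp: R_def)
    then show ?thesis by (intro that[of c]) blast
  qed
  have comp: "compact (E + cball 0 (r n))" if "convex_body E" for E :: "'a set" and n
    using convex_body_set_plus[OF that convex_body_cball[OF r(2)]] by (simp add: convex_body_def)
  have ev: "\<forall>\<^sub>F n in sequentially. r n \<le> 1"
    using order_tendstoD(2)[OF r(1), of 1] by (auto elim: eventually_mono)
  show ?thesis
  proof (rule tendsto_sandwich[where f = "\<lambda>n. measure lebesgue D - c * r n"])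
    show "(\<lambda>n. measure lebesgue (D + cball 0 (r n))) \<longlonglongrightarrow> measure lebesgue D"
      using D r by (intro measure_parallel_body_tendsto) (auto simp: convex_body_def)
    show "(\<lambda>n. measure lebesgue D - c * r n) \<longlonglongrightarrow> measure lebesgue D"
      using tendsto_diff[OF tendsto_const tendsto_mult_right_zero[OF r(1), of c], of "measure lebesgue D"] by simp
    show "\<forall>\<^sub>F n in sequentially. measure lebesgue (C n) \<le> measure lebesgue (D + cball 0 (r n))"
      using C D by (intro always_eventually allI measure_compact_mono comp sub) (auto simp: convex_body_def)
    show "\<forall>\<^sub>F n in sequentially. measure lebesgue D - c * r n \<le> measure lebesgue (C n)"
      using ev
    proof eventually_elim
      case (elim n)
      have "C n \<subseteq> cball 0 R"
      proof
        fix x assume "x \<in> C n"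
        then obtain y z where "y \<in> D" "norm z \<le> r n" "x = y + z"
          using sub(1) by (fastforce elim!: set_plus_elim)
        then show "x \<in> cball 0 R"
          using R0 elim norm_triangle_ineq[of y z] by (force simp: R_def)
      qed
      then have "measure lebesgue (C n + cball 0 (r n)) \<le> measure lebesgue (C n) + c * r n"
        using C r elim by (intro c)
      moreover have "measure lebesgue D \<le> measure lebesgue (C n + cball 0 (r n))"
        using D by (intro measure_compact_mono comp sub C) (auto simp: convex_body_def)
      ultimately show ?case by simp
    qed
  qed
qed

lemma set_sum_parallel_subset:
  fixes K L :: "'i \<Rightarrow> 'a::euclidean_space set"
  assumes "finite S" "\<And>k. k \<in> S \<Longrightarrow> K k \<subseteq> L k + cball 0 r"
  shows "(\<Sum>k\<in>S. K k) \<subseteq> (\<Sum>k\<in>S. L k) + cball 0 (real (card S) * r)"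
  using minkowski_comb_parallel_subset[OF assms(1), of "\<lambda>_. 1" K L r] assms(2) by (simp add: minkowski_comb_def)

lemma polar_volume_tendsto:
  fixes L :: "nat \<Rightarrow> 'a::euclidean_space set"
  assumes L: "\<And>k. k < DIM('a) \<Longrightarrow> convex_body (L k)"
    and K: "\<And>n k. k < DIM('a) \<Longrightarrow> convex_body (K n k)"
    and r: "r \<longlonglongrightarrow> 0" "\<And>n. 0 \<le> r n"
    and sub: "\<And>n k. k < DIM('a) \<Longrightarrow> K n k \<subseteq> L k + cball 0 (r n)"
      "\<And>n k. k < DIM('a) \<Longrightarrow> L k \<subseteq> K n k + cball 0 (r n)"
  shows "(\<lambda>n. polar_volume (K n)) \<longlonglongrightarrow> polar_volume L"
  unfolding polar_volume_def polarize_def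
proof (intro tendsto_intros)
  fix S assume S: "S \<in> Pow {..<DIM('a)}"
  then have fin: "finite S" using finite_subset by auto
  show "(\<lambda>n. measure lebesgue (\<Sum>k\<in>S. K n k)) \<longlonglongrightarrow> measure lebesgue (\<Sum>k\<in>S. L k)"
  proof (rule measure_convex_body_tendsto)
    show "(\<lambda>n. real (card S) * r n) \<longlonglongrightarrow> 0" by (rule tendsto_mult_right_zero[OF r(1)])
    show "(\<Sum>k\<in>S. K n k) \<subseteq> (\<Sum>k\<in>S. L k) + cball 0 (real (card S) * r n)"
      "(\<Sum>k\<in>S. L k) \<subseteq> (\<Sum>k\<in>S. K n k) + cball 0 (real (card S) * r n)" for n
      by (rule set_sum_parallel_subset; use S fin sub in blast)+
  qed (use S L K r in \<open>auto intro!: convex_body_sum mult_nonneg_nonneg\<close>)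
qed simp

section \<open>Volumes of coordinate sections\<close>

lemma orthonormal_family_Suc:
  assumes b: "orthonormal_family j b" and w: "norm w = 1" "\<And>i. i \<in> {1..j} \<Longrightarrow> w \<bullet> b i = 0"
  shows "orthonormal_family (Suc j) (b(Suc j := w))"
  unfolding orthonormal_family_def
proof (intro ballI)
  fix i k assume ik: "i \<in> {1..Suc j}" "k \<in> {1..Suc j}"
  have "w \<bullet> w = 1" using w(1) by (simp add: norm_eq_1)
  then show "(b(Suc j := w)) i \<bullet> (b(Suc j := w)) k = (if i = k then 1 else 0)"
    using ik b w(2) unfolding orthonormal_family_def
    by (cases "i = Suc j"; cases "k = Suc j") (auto simp: inner_commute le_Suc_eq)
qed

lemma exists_orthogonal_unit:
  fixes b :: "nat \<Rightarrow> 'a::euclidean_space"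
  assumes "j < DIM('a)"
  shows "\<exists>w. norm w = 1 \<and> (\<forall>i\<in>{1..j}. w \<bullet> b i = 0)"
proof -
  have "dim (b ` {1..j}) \<le> card (b ` {1..j})" by (rule dim_le_card) (auto intro: span_base)
  also have "\<dots> \<le> j" using card_image_le[of "{1..j}" b] by simp
  finally have "dim (b ` {1..j}) < DIM('a)" using assms by simp
  then obtain x where x: "x \<noteq> 0" "\<And>y. y \<in> span (b ` {1..j}) \<Longrightarrow> orthogonal x y"
    by (rule orthogonal_to_subspace_exists) blast
  then have "sgn x \<bullet> b i = 0" if "i \<in> {1..j}" for i
    using that by (auto simp: orthogonal_def sgn_div_norm span_base)
  then show ?thesis using x(1) by (intro exI[of _ "sgn x"]) (auto simp: norm_sgn)
qed

lemma orthonormal_family_extend: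
  fixes b :: "nat \<Rightarrow> 'a::euclidean_space"
  assumes "orthonormal_family j b" "j \<le> n" "n \<le> DIM('a)"
  shows "\<exists>e. orthonormal_family n e \<and> (\<forall>i\<in>{1..j}. e i = b i)"
  using assms(2,3)
proof (induction n rule: dec_induct)
  case base
  then show ?case using assms(1) by blast
next
  case (step n)
  then obtain e where e: "orthonormal_family n e" "\<forall>i\<in>{1..j}. e i = b i" by auto
  obtain w where w: "norm w = 1" "\<forall>i\<in>{1..n}. w \<bullet> e i = 0"
    using exists_orthogonal_unit[of n e] step by auto
  show ?case
  proof (intro exI conjI ballI)
    show "orthonormal_family (Suc n) (e(Suc n := w))" using w by (intro orthonormal_family_Suc e) auto
    show "(e(Suc n := w)) i = b i" if "i \<in> {1..j}" for i using e(2) step that by auto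
  qed
qed

lemma exists_orthonormal_family_span:
  fixes u :: "nat \<Rightarrow> 'a::euclidean_space"
  assumes "j \<le> DIM('a)"
  shows "\<exists>b. orthonormal_family j b \<and> (\<forall>i\<in>{1..j}. u i \<in> span (b ` {1..j}))"
  using assms
proof (induction j)
  case 0
  then show ?case by (auto simp: orthonormal_family_def)
next
  case (Suc j)
  then obtain b where b: "orthonormal_family j b" "\<forall>i\<in>{1..j}. u i \<in> span (b ` {1..j})" by auto
  define p where "p = (\<Sum>i\<in>{1..j}. (u (Suc j) \<bullet> b i) *\<^sub>R b i)"
  define x where "x = u (Suc j) - p"
  have p: "p \<in> span (b ` {1..j})" unfolding p_def by (intro span_sum span_scale span_base) auto
  have orth: "x \<bullet> b k = 0" if "k \<in> {1..j}" for k
  proof -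
    have "p \<bullet> b k = (\<Sum>i\<in>{1..j}. if i = k then u (Suc j) \<bullet> b i else 0)"
      unfolding p_def inner_sum_left using b(1) that
      by (intro sum.cong refl) (auto simp: orthonormal_family_def)
    then show ?thesis using that by (simp add: x_def inner_diff_left)
  qed
  \<comment> \<open>Gram-Schmidt with degenerate steps: if the new vector already lies in the span,
    any unit vector orthogonal to the family fills the slot, so the family has size \<open>j\<close>
    even for dependent vectors.\<close>
  obtain w where w: "norm w = 1" "\<forall>i\<in>{1..j}. w \<bullet> b i = 0" "x \<in> span {w}"
  proof (cases "x = 0")
    case True
    then show ?thesis using exists_orthogonal_unit[of j b] Suc.prems that by (auto simp: span_zero)
  next
    case False
    have "x = norm x *\<^sub>R sgn x" using False by (simp add: sgn_div_norm)
    then have "x \<in> span {sgn x}" by (metis insertI1 span_base span_scale)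
    then show ?thesis using False orth by (intro that[of "sgn x"]) (auto simp: norm_sgn sgn_div_norm)
  qed
  let ?b = "b(Suc j := w)"
  have img: "?b ` {1..Suc j} = insert w (b ` {1..j})" by (auto simp: image_iff le_Suc_eq)
  have sub: "span (b ` {1..j}) \<subseteq> span (?b ` {1..Suc j})" "span {w} \<subseteq> span (?b ` {1..Suc j})"
    unfolding img by (intro span_mono; auto)+
  have "u (Suc j) = p + x" by (simp add: x_def)
  then have "u (Suc j) \<in> span (?b ` {1..Suc j})" using p w(3) sub by (metis span_add subsetD)
  then have "u i \<in> span (?b ` {1..Suc j})" if "i \<in> {1..Suc j}" for i
    using b(2) sub that by (cases "i = Suc j") (auto simp del: fun_upd_apply)
  moreover have "orthonormal_family (Suc j) ?b" using w(2) by (intro orthonormal_family_Suc b(1) w(1)) auto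
  ultimately show ?case by blast
qed

section \<open>Lebesgue measure in enumerated coordinates\<close>

interpretation lborel_product: product_sigma_finite "\<lambda>_. lborel :: real measure"
  by standard

text \<open>Since \<open>volume_dim\<close> measures coordinate vectors indexed by
  \<open>{1..j}\<close>, numbering the axes allows the first \<open>j\<close> coordinates to be
  split off by Fubini.\<close>

lemma lborel_eq_enumerated:
  fixes \<beta> :: "'i \<Rightarrow> 'a::euclidean_space"
  assumes N: "finite N" and \<beta>: "bij_betw \<beta> N Basis"
  shows "lborel = distr (Pi\<^sub>M N (\<lambda>_. lborel)) borel (\<lambda>x. \<Sum>i\<in>N. x i *\<^sub>R \<beta> i)"
proof (rule lborel_eqI)
  let ?T = "\<lambda>x. \<Sum>i\<in>N. x i *\<^sub>R \<beta> i"
  have meas[measurable]: "?T \<in> Pi\<^sub>M N (\<lambda>_. lborel) \<rightarrow>\<^sub>M borel" by measurable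
  have \<beta>in: "\<beta> i \<in> Basis" if "i \<in> N" for i using \<beta> that by (auto simp: bij_betw_def)
  have coord: "?T x \<bullet> \<beta> k = x k" if k: "k \<in> N" for x k
  proof -
    have "?T x \<bullet> \<beta> k = (\<Sum>i\<in>N. if i = k then x i else 0)"
      unfolding inner_sum_left
    proof (intro sum.cong refl)
      fix i assume i: "i \<in> N"
      have "\<beta> i = \<beta> k \<longleftrightarrow> i = k" using \<beta> i k by (auto simp: bij_betw_def inj_on_def)
      then show "x i *\<^sub>R \<beta> i \<bullet> \<beta> k = (if i = k then x i else 0)"
        using inner_Basis[OF \<beta>in[OF i] \<beta>in[OF k]] by simp
    qed
    then show ?thesis using N k by simp
  qed
  fix l u :: 'a assume lu: "\<And>b. b \<in> Basis \<Longrightarrow> l \<bullet> b \<le> u \<bullet> b"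
  have "?T -` box l u \<inter> space (Pi\<^sub>M N (\<lambda>_. lborel)) = (\<Pi>\<^sub>E i\<in>N. {l \<bullet> \<beta> i<..<u \<bullet> \<beta> i})"
  proof -
    have "(\<forall>b\<in>Basis. l \<bullet> b < y \<bullet> b \<and> y \<bullet> b < u \<bullet> b) \<longleftrightarrow> (\<forall>i\<in>N. l \<bullet> \<beta> i < y \<bullet> \<beta> i \<and> y \<bullet> \<beta> i < u \<bullet> \<beta> i)" for y
      unfolding bij_betw_imp_surj_on[OF \<beta>, symmetric] by simp
    then show ?thesis by (auto simp: mem_box coord space_PiM PiE_iff)
  qed
  then have "emeasure (distr (Pi\<^sub>M N (\<lambda>_. lborel)) borel ?T) (box l u)
      = emeasure (Pi\<^sub>M N (\<lambda>_. lborel)) (\<Pi>\<^sub>E i\<in>N. {l \<bullet> \<beta> i<..<u \<bullet> \<beta> i})"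
    by (simp add: emeasure_distr)
  also have "\<dots> = (\<Prod>i\<in>N. emeasure lborel {l \<bullet> \<beta> i<..<u \<bullet> \<beta> i})"
    using N by (intro lborel_product.emeasure_PiM) auto
  also have "\<dots> = (\<Prod>i\<in>N. ennreal ((u - l) \<bullet> \<beta> i))"
    using lu \<beta>in by (intro prod.cong refl) (simp add: inner_diff_left)
  also have "\<dots> = (\<Prod>b\<in>Basis. ennreal ((u - l) \<bullet> b))"
    by (rule prod.reindex_bij_betw[OF \<beta>])
  also have "\<dots> = ennreal (\<Prod>b\<in>Basis. (u - l) \<bullet> b)"
    using lu by (intro prod_ennreal) (simp add: inner_diff_left)
  finally show "emeasure (distr (Pi\<^sub>M N (\<lambda>_. lborel)) borel ?T) (box l u) = ennreal (\<Prod>b\<in>Basis. (u - l) \<bullet> b)" .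
qed simp

text \<open>Fubini: in coordinates the set is the product of \<open>Q\<close> and the unit ball of its orthogonal complement.\<close>
lemma measure_plus_orthogonal_ball:
  fixes \<beta> :: "nat \<Rightarrow> 'a::euclidean_space"
  assumes \<beta>: "bij_betw \<beta> {1..DIM('a)} Basis" and j: "j \<le> DIM('a)"
    and Q: "compact Q" "\<And>x i. x \<in> Q \<Longrightarrow> i \<in> {j<..DIM('a)} \<Longrightarrow> x \<bullet> \<beta> i = 0"
  defines "E \<equiv> {y. norm y \<le> 1 \<and> (\<forall>i\<in>{1..j}. y \<bullet> \<beta> i = 0)}"
  shows "measure lebesgue (Q + E)
    = measure (Pi\<^sub>M {1..j} (\<lambda>_. lborel)) {x \<in> {1..j} \<rightarrow>\<^sub>E UNIV. (\<Sum>i=1..j. x i *\<^sub>R \<beta> i) \<in> Q}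
      * unit_ball_vol (real (DIM('a) - j))"
proof -
  let ?d = "DIM('a)"
  let ?I = "{1..j}" and ?J = "{j<..?d}"
  have IJ: "?I \<union> ?J = {1..?d}" "?I \<inter> ?J = {}" using j by auto
  let ?T = "\<lambda>N x. \<Sum>i\<in>N. x i *\<^sub>R \<beta> i"
  have \<beta>in: "\<beta> i \<in> Basis" if "i \<in> {1..?d}" for i by (rule bij_betwE[OF \<beta>, rule_format, OF that])
  have ip: "\<beta> i \<bullet> \<beta> k = (if i = k then 1 else 0)" if "i \<in> {1..?d}" "k \<in> {1..?d}" for i k
  proof -
    have "\<beta> i = \<beta> k \<longleftrightarrow> i = k" by (rule inj_on_eq_iff[OF bij_betw_imp_inj_on[OF \<beta>] that])
    then show ?thesis unfolding inner_Basis[OF \<beta>in[OF that(1)] \<beta>in[OF that(2)]] by simp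
  qed
  have coord: "?T N x \<bullet> \<beta> k = (if k \<in> N then x k else 0)" if "N \<subseteq> {1..?d}" "k \<in> {1..?d}" for N x k
  proof -
    have "?T N x \<bullet> \<beta> k = (\<Sum>i\<in>N. if i = k then x i else 0)"
      unfolding inner_sum_left using that ip by (intro sum.cong refl) auto
    moreover have "finite N" using that(1) by (rule finite_subset) simp
    ultimately show ?thesis by simp
  qed
  have expand: "y = ?T {1..?d} (\<lambda>i. y \<bullet> \<beta> i)" for y
    by (subst euclidean_representation[of y, symmetric]) (rule sum.reindex_bij_betw[OF \<beta>, symmetric])
  have normT: "norm (?T ?J x) = sqrt (\<Sum>i\<in>?J. (x i)\<^sup>2)" for x
  proof -
    have "y \<bullet> ?T ?J x = (\<Sum>i\<in>?J. x i * (y \<bullet> \<beta> i))" for y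
      by (simp add: inner_sum_right)
    then have "?T ?J x \<bullet> ?T ?J x = (\<Sum>i\<in>?J. x i * (?T ?J x \<bullet> \<beta> i))" .
    also have "\<dots> = (\<Sum>i\<in>?J. (x i)\<^sup>2)"
      using IJ by (intro sum.cong refl) (subst coord, auto simp: power2_eq_square)
    finally show ?thesis by (simp add: norm_eq_sqrt_inner)
  qed
  define X1 where "X1 = {x \<in> ?I \<rightarrow>\<^sub>E UNIV. ?T ?I x \<in> Q}"
  define X2 where "X2 = {f. sqrt (\<Sum>i\<in>?J. (f i)\<^sup>2) \<le> 1} \<inter> space (Pi\<^sub>M ?J (\<lambda>_. lborel))"
  have "E = cball 0 1 \<inter> (\<Inter>i\<in>?I. {y. \<beta> i \<bullet> y = 0})" by (auto simp: E_def inner_commute)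
  then have "compact E" by (simp add: compact_Int_closed closed_INT closed_hyperplane)
  then have comp: "compact (Q + E)" by (rule compact_set_plus[OF Q(1)])
  \<comment> \<open>Uniqueness of the orthogonal decomposition: points of \<open>Q\<close> have no
    coordinates beyond \<open>j\<close>, points of \<open>E\<close> none up to
    \<open>j\<close>.\<close>
  have mem: "?T {1..?d} x \<in> Q + E \<longleftrightarrow> ?T ?I x \<in> Q \<and> norm (?T ?J x) \<le> 1" for x
  proof -
    have split: "?T {1..?d} x = ?T ?I x + ?T ?J x"
      unfolding IJ(1)[symmetric] using IJ(2) by (intro sum.union_disjoint) auto
    show ?thesis
    proof
      assume "?T {1..?d} x \<in> Q + E"
      then obtain q y where qy: "q \<in> Q" "y \<in> E" "?T {1..?d} x = q + y" by (auto elim!: set_plus_elim)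
      have c: "x i = q \<bullet> \<beta> i + y \<bullet> \<beta> i" if "i \<in> {1..?d}" for i
        using coord[of "{1..?d}" i x] that qy(3) by (simp add: inner_add_left)
      have "q = ?T {1..?d} (\<lambda>i. q \<bullet> \<beta> i)" by (rule expand)
      also have "\<dots> = ?T ?I x"
        using qy Q(2) c j by (intro sum.mono_neutral_cong_right) (auto simp: E_def)
      finally have q: "q = ?T ?I x" .
      moreover have "y = ?T ?J x" using q split qy(3) by simp
      ultimately show "?T ?I x \<in> Q \<and> norm (?T ?J x) \<le> 1" using qy by (auto simp: E_def)
    next
      assume a: "?T ?I x \<in> Q \<and> norm (?T ?J x) \<le> 1"
      moreover have "?T ?J x \<bullet> \<beta> i = 0" if "i \<in> ?I" for i
        using coord[of ?J i x] that j by (simp add: subset_iff)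
      ultimately have "?T ?J x \<in> E" unfolding E_def by blast
      then show "?T {1..?d} x \<in> Q + E" unfolding split using a by (intro set_plus_intro) auto
    qed
  qed
  have T1: "?T ?I \<in> Pi\<^sub>M ?I (\<lambda>_. lborel) \<rightarrow>\<^sub>M borel" by measurable
  have X1: "X1 \<in> sets (Pi\<^sub>M ?I (\<lambda>_. lborel))"
  proof -
    have "X1 = ?T ?I -` Q \<inter> space (Pi\<^sub>M ?I (\<lambda>_. lborel))" by (auto simp: X1_def space_PiM)
    then show ?thesis using measurable_sets[OF T1, of Q] Q(1) by (simp add: borel_compact)
  qed
  have X2: "X2 \<in> sets (Pi\<^sub>M ?J (\<lambda>_. lborel))"
  proof -
    have "(\<lambda>f. sqrt (\<Sum>i\<in>?J. (f i)\<^sup>2)) \<in> Pi\<^sub>M ?J (\<lambda>_. lborel) \<rightarrow>\<^sub>M borel" by measurable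
    then have "(\<lambda>f. sqrt (\<Sum>i\<in>?J. (f i)\<^sup>2)) -` {..1} \<inter> space (Pi\<^sub>M ?J (\<lambda>_. lborel)) \<in> sets (Pi\<^sub>M ?J (\<lambda>_. lborel))"
      by (rule measurable_sets) simp
    then show ?thesis by (simp add: X2_def vimage_def)
  qed
  interpret J: finite_product_sigma_finite "\<lambda>_. lborel :: real measure" ?J by standard simp
  let ?PI = "Pi\<^sub>M ?I (\<lambda>_. lborel :: real measure)" and ?PJ = "Pi\<^sub>M ?J (\<lambda>_. lborel :: real measure)"
  have meas: "?T {1..?d} \<in> Pi\<^sub>M {1..?d} (\<lambda>_. lborel) \<rightarrow>\<^sub>M borel" by measurable
  have pre: "?T {1..?d} -` (Q + E) \<inter> space (Pi\<^sub>M {1..?d} (\<lambda>_. lborel)) \<in> sets (Pi\<^sub>M (?I \<union> ?J) (\<lambda>_. lborel))"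
    unfolding IJ(1) using comp by (intro measurable_sets[OF meas]) (simp add: borel_compact)
  have "emeasure lborel (Q + E)
      = emeasure (Pi\<^sub>M (?I \<union> ?J) (\<lambda>_. lborel)) (?T {1..?d} -` (Q + E) \<inter> space (Pi\<^sub>M {1..?d} (\<lambda>_. lborel)))"
    unfolding IJ(1) by (subst lborel_eq_enumerated[OF _ \<beta>]) (use comp in \<open>simp_all add: emeasure_distr borel_compact\<close>)
  also have "\<dots> = emeasure (?PI \<Otimes>\<^sub>M ?PJ) (merge ?I ?J -` (?T {1..?d} -` (Q + E) \<inter> space (Pi\<^sub>M {1..?d} (\<lambda>_. lborel))) \<inter> space (?PI \<Otimes>\<^sub>M ?PJ))"
    by (subst lborel_product.distr_merge[OF IJ(2), symmetric]) (use pre in \<open>simp_all add: emeasure_distr\<close>)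
  also have "merge ?I ?J -` (?T {1..?d} -` (Q + E) \<inter> space (Pi\<^sub>M {1..?d} (\<lambda>_. lborel))) \<inter> space (?PI \<Otimes>\<^sub>M ?PJ) = X1 \<times> X2"
  proof -
    have 1: "?T ?I (merge ?I ?J (x, y)) = ?T ?I x" "?T ?J (merge ?I ?J (x, y)) = ?T ?J y" for x y :: "nat \<Rightarrow> real"
      using IJ by (auto intro!: sum.cong simp: merge_def)
    have "merge ?I ?J (x, y) \<in> {1..?d} \<rightarrow>\<^sub>E UNIV" for x y :: "nat \<Rightarrow> real"
      using extensional_merge[of ?I ?J x y] unfolding IJ(1) by (auto simp: PiE_def)
    moreover have "?T {1..?d} (merge ?I ?J (x, y)) \<in> Q + E
        \<longleftrightarrow> ?T ?I x \<in> Q \<and> sqrt (\<Sum>i\<in>?J. (y i)\<^sup>2) \<le> 1" for x y :: "nat \<Rightarrow> real"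
      using mem[of "merge ?I ?J (x, y)"] normT[of y] by (simp only: 1)
    ultimately show ?thesis
      unfolding X1_def X2_def by (auto simp only: space_pair_measure space_PiM space_lborel vimage_eq Int_iff
          mem_Sigma_iff mem_Collect_eq space_borel)
  qed
  also have "emeasure (?PI \<Otimes>\<^sub>M ?PJ) (X1 \<times> X2) = emeasure ?PI X1 * emeasure ?PJ X2"
    by (rule J.emeasure_pair_measure_Times[OF X1 X2])
  also have "emeasure ?PJ X2 = ennreal (unit_ball_vol (real (?d - j)))"
    unfolding X2_def using emeasure_cball_aux[of ?J 1] by simp
  finally have "measure lborel (Q + E) = measure ?PI X1 * unit_ball_vol (real (?d - j))"
    by (simp add: measure_def enn2real_mult)
  then show ?thesis using comp by (simp add: measure_lebesgue_compact X1_def)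
qed

lemma measure_diagonal_image:
  fixes c :: "'a::euclidean_space \<Rightarrow> real"
  assumes c: "\<And>b. b \<in> Basis \<Longrightarrow> c b > 0" and S: "compact S"
  defines "D \<equiv> \<lambda>x. \<Sum>b\<in>Basis. (c b * (x \<bullet> b)) *\<^sub>R b"
  shows "measure lebesgue (D ` S) = (\<Prod>b\<in>Basis. c b) * measure lebesgue S"
proof -
  have D: "continuous_on UNIV D" unfolding D_def by (intro continuous_intros)
  then have meas: "D \<in> borel_measurable borel" by (rule borel_measurable_continuous_onI)
  have comp: "compact (D ` S)" using S D by (intro compact_continuous_image) (auto intro: continuous_on_subset)
  have Db: "D x \<bullet> b = c b * (x \<bullet> b)" if "b \<in> Basis" for x b using that by (simp add: D_def)
  have "inj D"
  proof (rule injI)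
    fix x y assume eq: "D x = D y"
    show "x = y"
    proof (rule euclidean_eqI)
      fix b :: 'a assume b: "b \<in> Basis"
      then have "c b * (x \<bullet> b) = c b * (y \<bullet> b)" using eq Db by metis
      then show "x \<bullet> b = y \<bullet> b" using c[OF b] by simp
    qed
  qed
  have "lborel = density (distr lborel borel (\<lambda>x. 0 + D x)) (\<lambda>_. (\<Prod>b\<in>Basis. \<bar>c b\<bar>))"
    unfolding D_def using c less_imp_neq by (intro lborel_affine_euclidean) fastforce
  then have lb: "lborel = density (distr lborel borel D) (\<lambda>_. (\<Prod>b\<in>Basis. \<bar>c b\<bar>))" by simp
  have "emeasure lborel (D ` S) = (\<Prod>b\<in>Basis. \<bar>c b\<bar>) * emeasure lborel (D -` D ` S)"
    by (subst lb) (use meas comp in \<open>simp add: emeasure_density nn_integral_cmult_indicator emeasure_distr borel_compact\<close>)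
  also have "D -` D ` S = S" using \<open>inj D\<close> by (simp add: inj_vimage_image_eq)
  also have "(\<Prod>b\<in>Basis. \<bar>c b\<bar>) = (\<Prod>b\<in>Basis. c b)" using c by (intro prod.cong) (auto simp: less_imp_le)
  finally have "measure lborel (D ` S) = (\<Prod>b\<in>Basis. c b) * measure lborel S"
    using prod_nonneg[of Basis c] c by (simp add: measure_def enn2real_mult less_imp_le)
  then show ?thesis using comp S by (simp add: measure_lebesgue_compact)
qed

text \<open>
  Rotating the orthonormal family into the standard basis and shrinking its span by the factor
  \<open>1 / s\<close> turns \<open>B + s P\<close> into \<open>P + B'\<close>, where \<open>B'\<close> is an ellipsoid that collapses to the unit
  ball of the orthogonal complement.
\<close>
lemma parallel_volume_limit:
  fixes b :: "nat \<Rightarrow> 'a::euclidean_space"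
  assumes b: "orthonormal_family j b" and j: "j \<le> DIM('a)" and P: "compact P" "P \<subseteq> span (b ` {1..j})"
  shows "(\<lambda>n. measure lebesgue (cball 0 1 + (\<lambda>x. real (Suc n) *\<^sub>R x) ` P) / real (Suc n) ^ j)
    \<longlonglongrightarrow> measure (Pi\<^sub>M {1..j} (\<lambda>_. lborel)) {x \<in> {1..j} \<rightarrow>\<^sub>E UNIV. (\<Sum>i=1..j. x i *\<^sub>R b i) \<in> P}
      * unit_ball_vol (real (DIM('a) - j))"
proof -
  let ?d = "DIM('a)"
  obtain e where e: "orthonormal_family ?d e" "\<forall>i\<in>{1..j}. e i = b i"
    using orthonormal_family_extend[OF b j] by blast
  obtain \<beta> where \<beta>: "bij_betw \<beta> {1..?d} (Basis :: 'a set)"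
    using finite_same_card_bij[of "{1..?d}" "Basis :: 'a set"] by auto
  have \<beta>in: "\<beta> i \<in> Basis" if "i \<in> {1..?d}" for i by (rule bij_betwE[OF \<beta>, rule_format, OF that])
  have \<beta>inj: "\<beta> i = \<beta> k \<longleftrightarrow> i = k" if "i \<in> {1..?d}" "k \<in> {1..?d}" for i k
    by (rule inj_on_eq_iff[OF bij_betw_imp_inj_on[OF \<beta>] that])
  have ip: "\<beta> i \<bullet> \<beta> k = (if i = k then 1 else 0)" if "i \<in> {1..?d}" "k \<in> {1..?d}" for i k
    unfolding inner_Basis[OF \<beta>in[OF that(1)] \<beta>in[OF that(2)]] \<beta>inj[OF that] ..
  \<comment> \<open>An orthogonal map sending the axis \<open>\<beta> i\<close> to
    \<open>e i\<close>, so that the first \<open>j\<close> axes go to the given family.\<close>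
  define R where "R x = (\<Sum>i\<in>{1..?d}. (x \<bullet> \<beta> i) *\<^sub>R e i)" for x
  have linR: "linear R"
    unfolding R_def by (intro linear_compose_sum ballI linearI) (auto simp: inner_add_left scaleR_add_left)
  have Re: "R x \<bullet> e k = x \<bullet> \<beta> k" if k: "k \<in> {1..?d}" for x k
  proof -
    have "R x \<bullet> e k = (\<Sum>i\<in>{1..?d}. if i = k then x \<bullet> \<beta> i else 0)"
      unfolding R_def inner_sum_left using e(1) k
      by (intro sum.cong refl) (auto simp: orthonormal_family_def)
    then show ?thesis using k by simp
  qed
  have normR: "norm (R x) = norm x" for x
  proof -
    have "y \<bullet> R x = (\<Sum>i\<in>{1..?d}. (x \<bullet> \<beta> i) * (y \<bullet> e i))" for y
      by (simp add: R_def inner_sum_right)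
    then have "R x \<bullet> R x = (\<Sum>i\<in>{1..?d}. (x \<bullet> \<beta> i) * (R x \<bullet> e i))" .
    also have "\<dots> = (\<Sum>i\<in>{1..?d}. (x \<bullet> \<beta> i) * (x \<bullet> \<beta> i))"
      by (intro sum.cong refl) (simp only: Re)
    also have "\<dots> = (\<Sum>b\<in>Basis. (x \<bullet> b) * (x \<bullet> b))"
      by (rule sum.reindex_bij_betw[OF \<beta>])
    also have "\<dots> = x \<bullet> x" by (rule euclidean_inner[symmetric])
    finally show ?thesis by (simp add: norm_eq_sqrt_inner)
  qed
  have R: "orthogonal_transformation R" using linR normR by (simp add: orthogonal_transformation)
  have Rcont: "continuous_on UNIV R" using linR by (intro linear_continuous_on) (simp add: linear_conv_bounded_linear)
  define Q where "Q = R -` P"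
  have RQ: "R ` Q = P"
    unfolding Q_def using orthogonal_transformation_surj[OF R] by (rule surj_image_vimage_eq)
  have Q: "compact Q"
  proof -
    have "closed Q" unfolding Q_def using Rcont P(1) by (intro closed_vimage compact_imp_closed) auto
    moreover obtain B where "\<forall>x\<in>P. norm x \<le> B" using P(1) compact_imp_bounded bounded_iff by blast
    then have "\<forall>x\<in>Q. norm x \<le> B" using normR by (force simp: Q_def)
    ultimately show ?thesis by (auto simp: compact_eq_bounded_closed bounded_iff)
  qed
  have Qperp: "x \<bullet> \<beta> i = 0" if "x \<in> Q" "i \<in> {j<..?d}" for x i
  proof -
    have "orthogonal (e i) (R x)"
    proof (rule orthogonal_to_span)
      show "R x \<in> span (b ` {1..j})" using that P(2) by (auto simp: Q_def)
      fix y assume "y \<in> b ` {1..j}"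
      then obtain k where "k \<in> {1..j}" "y = e k" using e(2) by auto
      then show "orthogonal (e i) y"
        using e(1) that j by (auto simp: orthonormal_family_def orthogonal_def)
    qed
    then show ?thesis using Re[of i x] that by (simp add: orthogonal_def inner_commute)
  qed
  define E where "E = {y::'a. norm y \<le> 1 \<and> (\<forall>i\<in>{1..j}. y \<bullet> \<beta> i = 0)}"
  have Ecomp: "compact E"
  proof -
    have "E = cball 0 1 \<inter> (\<Inter>i\<in>{1..j}. {y. \<beta> i \<bullet> y = 0})" by (auto simp: E_def inner_commute)
    then show ?thesis by (simp add: compact_Int_closed closed_INT closed_hyperplane)
  qed
  have X: "{x \<in> {1..j} \<rightarrow>\<^sub>E UNIV. (\<Sum>i=1..j. x i *\<^sub>R b i) \<in> P} = {x \<in> {1..j} \<rightarrow>\<^sub>E UNIV. (\<Sum>i=1..j. x i *\<^sub>R \<beta> i) \<in> Q}"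
  proof -
    have R\<beta>: "R (\<beta> k) = e k" if k: "k \<in> {1..?d}" for k
    proof -
      have "R (\<beta> k) = (\<Sum>i\<in>{1..?d}. if i = k then e i else 0)"
        unfolding R_def by (intro sum.cong refl) (simp add: ip[OF k])
      then show ?thesis using k by simp
    qed
    have "R (\<Sum>i=1..j. x i *\<^sub>R \<beta> i) = (\<Sum>i=1..j. x i *\<^sub>R b i)" for x :: "nat \<Rightarrow> real"
      unfolding linear_sum[OF linR] linear_scale[OF linR] using j e(2) by (intro sum.cong refl) (simp add: R\<beta>)
    then show ?thesis by (simp only: Q_def vimage_eq)
  qed
  \<comment> \<open>The diagonal map \<open>D\<close> divides the coordinates along
    \<open>B1\<close> by \<open>s\<close>. Its determinant \<open>1 / s ^ j\<close> is exactly the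
    normalization, it returns the dilated \<open>Q\<close> to \<open>Q\<close>, and it carries the
    unit ball to a set between \<open>E\<close> and \<open>E + cball 0 (inverse s)\<close>.\<close>
  have main: "measure lebesgue (cball 0 1 + (\<lambda>x. s *\<^sub>R x) ` P) / s ^ j \<in>
      {measure lebesgue (Q + E) .. measure lebesgue ((Q + E) + cball 0 (inverse s))}" if s: "s > 0" "s \<ge> 1" for s :: real
  proof -
    define B1 where "B1 = \<beta> ` {1..j}"
    have B1: "B1 \<subseteq> Basis" "card B1 = j"
      using j \<beta>in card_image[OF inj_on_subset[OF bij_betw_imp_inj_on[OF \<beta>]], of "{1..j}"] by (auto simp: B1_def)
    define c where "c b = (if b \<in> B1 then inverse s else 1)" for b :: 'a
    define D where "D x = (\<Sum>b\<in>Basis. (c b * (x \<bullet> b)) *\<^sub>R b)" for x :: 'a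
    have Db: "D x \<bullet> b = c b * (x \<bullet> b)" if "b \<in> Basis" for x b using that by (simp add: D_def)
    have linD: "linear D"
      unfolding D_def by (intro linear_compose_sum ballI linearI) (auto simp: inner_add_left algebra_simps)
    have perp: "x \<bullet> b = 0" if x: "x \<in> Q" and b: "b \<in> Basis" "b \<notin> B1" for x b
    proof -
      obtain i where i: "i \<in> {1..?d}" "b = \<beta> i" using b(1) bij_betw_imp_surj_on[OF \<beta>] by blast
      then have "i \<in> {j<..?d}" using b(2) by (auto simp: B1_def)
      then show ?thesis using Qperp x i by simp
    qed
    have img: "R ` (cball 0 1 + (\<lambda>x. s *\<^sub>R x) ` Q) = cball 0 1 + (\<lambda>x. s *\<^sub>R x) ` P"
    proof -
      have "R ` (\<lambda>x. s *\<^sub>R x) ` Q = (\<lambda>x. s *\<^sub>R x) ` R ` Q" by (simp add: image_image linear_scale[OF linR])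
      then show ?thesis
        unfolding linear_image_set_plus[OF linR] image_orthogonal_transformation_cball[OF R] linear_0[OF linR] RQ by simp
    qed
    have comp: "compact (cball 0 1 + (\<lambda>x. s *\<^sub>R x) ` Q)"
      using Q by (intro compact_set_plus compact_scaling) auto
    have "measure lebesgue (cball 0 1 + (\<lambda>x. s *\<^sub>R x) ` P) = measure lebesgue (cball 0 1 + (\<lambda>x. s *\<^sub>R x) ` Q)"
      using measure_orthogonal_image_euclidean[OF R comp] img by simp
    moreover have "measure lebesgue (D ` (cball 0 1 + (\<lambda>x. s *\<^sub>R x) ` Q))
        = (\<Prod>b\<in>Basis. c b) * measure lebesgue (cball 0 1 + (\<lambda>x. s *\<^sub>R x) ` Q)"
      unfolding D_def using s by (intro measure_diagonal_image comp) (auto simp: c_def)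
    moreover have "(\<Prod>b\<in>Basis. c b) = 1 / s ^ j"
    proof -
      have "(\<Prod>b\<in>Basis. c b) = (\<Prod>b\<in>B1. inverse s)"
        using B1 by (intro prod.mono_neutral_cong_right) (auto simp: c_def)
      then show ?thesis using B1 by (simp add: power_inverse divide_inverse)
    qed
    moreover have "D ` (cball 0 1 + (\<lambda>x. s *\<^sub>R x) ` Q) = Q + D ` cball 0 1"
    proof -
      have "D (s *\<^sub>R x) = x" if "x \<in> Q" for x
      proof (rule euclidean_eqI)
        fix b :: 'a assume "b \<in> Basis"
        then show "D (s *\<^sub>R x) \<bullet> b = x \<bullet> b" using perp[OF that, of b] s by (auto simp: Db c_def)
      qed
      then have "D ` (\<lambda>x. s *\<^sub>R x) ` Q = Q" by (simp add: image_image)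
      then show ?thesis by (simp add: linear_image_set_plus[OF linD] add.commute)
    qed
    ultimately have eq: "measure lebesgue (cball 0 1 + (\<lambda>x. s *\<^sub>R x) ` P) / s ^ j = measure lebesgue (Q + D ` cball 0 1)"
      by simp
    have lower: "E \<subseteq> D ` cball 0 1"
    proof
      fix y assume y: "y \<in> E"
      have "D y = y"
      proof (rule euclidean_eqI)
        fix b :: 'a assume "b \<in> Basis"
        then show "D y \<bullet> b = y \<bullet> b" using y by (auto simp: Db c_def E_def B1_def)
      qed
      then show "y \<in> D ` cball 0 1" using y by (intro image_eqI[of _ _ y]) (auto simp: E_def)
    qed
    have upper: "D ` cball 0 1 \<subseteq> E + cball 0 (inverse s)"
    proof safe
      fix y :: 'a assume y: "y \<in> cball 0 1"
      \<comment> \<open>The projection of \<open>y\<close> that deletes the coordinates along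
        \<open>B1\<close>. The difference \<open>D y - z\<close> consists of the deleted coordinates
        divided by \<open>s\<close>.\<close>
      define z where "z = (\<Sum>b\<in>Basis. (if b \<in> B1 then 0 else y \<bullet> b) *\<^sub>R b)"
      have zb: "z \<bullet> b = (if b \<in> B1 then 0 else y \<bullet> b)" if "b \<in> Basis" for b using that by (simp add: z_def)
      have "norm z \<le> norm y" by (rule norm_le_componentwise) (simp add: zb)
      moreover have "z \<bullet> \<beta> i = 0" if "i \<in> {1..j}" for i
        using zb[OF \<beta>in[of i]] that j by (simp add: B1_def)
      ultimately have z: "z \<in> E" using y by (simp add: E_def)
      have "norm (D y - z) \<le> norm (inverse s *\<^sub>R y)"
        by (rule norm_le_componentwise) (simp add: inner_diff_left Db zb c_def)
      moreover have "norm (inverse s *\<^sub>R y) \<le> inverse s" using y s mult_left_le[of "norm y" "inverse s"] by simp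
      ultimately have "D y - z \<in> cball 0 (inverse s)" by simp
      with z have "z + (D y - z) \<in> E + cball 0 (inverse s)" by (rule set_plus_intro)
      then show "D y \<in> E + cball 0 (inverse s)" by simp
    qed
    have comps: "compact (Q + E)" "compact (Q + D ` cball 0 1)" "compact ((Q + E) + cball 0 (inverse s))"
      using Q Ecomp linD
      by (auto intro!: compact_set_plus compact_continuous_image linear_continuous_on simp: linear_conv_bounded_linear)
    have "measure lebesgue (Q + E) \<le> measure lebesgue (Q + D ` cball 0 1)"
      using lower by (intro measure_compact_mono comps set_plus_mono2) auto
    moreover have "measure lebesgue (Q + D ` cball 0 1) \<le> measure lebesgue ((Q + E) + cball 0 (inverse s))"
      unfolding add.assoc using upper comps by (intro measure_compact_mono comps(2) set_plus_mono2) (auto simp: add.assoc)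
    ultimately show ?thesis unfolding eq by simp
  qed
  have "(\<lambda>n. measure lebesgue (cball 0 1 + (\<lambda>x. real (Suc n) *\<^sub>R x) ` P) / real (Suc n) ^ j)
      \<longlonglongrightarrow> measure lebesgue (Q + E)"
  proof (rule tendsto_sandwich[where f = "\<lambda>_. measure lebesgue (Q + E)"])
    show "(\<lambda>n. measure lebesgue ((Q + E) + cball 0 (inverse (real (Suc n))))) \<longlonglongrightarrow> measure lebesgue (Q + E)"
      using Q Ecomp LIMSEQ_inverse_real_of_nat by (intro measure_parallel_body_tendsto compact_set_plus) auto
  qed (use main in \<open>auto intro!: always_eventually simp del: of_nat_Suc\<close>)
  then show ?thesis
    unfolding X using measure_plus_orthogonal_ball[OF \<beta> j Q Qperp] by (simp add: E_def)
qed

section \<open>Mixed volumes of segments and balls\<close>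

text \<open>Index \<open>0\<close> stands for the ball and positive indices for the segments, so a
  map into \<open>{0..j}\<close> records what each slot of a mixed volume holds.\<close>

definition segment_or_ball :: "(nat \<Rightarrow> 'a::euclidean_space) \<Rightarrow> nat \<Rightarrow> 'a set" where
  "segment_or_ball u i = (if i = 0 then cball 0 1 else closed_segment 0 (u i))"

lemma convex_body_segment_or_ball: "convex_body (segment_or_ball u i)"
  by (simp add: segment_or_ball_def convex_body_cball convex_body_segment)

lemma parallelepiped_eq_sum: "parallelepiped j u = (\<Sum>i\<in>{1..j}. closed_segment 0 (u i))"
proof
  show "parallelepiped j u \<subseteq> (\<Sum>i\<in>{1..j}. closed_segment 0 (u i))"
    unfolding parallelepiped_def set_sum_alt[OF finite_atLeastAtMost]
    by (auto simp: mem_segment_zero)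
  show "(\<Sum>i\<in>{1..j}. closed_segment 0 (u i)) \<subseteq> parallelepiped j u"
  proof
    fix x assume "x \<in> (\<Sum>i\<in>{1..j}. closed_segment 0 (u i))"
    then obtain s where s: "x = sum s {1..j}" "\<forall>i\<in>{1..j}. s i \<in> closed_segment 0 (u i)"
      unfolding set_sum_alt[OF finite_atLeastAtMost] by blast
    then have "\<forall>i\<in>{1..j}. \<exists>c. 0 \<le> c \<and> c \<le> 1 \<and> s i = c *\<^sub>R u i" by (simp add: mem_segment_zero)
    then obtain c where c: "\<forall>i\<in>{1..j}. 0 \<le> c i \<and> c i \<le> 1 \<and> s i = c i *\<^sub>R u i" by metis
    then have "x = (\<Sum>i=1..j. c i *\<^sub>R u i)" unfolding s(1) by (intro sum.cong) auto
    then show "x \<in> parallelepiped j u" using c unfolding parallelepiped_def by blast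
  qed
qed

lemma compact_parallelepiped: "compact (parallelepiped j u)"
  using convex_body_sum[of "{1..j}" "\<lambda>i. closed_segment 0 (u i)"] convex_body_segment
  by (auto simp: parallelepiped_eq_sum convex_body_def)

lemma ball_plus_parallelepiped:
  "cball 0 1 + (\<lambda>x. t *\<^sub>R x) ` parallelepiped j u
    = minkowski_comb {0..j} (\<lambda>i. if i = 0 then 1 else t) (segment_or_ball u)"
proof -
  have "linear (\<lambda>x::'a. t *\<^sub>R x)" by (simp add: linear_scale_self)
  note * = linear_image_set_sum[OF this]
  have "{0..j} = insert 0 {1..j}" by auto
  then have "minkowski_comb {0..j} (\<lambda>i. if i = 0 then 1 else t) (segment_or_ball u)
      = cball 0 1 + (\<Sum>i\<in>{1..j}. (\<lambda>x. (if i = 0 then 1 else t) *\<^sub>R x) ` segment_or_ball u i)"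
    unfolding minkowski_comb_def by (simp add: segment_or_ball_def)
  also have "(\<Sum>i\<in>{1..j}. (\<lambda>x. (if i = 0 then 1 else t) *\<^sub>R x) ` segment_or_ball u i)
      = (\<Sum>i\<in>{1..j}. (\<lambda>x. t *\<^sub>R x) ` closed_segment 0 (u i))"
    by (intro sum.cong) (auto simp: segment_or_ball_def)
  finally show ?thesis by (simp add: parallelepiped_eq_sum *)
qed

text \<open>The assignments in which every segment occurs exactly once and all other slots hold
  balls; injectivity on the nonzero slots and the count \<open>j\<close> together force
  this.\<close>

definition slot_choices :: "nat \<Rightarrow> nat \<Rightarrow> (nat \<Rightarrow> nat) set" where
  "slot_choices d j = {g \<in> {..<d} \<rightarrow>\<^sub>E {0..j}. inj_on g {k. k < d \<and> g k \<noteq> 0} \<and> card {k. k < d \<and> g k \<noteq> 0} = j}"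

lemma slot_choices_bij:
  assumes "g \<in> slot_choices d j"
  shows "bij_betw g {k. k < d \<and> g k \<noteq> 0} {1..j}"
proof -
  have g: "g \<in> {..<d} \<rightarrow>\<^sub>E {0..j}" "inj_on g {k. k < d \<and> g k \<noteq> 0}" "card {k. k < d \<and> g k \<noteq> 0} = j"
    using assms by (auto simp: slot_choices_def)
  have "g ` {k. k < d \<and> g k \<noteq> 0} \<subseteq> {1..j}" using g(1) by (fastforce simp: PiE_iff Suc_le_eq)
  then have "g ` {k. k < d \<and> g k \<noteq> 0} = {1..j}"
    using card_image[OF g(2)] g(3) by (intro card_subset_eq) auto
  then show ?thesis using g(2) by (simp add: bij_betw_def)
qed

text \<open>An assignment is the same as a list of \<open>j\<close> distinct slots whose entry at
  position \<open>i\<close> is the slot of segment \<open>Suc i\<close>. Such lists are counted by a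
  falling factorial.\<close>

lemma card_slot_choices:
  assumes j: "j \<le> d"
  shows "real (card (slot_choices d j)) = fact d / fact (d - j)"
proof -
  let ?L = "{xs. length xs = j \<and> distinct xs \<and> set xs \<subseteq> {..<d}}"
  define \<phi> where "\<phi> xs = (\<lambda>k\<in>{..<d}. if \<exists>i<j. xs ! i = k then Suc (THE i. i < j \<and> xs ! i = k) else 0)" for xs
  have \<phi>_iff: "\<phi> xs k = Suc i \<longleftrightarrow> i < j \<and> xs ! i = k" if xs: "xs \<in> ?L" and k: "k < d" for xs k i
  proof
    have uniq: "(THE i. i < j \<and> xs ! i = k) = i" if "i < j" "xs ! i = k" for i
      using that xs by (intro the_equality) (auto simp: nth_eq_iff_index_eq)
    show "\<phi> xs k = Suc i" if "i < j \<and> xs ! i = k"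
      using that k uniq by (auto simp: \<phi>_def)
    assume a: "\<phi> xs k = Suc i"
    then obtain i' where i': "i' < j" "xs ! i' = k" using k by (auto simp: \<phi>_def split: if_splits)
    then have "\<phi> xs k = Suc i'" using k uniq by (auto simp: \<phi>_def)
    then show "i < j \<and> xs ! i = k" using a i' by simp
  qed
  have "bij_betw \<phi> ?L (slot_choices d j)"
  proof (rule bij_betwI')
    fix xs ys assume xs: "xs \<in> ?L" and ys: "ys \<in> ?L"
    show "(\<phi> xs = \<phi> ys) = (xs = ys)"
    proof
      assume eq: "\<phi> xs = \<phi> ys"
      show "xs = ys"
      proof (rule nth_equalityI)
        show "length xs = length ys" using xs ys by simp
        fix i assume i: "i < length xs"
        then have "i < j" "xs ! i < d" using xs nth_mem[of i xs] by (auto simp del: nth_mem)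
        then show "xs ! i = ys ! i" using \<phi>_iff[OF xs, of "xs ! i" i] \<phi>_iff[OF ys, of "xs ! i" i] eq by simp
      qed
    qed simp
  next
    fix xs assume xs: "xs \<in> ?L"
    have A: "{k. k < d \<and> \<phi> xs k \<noteq> 0} = set xs"
    proof -
      have "\<phi> xs k \<noteq> 0 \<longleftrightarrow> k \<in> set xs" if "k < d" for k
      proof -
        have "\<phi> xs k \<noteq> 0 \<longleftrightarrow> (\<exists>i. \<phi> xs k = Suc i)" by (cases "\<phi> xs k") auto
        then show ?thesis using \<phi>_iff[OF xs that] xs by (auto simp: in_set_conv_nth)
      qed
      then show ?thesis using xs by auto
    qed
    have "\<phi> xs k \<le> j" if "k < d" for k
    proof (cases "\<phi> xs k")
      case (Suc i)
      then show ?thesis using \<phi>_iff[OF xs that, of i] by simp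
    qed simp
    then have "\<phi> xs \<in> {..<d} \<rightarrow>\<^sub>E {0..j}" by (auto simp: \<phi>_def PiE_iff)
    moreover have "inj_on (\<phi> xs) (set xs)"
    proof (rule inj_onI)
      fix k l assume kl: "k \<in> set xs" "l \<in> set xs" "\<phi> xs k = \<phi> xs l"
      then have "k < d" "l < d" "\<phi> xs k \<noteq> 0" using xs A by auto
      then show "k = l" using \<phi>_iff[OF xs] kl(3) by (metis not0_implies_Suc)
    qed
    moreover have "card (set xs) = j" using xs by (simp add: distinct_card)
    ultimately show "\<phi> xs \<in> slot_choices d j" unfolding slot_choices_def A[symmetric] by simp
  next
    fix g assume g: "g \<in> slot_choices d j"
    let ?A = "{k. k < d \<and> g k \<noteq> 0}"
    have b: "bij_betw g ?A {1..j}" by (rule slot_choices_bij[OF g])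
    define h where "h i = inv_into ?A g (Suc i)" for i
    have h: "h i \<in> ?A" "g (h i) = Suc i" if "i < j" for i
      using that bij_betw_inv_into_right[OF b, of "Suc i"] bij_betwE[OF bij_betw_inv_into[OF b], rule_format, of "Suc i"]
      by (auto simp: h_def)
    define xs where "xs = map h [0..<j]"
    have xs: "xs \<in> ?L"
    proof -
      have "inj_on h {0..<j}" using h(2) by (intro inj_onI) (metis atLeastLessThan_iff nat.inject)
      then show ?thesis using h(1) by (auto simp: xs_def distinct_map)
    qed
    have "g k = \<phi> xs k" for k
    proof (cases "k < d")
      case True
      show ?thesis
      proof (cases "g k")
        case 0
        have "\<phi> xs k = 0"
        proof (rule ccontr)
          assume "\<phi> xs k \<noteq> 0"
          then obtain i where "\<phi> xs k = Suc i" using not0_implies_Suc by blast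
          then have "i < j" "xs ! i = k" using \<phi>_iff[OF xs True] by auto
          then show False using h(2)[of i] 0 by (simp add: xs_def)
        qed
        then show ?thesis using 0 by simp
      next
        case (Suc i)
        then have "Suc i \<le> j" using bij_betwE[OF b, rule_format, of k] True by simp
        moreover have "h i = k"
          using bij_betw_inv_into_left[OF b, of k] True Suc by (simp add: h_def)
        ultimately show ?thesis using \<phi>_iff[OF xs True, of i] Suc by (simp add: xs_def)
      qed
    next
      case False
      then show ?thesis using g by (auto simp: slot_choices_def \<phi>_def PiE_def extensional_def)
    qed
    then show "\<exists>xs\<in>?L. g = \<phi> xs" using xs by blast
  qed
  then have "card (slot_choices d j) = card ?L" by (rule bij_betw_same_card[symmetric])
  also have "\<dots> = \<Prod>{d - j + 1..d}" using card_lists_distinct_length_eq[of "{..<d}" j] j by simp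
  also have "\<dots> = fact d div fact (d - j)" by (simp add: fact_div_fact)
  finally have "real (card (slot_choices d j)) = real (fact d div fact (d - j))" by simp
  also have "\<dots> = fact d / fact (d - j)"
    by (subst real_of_nat_div) (auto simp: fact_dvd)
  finally show ?thesis .
qed

text \<open>The permutation \<open>\<sigma>\<close> moves the slot holding segment \<open>i\<close>
  to position \<open>i - 1\<close> and the slots holding balls, in an arbitrary order
  \<open>\<tau>\<close>, to the positions from \<open>j\<close> on.\<close>

lemma polar_volume_slot_choice:
  fixes K :: "nat \<Rightarrow> 'a::euclidean_space set"
  assumes g: "g \<in> slot_choices DIM('a) j" and j: "j \<le> DIM('a)"
  shows "polar_volume (\<lambda>k. K (g k)) = polar_volume (\<lambda>k. K (if k < j then Suc k else 0))"
proof -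
  let ?d = "DIM('a)"
  let ?A = "{k. k < ?d \<and> g k \<noteq> 0}" and ?Z = "{k. k < ?d \<and> g k = 0}"
  have b: "bij_betw g ?A {1..j}" by (rule slot_choices_bij[OF g])
  have "?Z = {..<?d} - ?A" by auto
  then have "card ?Z = ?d - card ?A" by (simp add: card_Diff_subset subset_iff)
  then have "card ?Z = card {j..<?d}" using bij_betw_same_card[OF b] by simp
  then obtain \<tau> where \<tau>: "bij_betw \<tau> ?Z {j..<?d}"
    using finite_same_card_bij[of ?Z "{j..<?d}"] by auto
  define \<sigma> where "\<sigma> k = (if k < ?d then if g k = 0 then \<tau> k else g k - 1 else k)" for k
  have \<tau>in: "j \<le> \<tau> k" "\<tau> k < ?d" if "k < ?d" "g k = 0" for k
    using bij_betwE[OF \<tau>] that by auto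
  have gin: "1 \<le> g k" "g k \<le> j" if "k < ?d" "g k \<noteq> 0" for k
    using bij_betwE[OF b] that by auto
  have "inj_on \<sigma> {..<?d}"
  proof (rule inj_onI)
    fix k l assume kl: "k \<in> {..<?d}" "l \<in> {..<?d}" "\<sigma> k = \<sigma> l"
    consider "g k = 0" "g l = 0" | "g k \<noteq> 0" "g l \<noteq> 0" | "g k = 0" "g l \<noteq> 0" | "g k \<noteq> 0" "g l = 0" by blast
    then show "k = l"
    proof cases
      case 1
      then show ?thesis using kl bij_betw_imp_inj_on[OF \<tau>] by (auto simp: \<sigma>_def inj_on_def)
    next
      case 2
      then have "g k = g l" using kl gin[of k] gin[of l] by (auto simp: \<sigma>_def)
      then show ?thesis using 2 kl bij_betw_imp_inj_on[OF b] by (auto simp: inj_on_def)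
    next
      case 3
      then show ?thesis using kl gin[of l] \<tau>in[of k] by (auto simp: \<sigma>_def)
    next
      case 4
      then show ?thesis using kl gin[of k] \<tau>in[of l] by (auto simp: \<sigma>_def)
    qed
  qed
  moreover have "\<sigma> ` {..<?d} \<subseteq> {..<?d}" using \<tau>in gin j by (force simp: \<sigma>_def)
  ultimately have "bij_betw \<sigma> {..<?d} {..<?d}" by (simp add: bij_betw_def endo_inj_surj)
  then have \<sigma>: "\<sigma> permutes {..<?d}" by (rule bij_imp_permutes) (simp add: \<sigma>_def)
  have "polar_volume (\<lambda>k. K (g k)) = polar_volume (\<lambda>k. K (if \<sigma> k < j then Suc (\<sigma> k) else 0))"
  proof (rule polar_volume_cong)
    fix k assume k: "k < ?d"
    have "g k = (if \<sigma> k < j then Suc (\<sigma> k) else 0)"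
      using k \<tau>in[OF k] gin[OF k] by (auto simp: \<sigma>_def)
    then show "K (g k) = K (if \<sigma> k < j then Suc (\<sigma> k) else 0)" by simp
  qed
  also have "\<dots> = polar_volume (\<lambda>k. K (if k < j then Suc k else 0))"
    using polar_volume_permute[OF \<sigma>, of "\<lambda>k. K (if k < j then Suc k else 0)"] by simp
  finally show ?thesis .
qed

text \<open>A term with \<open>m\<close> segment slots carries the factor
  \<open>(n + 1) ^ m\<close>. Terms that repeat a segment vanish, which bounds the degree by
  \<open>j\<close>; terms with \<open>m < j\<close> disappear in the limit, and the remaining ones
  are indexed by \<open>slot_choices\<close> and all equal.\<close>

lemma parallel_volume_leading_coefficient:
  fixes u :: "nat \<Rightarrow> 'a::euclidean_space"
  assumes j: "j \<le> DIM('a)"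
  shows "(\<lambda>n. measure lebesgue (cball 0 1 + (\<lambda>x. real (Suc n) *\<^sub>R x) ` parallelepiped j u) / real (Suc n) ^ j)
    \<longlonglongrightarrow> fact DIM('a) / fact (DIM('a) - j) * polar_volume (\<lambda>k. segment_or_ball u (if k < j then Suc k else 0))"
proof -
  let ?d = "DIM('a)"
  let ?K = "segment_or_ball u"
  let ?E = "{..<?d} \<rightarrow>\<^sub>E {0..j}"
  let ?A = "\<lambda>g::nat \<Rightarrow> nat. {k. k < ?d \<and> g k \<noteq> 0}"
  define v where "v g = polar_volume (\<lambda>k. ?K (g k))" for g
  have vol: "measure lebesgue (cball 0 1 + (\<lambda>x. s *\<^sub>R x) ` parallelepiped j u)
      = (\<Sum>g\<in>?E. s ^ card (?A g) * v g)" if "0 \<le> s" for s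
  proof -
    have "(\<Prod>k<?d. if g k = 0 then 1 else s) = s ^ card (?A g)" for g :: "nat \<Rightarrow> nat"
    proof -
      have "(\<Prod>k<?d. if g k = 0 then 1 else s) = (\<Prod>k\<in>?A g. s)"
        by (intro prod.mono_neutral_cong_right) auto
      then show ?thesis by simp
    qed
    then show ?thesis
      unfolding ball_plus_parallelepiped v_def using that
      by (subst measure_minkowski_comb) (auto simp: convex_body_segment_or_ball)
  qed
  have summand: "(\<lambda>n. real (Suc n) ^ card (?A g) * v g / real (Suc n) ^ j)
      \<longlonglongrightarrow> (if g \<in> slot_choices ?d j then v g else 0)" if g: "g \<in> ?E" for g
  proof (cases "inj_on g (?A g)")
    case False
    then obtain k l where kl: "k < ?d" "l < ?d" "k \<noteq> l" "g k = g l" "g k \<noteq> 0" "g l \<noteq> 0" by (auto simp: inj_on_def)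
    then have "v g = 0"
      unfolding v_def by (intro polar_volume_repeated_segment[of k l _ "u (g k)"])
        (auto simp: convex_body_cball convex_body_segment segment_or_ball_def)
    then show ?thesis using False by (simp add: slot_choices_def)
  next
    case True
    have "g ` ?A g \<subseteq> {1..j}" using g by (fastforce simp: PiE_iff Suc_le_eq)
    then have le: "card (?A g) \<le> j" using card_inj_on_le[OF True, of "{1..j}"] by simp
    show ?thesis
    proof (cases "card (?A g) = j")
      case eq: True
      then have "g \<in> slot_choices ?d j" using True g by (simp add: slot_choices_def)
      then show ?thesis using eq by simp
    next
      case False
      then have lt: "0 < j - card (?A g)" using le by simp
      have eq: "real (Suc n) ^ card (?A g) * v g / real (Suc n) ^ j = v g * inverse (real (Suc n)) ^ (j - card (?A g))" for n
      proof -
        have "real (Suc n) ^ j = real (Suc n) ^ card (?A g) * real (Suc n) ^ (j - card (?A g))"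
          using le by (simp flip: power_add)
        then show ?thesis by (simp add: power_inverse divide_inverse mult_ac del: of_nat_Suc)
      qed
      have "(\<lambda>n. v g * inverse (real (Suc n)) ^ (j - card (?A g))) \<longlonglongrightarrow> v g * 0 ^ (j - card (?A g))"
        by (intro tendsto_intros LIMSEQ_inverse_real_of_nat)
      then show ?thesis unfolding eq using lt False by (simp add: slot_choices_def zero_power)
    qed
  qed
  have "(\<lambda>n. \<Sum>g\<in>?E. real (Suc n) ^ card (?A g) * v g / real (Suc n) ^ j)
      \<longlonglongrightarrow> (\<Sum>g\<in>?E. if g \<in> slot_choices ?d j then v g else 0)"
    by (intro tendsto_sum summand)
  also have "(\<Sum>g\<in>?E. if g \<in> slot_choices ?d j then v g else 0) = (\<Sum>g\<in>slot_choices ?d j. v g)"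
    by (intro sum.mono_neutral_cong_right) (auto simp: slot_choices_def intro!: finite_PiE)
  also have "\<dots> = (\<Sum>g\<in>slot_choices ?d j. polar_volume (\<lambda>k. ?K (if k < j then Suc k else 0)))"
    unfolding v_def by (intro sum.cong refl polar_volume_slot_choice j)
  also have "\<dots> = fact ?d / fact (?d - j) * polar_volume (\<lambda>k. ?K (if k < j then Suc k else 0))"
    by (simp add: card_slot_choices[OF j])
  finally show ?thesis
    by (simp add: vol sum_divide_distrib del: of_nat_Suc)
qed

text \<open>Two limits of the same sequence agree. As the second one involves no basis, the
  coordinate measure equals \<open>c\<close> for every admissible family \<open>b\<close>, so the
  definite description in \<open>volume_dim\<close> denotes \<open>c\<close>.\<close>

lemma polar_volume_segments_ball:
  fixes u :: "nat \<Rightarrow> 'a::euclidean_space"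
  assumes j: "j \<le> DIM('a)"
  shows "polar_volume (\<lambda>k. segment_or_ball u (if k < j then Suc k else 0))
    = fact (DIM('a) - j) / fact DIM('a) * unit_ball_vol (real (DIM('a) - j)) * parallelepiped_volume j u"
proof -
  let ?d = "DIM('a)"
  define V where "V = polar_volume (\<lambda>k. segment_or_ball u (if k < j then Suc k else 0))"
  define c where "c = fact ?d / fact (?d - j) * V / unit_ball_vol (real (?d - j))"
  let ?P = "parallelepiped j u"
  let ?\<mu> = "\<lambda>b. measure (Pi\<^sub>M {1..j} (\<lambda>_. lborel)) {x \<in> {1..j} \<rightarrow>\<^sub>E UNIV. (\<Sum>i=1..j. x i *\<^sub>R b i) \<in> ?P}"
  have pos: "unit_ball_vol (real (?d - j)) > 0" by (rule unit_ball_vol_pos) simp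
  have coord_measure: "?\<mu> b = c" if b: "orthonormal_family j b" "?P \<subseteq> span (b ` {1..j})" for b
  proof -
    have "?\<mu> b * unit_ball_vol (real (?d - j)) = fact ?d / fact (?d - j) * V"
      unfolding V_def
      by (rule LIMSEQ_unique[OF parallel_volume_limit[OF b(1) j compact_parallelepiped b(2)]
            parallel_volume_leading_coefficient[OF j]])
    then show ?thesis using pos unfolding c_def by (simp add: eq_divide_eq less_imp_neq[THEN not_sym] mult_ac)
  qed
  obtain b where b: "orthonormal_family j b" "\<forall>i\<in>{1..j}. u i \<in> span (b ` {1..j})"
    using exists_orthonormal_family_span[OF j] by blast
  have "?P \<subseteq> span (b ` {1..j})"
    using b(2) by (auto simp: parallelepiped_def intro!: span_sum span_scale)
  then have "\<exists>b. orthonormal_family j b \<and> ?P \<subseteq> span (b ` {1..j}) \<and> c = ?\<mu> b"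
    using coord_measure[OF b(1)] b(1) by (intro exI[of _ b]) simp
  then have "parallelepiped_volume j u = c"
    unfolding parallelepiped_volume_def volume_dim_def
    by (rule the_equality) (elim exE conjE, simp only: coord_measure)
  then show ?thesis using less_imp_neq[OF pos] by (simp add: c_def V_def)
qed

section \<open>Selection expectations of random segments\<close>

lemma support_fun_upper:
  assumes "convex_body K" "x \<in> K"
  shows "x \<bullet> u \<le> support_fun K u"
proof -
  have "compact ((\<lambda>x. x \<bullet> u) ` K)"
    using assms(1) by (intro compact_continuous_image continuous_intros) (simp add: convex_body_def)
  then have "bdd_above ((\<lambda>x. x \<bullet> u) ` K)" by (intro bounded_imp_bdd_above compact_imp_bounded)
  then show ?thesis unfolding support_fun_def using assms(2) by (intro cSUP_upper)
qed

lemma support_fun_attained: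
  assumes "convex_body K"
  shows "\<exists>x\<in>K. support_fun K u = x \<bullet> u"
proof -
  have "continuous_on K (\<lambda>x. x \<bullet> u)" by (intro continuous_intros)
  then obtain x where x: "x \<in> K" "\<And>y. y \<in> K \<Longrightarrow> y \<bullet> u \<le> x \<bullet> u"
    using continuous_attains_sup[of K "\<lambda>x. x \<bullet> u"] assms by (auto simp: convex_body_def)
  have "support_fun K u \<le> x \<bullet> u"
    unfolding support_fun_def using x by (intro cSUP_least) auto
  then show ?thesis using support_fun_upper[OF assms x(1), of u] x(1) by (intro bexI[of _ x]) auto
qed

lemma support_fun_eqI:
  assumes "convex_body K" "x \<in> K" "x \<bullet> u = c" "\<And>y. y \<in> K \<Longrightarrow> y \<bullet> u \<le> c"
  shows "support_fun K u = c"
  using support_fun_attained[OF assms(1), of u] support_fun_upper[OF assms(1,2), of u] assms(3,4) by fastforce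

text \<open>A point of \<open>K\<close> outside \<open>L + cball 0 \<epsilon>\<close> is separated
  from it by a hyperplane with normal \<open>a\<close>. In the direction \<open>- a\<close> the
  support function of \<open>K\<close> would exceed that of \<open>L\<close> by more than
  \<open>\<epsilon> * norm a\<close>, the contribution of the ball.\<close>

lemma support_fun_le_imp_subset:
  fixes K L :: "'a::euclidean_space set"
  assumes K: "convex_body K" and L: "convex_body L" and \<epsilon>: "0 \<le> \<epsilon>"
    and le: "\<And>u. support_fun K u \<le> support_fun L u + \<epsilon> * norm u"
  shows "K \<subseteq> L + cball 0 \<epsilon>"
proof
  fix x assume x: "x \<in> K"
  have LB: "convex_body (L + cball 0 \<epsilon>)" by (rule convex_body_set_plus[OF L convex_body_cball[OF \<epsilon>]])
  show "x \<in> L + cball 0 \<epsilon>"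
  proof (rule ccontr)
    assume "x \<notin> L + cball 0 \<epsilon>"
    then obtain a b where ab: "a \<bullet> x < b" "\<forall>y\<in>L + cball 0 \<epsilon>. a \<bullet> y > b"
      using separating_hyperplane_closed_point[of "L + cball 0 \<epsilon>" x] LB
      by (auto simp: convex_body_def compact_imp_closed)
    obtain y where y: "y \<in> L" "support_fun L (- a) = y \<bullet> (- a)" using support_fun_attained[OF L] by blast
    have "y + \<epsilon> *\<^sub>R sgn (- a) \<in> L + cball 0 \<epsilon>"
      using y \<epsilon> by (intro set_plus_intro) (auto simp: norm_sgn)
    then have "b < a \<bullet> (y + \<epsilon> *\<^sub>R sgn (- a))" using ab by blast
    also have "a \<bullet> sgn (- a) = - norm a"
      by (simp add: sgn_div_norm power2_norm_eq_inner[symmetric] power2_eq_square divide_simps)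
    then have "a \<bullet> (y + \<epsilon> *\<^sub>R sgn (- a)) = - (support_fun L (- a) + \<epsilon> * norm (- a))"
      by (simp add: inner_add_right y(2) inner_commute)
    also have "\<dots> \<le> - support_fun K (- a)" using le[of "- a"] by simp
    also have "\<dots> \<le> a \<bullet> x" using support_fun_upper[OF K x, of "- a"] by (simp add: inner_commute)
    finally show False using ab(1) by simp
  qed
qed

lemma support_fun_inject:
  fixes K L :: "'a::euclidean_space set"
  assumes "convex_body K" "convex_body L" "\<And>u. support_fun K u = support_fun L u"
  shows "K = L"
  using support_fun_le_imp_subset[of K L 0] support_fun_le_imp_subset[of L K 0] assms
  by (auto simp flip: set_zero)

lemma support_fun_segment: "support_fun (closed_segment 0 x) u = max 0 (x \<bullet> u)"
proof (cases "0 \<le> x \<bullet> u")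
  case True
  show ?thesis
    by (rule support_fun_eqI[OF convex_body_segment, of x])
      (use True in \<open>auto simp: mem_segment_zero mult_left_le_one_le\<close>)
next
  case False
  show ?thesis
    by (rule support_fun_eqI[OF convex_body_segment, of 0])
      (use False in \<open>auto simp: mem_segment_zero mult_nonneg_nonpos\<close>)
qed

lemma support_fun_minkowski_comb:
  fixes K :: "'i \<Rightarrow> 'a::euclidean_space set"
  assumes I: "finite I" and K: "\<And>i. i \<in> I \<Longrightarrow> convex_body (K i)" and t: "\<And>i. i \<in> I \<Longrightarrow> 0 \<le> t i"
  shows "support_fun (minkowski_comb I t K) u = (\<Sum>i\<in>I. t i * support_fun (K i) u)"
proof -
  have "\<forall>i\<in>I. \<exists>x\<in>K i. support_fun (K i) u = x \<bullet> u" using support_fun_attained K by blast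
  then obtain s where s: "\<forall>i\<in>I. s i \<in> K i \<and> support_fun (K i) u = s i \<bullet> u" by metis
  show ?thesis
  proof (rule support_fun_eqI)
    show "(\<Sum>i\<in>I. t i *\<^sub>R s i) \<in> minkowski_comb I t K" using s by (auto simp: mem_minkowski_comb[OF I])
    show "(\<Sum>i\<in>I. t i *\<^sub>R s i) \<bullet> u = (\<Sum>i\<in>I. t i * support_fun (K i) u)"
      using s by (simp add: inner_sum_left)
    fix y assume "y \<in> minkowski_comb I t K"
    then obtain r where r: "\<forall>i\<in>I. r i \<in> K i" "y = (\<Sum>i\<in>I. t i *\<^sub>R r i)" by (auto simp: mem_minkowski_comb[OF I])
    then show "y \<bullet> u \<le> (\<Sum>i\<in>I. t i * support_fun (K i) u)"
      using t K by (auto simp: inner_sum_left intro!: sum_mono mult_left_mono support_fun_upper)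
  qed (intro convex_body_minkowski_comb K)
qed

text \<open>
  The body is the closure of all expectations \<open>E (\<phi> \<xi>)\<close> with \<open>0 \<le> \<phi> \<le> 1\<close>; the support point in
  direction \<open>u\<close> is obtained for the indicator function of the event that \<open>\<xi> \<bullet> u > 0\<close>.
\<close>
lemma exists_segment_expectation:
  fixes \<xi> :: "'w \<Rightarrow> 'a::euclidean_space"
  assumes \<xi>: "integrable M \<xi>"
  shows "\<exists>K. convex_body K \<and> (\<forall>u. support_fun K u = (LINT \<omega>|M. max 0 (\<xi> \<omega> \<bullet> u)))"
proof -
  define \<Phi> where "\<Phi> = {\<phi> \<in> borel_measurable M. \<forall>\<omega>. 0 \<le> \<phi> \<omega> \<and> \<phi> \<omega> \<le> (1::real)}"
  define Z where "Z = (\<lambda>\<phi>. LINT \<omega>|M. \<phi> \<omega> *\<^sub>R \<xi> \<omega>) ` \<Phi>"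
  have [measurable]: "\<xi> \<in> borel_measurable M" using \<xi> by auto
  have int: "integrable M (\<lambda>\<omega>. \<phi> \<omega> *\<^sub>R \<xi> \<omega>)" if "\<phi> \<in> \<Phi>" for \<phi>
  proof (rule Bochner_Integration.integrable_bound[OF \<xi>])
    show "(\<lambda>\<omega>. \<phi> \<omega> *\<^sub>R \<xi> \<omega>) \<in> borel_measurable M" using that by (auto simp: \<Phi>_def)
    show "AE \<omega> in M. norm (\<phi> \<omega> *\<^sub>R \<xi> \<omega>) \<le> norm (\<xi> \<omega>)"
      using that by (auto simp: \<Phi>_def mult_left_le_one_le)
  qed
  have "Z \<noteq> {}" by (auto simp: Z_def \<Phi>_def intro!: exI[of _ "\<lambda>_. 0"])
  have "convex Z"
  proof (rule convexI)
    fix x y and a b :: real assume "x \<in> Z" "y \<in> Z" and ab: "0 \<le> a" "0 \<le> b" "a + b = 1"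
    then obtain \<phi> \<psi> where \<phi>: "\<phi> \<in> \<Phi>" "x = (LINT \<omega>|M. \<phi> \<omega> *\<^sub>R \<xi> \<omega>)" and \<psi>: "\<psi> \<in> \<Phi>" "y = (LINT \<omega>|M. \<psi> \<omega> *\<^sub>R \<xi> \<omega>)"
      by (auto simp: Z_def)
    have "a *\<^sub>R x + b *\<^sub>R y = (LINT \<omega>|M. (a * \<phi> \<omega> + b * \<psi> \<omega>) *\<^sub>R \<xi> \<omega>)"
      using int[OF \<phi>(1)] int[OF \<psi>(1)] by (simp add: \<phi> \<psi> scaleR_add_left flip: scaleR_scaleR)
    moreover have "(\<lambda>\<omega>. a * \<phi> \<omega> + b * \<psi> \<omega>) \<in> \<Phi>"
    proof -
      have "a * \<phi> \<omega> + b * \<psi> \<omega> \<le> 1" for \<omega>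
        using convex_bound_le[of "\<phi> \<omega>" 1 "\<psi> \<omega>" a b] \<phi> \<psi> ab by (auto simp: \<Phi>_def)
      then show ?thesis using \<phi> \<psi> ab by (auto simp: \<Phi>_def)
    qed
    ultimately show "a *\<^sub>R x + b *\<^sub>R y \<in> Z" by (auto simp: Z_def)
  qed
  have "norm z \<le> (LINT \<omega>|M. norm (\<xi> \<omega>))" if z: "z \<in> Z" for z
  proof -
    obtain \<phi> where \<phi>: "\<phi> \<in> \<Phi>" "z = (LINT \<omega>|M. \<phi> \<omega> *\<^sub>R \<xi> \<omega>)" using z by (auto simp: Z_def)
    have "norm z \<le> (LINT \<omega>|M. norm (\<phi> \<omega> *\<^sub>R \<xi> \<omega>))" unfolding \<phi>(2) by (rule integral_norm_bound)
    also have "\<dots> \<le> (LINT \<omega>|M. norm (\<xi> \<omega>))"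
      using integrable_norm[OF \<xi>] integrable_norm[OF int[OF \<phi>(1)]] \<phi>(1)
      by (intro integral_mono) (auto simp: \<Phi>_def mult_left_le_one_le)
    finally show ?thesis .
  qed
  then have "bounded Z" by (auto simp: bounded_iff)
  then have cb: "convex_body (closure Z)"
    using \<open>convex Z\<close> \<open>Z \<noteq> {}\<close> by (simp add: convex_body_def convex_closure)
  have "support_fun (closure Z) u = (LINT \<omega>|M. max 0 (\<xi> \<omega> \<bullet> u))" for u
  proof (rule support_fun_eqI[OF cb])
    let ?\<phi> = "\<lambda>\<omega>. of_bool (0 < \<xi> \<omega> \<bullet> u) :: real"
    have \<phi>: "?\<phi> \<in> \<Phi>" by (auto simp: \<Phi>_def of_bool_def)
    then show "(LINT \<omega>|M. ?\<phi> \<omega> *\<^sub>R \<xi> \<omega>) \<in> closure Z"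
      by (intro subsetD[OF closure_subset]) (auto simp: Z_def)
    have "(LINT \<omega>|M. ?\<phi> \<omega> *\<^sub>R \<xi> \<omega>) \<bullet> u = (LINT \<omega>|M. (?\<phi> \<omega> *\<^sub>R \<xi> \<omega>) \<bullet> u)"
      using int[OF \<phi>] by (intro integral_inner_left[symmetric]) auto
    also have "\<dots> = (LINT \<omega>|M. max 0 (\<xi> \<omega> \<bullet> u))"
      by (intro Bochner_Integration.integral_cong refl) auto
    finally show "(LINT \<omega>|M. ?\<phi> \<omega> *\<^sub>R \<xi> \<omega>) \<bullet> u = (LINT \<omega>|M. max 0 (\<xi> \<omega> \<bullet> u))" .
    have "Z \<subseteq> {y. u \<bullet> y \<le> (LINT \<omega>|M. max 0 (\<xi> \<omega> \<bullet> u))}"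
    proof
      fix z assume "z \<in> Z"
      then obtain \<phi> where \<phi>: "\<phi> \<in> \<Phi>" "z = (LINT \<omega>|M. \<phi> \<omega> *\<^sub>R \<xi> \<omega>)" by (auto simp: Z_def)
      have "z \<bullet> u = (LINT \<omega>|M. (\<phi> \<omega> *\<^sub>R \<xi> \<omega>) \<bullet> u)"
        unfolding \<phi>(2) using int[OF \<phi>(1)] by (intro integral_inner_left[symmetric]) auto
      also have "\<dots> \<le> (LINT \<omega>|M. max 0 (\<xi> \<omega> \<bullet> u))"
      proof (rule integral_mono)
        show "integrable M (\<lambda>\<omega>. (\<phi> \<omega> *\<^sub>R \<xi> \<omega>) \<bullet> u)" by (rule integrable_inner_left[OF int[OF \<phi>(1)]])
        show "integrable M (\<lambda>\<omega>. max 0 (\<xi> \<omega> \<bullet> u))" using \<xi> by (intro integrable_max) auto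
        fix \<omega>
        have p: "0 \<le> \<phi> \<omega>" "\<phi> \<omega> \<le> 1" using \<phi>(1) by (auto simp: \<Phi>_def)
        show "(\<phi> \<omega> *\<^sub>R \<xi> \<omega>) \<bullet> u \<le> max 0 (\<xi> \<omega> \<bullet> u)"
        proof (cases "0 \<le> \<xi> \<omega> \<bullet> u")
          case True
          then show ?thesis using p by (simp add: mult_left_le_one_le)
        next
          case False
          then show ?thesis using p by (simp add: mult_nonneg_nonpos)
        qed
      qed
      finally show "z \<in> {y. u \<bullet> y \<le> (LINT \<omega>|M. max 0 (\<xi> \<omega> \<bullet> u))}" by (simp add: inner_commute)
    qed
    then have "closure Z \<subseteq> {y. u \<bullet> y \<le> (LINT \<omega>|M. max 0 (\<xi> \<omega> \<bullet> u))}"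
      by (intro closure_minimal closed_halfspace_le)
    then show "y \<bullet> u \<le> (LINT \<omega>|M. max 0 (\<xi> \<omega> \<bullet> u))" if "y \<in> closure Z" for y
      using that by (auto simp: inner_commute)
  qed
  then show ?thesis using cb by blast
qed

lemma selection_expectation_segment:
  fixes \<xi> :: "'w \<Rightarrow> 'a::euclidean_space"
  assumes \<xi>: "integrable M \<xi>"
  defines "Z \<equiv> selection_expectation M (\<lambda>\<omega>. closed_segment 0 (\<xi> \<omega>))"
  shows "convex_body Z" "support_fun Z u = (LINT \<omega>|M. max 0 (\<xi> \<omega> \<bullet> u))"
proof -
  obtain K where K: "convex_body K" "\<And>u. support_fun K u = (LINT \<omega>|M. max 0 (\<xi> \<omega> \<bullet> u))"
    using exists_segment_expectation[OF \<xi>] by blast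
  have "Z = K"
    unfolding Z_def selection_expectation_def support_fun_segment
  proof (rule the_equality)
    show "L = K" if "convex_body L \<and> (\<forall>u. support_fun L u = (LINT \<omega>|M. max 0 (\<xi> \<omega> \<bullet> u)))" for L
      using that K by (intro support_fun_inject) auto
  qed (use K in blast)
  then show "convex_body Z" "support_fun Z u = (LINT \<omega>|M. max 0 (\<xi> \<omega> \<bullet> u))" using K by auto
qed

section \<open>Mixed volumes of segments as functions of their end-points\<close>

lemma polar_volume_scale:
  fixes K :: "nat \<Rightarrow> 'a::euclidean_space set"
  assumes K: "\<And>k. k < DIM('a) \<Longrightarrow> convex_body (K k)" and c: "\<And>k. k < DIM('a) \<Longrightarrow> 0 \<le> c k"
  shows "polar_volume (\<lambda>k. (\<lambda>x. c k *\<^sub>R x) ` K k) = (\<Prod>k<DIM('a). c k) * polar_volume K"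
proof -
  let ?U = "{..<DIM('a)}"
  let ?w = "\<lambda>k i. c k * of_bool (k = i)"
  have "polar_volume (\<lambda>k. (\<lambda>x. c k *\<^sub>R x) ` K k) = polar_volume (\<lambda>k. minkowski_comb ?U (?w k) K)"
  proof (rule polar_volume_cong)
    fix k assume k: "k < DIM('a)"
    have "minkowski_comb ?U (?w k) K = (\<Sum>i\<in>?U. if i = k then (\<lambda>x. c k *\<^sub>R x) ` K k else 0)"
      unfolding minkowski_comb_def using K by (intro sum.cong refl) (auto simp: set_zero convex_body_def)
    then show "(\<lambda>x. c k *\<^sub>R x) ` K k = minkowski_comb ?U (?w k) K" using k by simp
  qed
  also have "\<dots> = (\<Sum>g\<in>?U \<rightarrow>\<^sub>E ?U. (\<Prod>k<DIM('a). ?w k (g k)) * polar_volume (\<lambda>k. K (g k)))"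
    using K c by (intro polar_volume_multilinear) auto
  \<comment> \<open>The weights are diagonal, so any choice other than the identity meets a zero
    factor.\<close>
  also have "\<dots> = (\<Sum>g\<in>{restrict id ?U}. (\<Prod>k<DIM('a). ?w k (g k)) * polar_volume (\<lambda>k. K (g k)))"
  proof (rule sum.mono_neutral_right)
    show "\<forall>g\<in>(?U \<rightarrow>\<^sub>E ?U) - {restrict id ?U}. (\<Prod>k<DIM('a). ?w k (g k)) * polar_volume (\<lambda>k. K (g k)) = 0"
    proof
      fix g assume g: "g \<in> (?U \<rightarrow>\<^sub>E ?U) - {restrict id ?U}"
      then have "\<not> (\<forall>k<DIM('a). g k = k)"
        using PiE_ext[of g ?U "\<lambda>_. ?U" "restrict id ?U"] by auto
      then obtain k where "k < DIM('a)" "g k \<noteq> k" by blast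
      then have "(\<Prod>k<DIM('a). ?w k (g k)) = 0" by (intro prod_zero bexI[of _ k]) auto
      then show "(\<Prod>k<DIM('a). ?w k (g k)) * polar_volume (\<lambda>k. K (g k)) = 0" by simp
    qed
  qed (auto intro!: finite_PiE)
  also have "\<dots> = (\<Prod>k<DIM('a). c k) * polar_volume K"
  proof -
    have "polar_volume (\<lambda>k. K (restrict id ?U k)) = polar_volume K" by (rule polar_volume_cong) simp
    then show ?thesis by simp
  qed
  finally show ?thesis .
qed

text \<open>For \<open>j\<close> at most the dimension this is a constant multiple of
  \<open>parallelepiped_volume\<close>; in this form the bound, the continuity and the multilinear
  expansion are inherited from mixed volumes.\<close>

definition zonotope_volume :: "nat \<Rightarrow> (nat \<Rightarrow> 'a::euclidean_space) \<Rightarrow> real" where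
  "zonotope_volume j x = polar_volume (\<lambda>k. segment_or_ball x (if k < j then Suc k else 0))"

text \<open>A Hadamard-type inequality. Homogeneity extracts the lengths and leaves segments in the
  unit ball, for which mixed volumes are uniformly bounded; a zero vector is harmless since
  \<open>sgn 0 = 0\<close>. It later supplies the integrable dominating function.\<close>

lemma zonotope_volume_bound:
  assumes j: "j \<le> DIM('a::euclidean_space)"
  shows "\<exists>C\<ge>0. \<forall>x :: nat \<Rightarrow> 'a. \<bar>zonotope_volume j x\<bar> \<le> C * (\<Prod>i\<in>{1..j}. norm (x i))"
proof (intro exI conjI allI)
  let ?d = "DIM('a)"
  let ?C = "2 ^ ?d * measure lebesgue (cball (0::'a) (real ?d * 1))"
  show "0 \<le> ?C" by simp
  fix x :: "nat \<Rightarrow> 'a"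
  define y where "y i = sgn (x i)" for i
  define c where "c k = (if k < j then norm (x (Suc k)) else 1)" for k
  have "zonotope_volume j x = polar_volume (\<lambda>k. (\<lambda>z. c k *\<^sub>R z) ` segment_or_ball y (if k < j then Suc k else 0))"
    unfolding zonotope_volume_def
  proof (rule polar_volume_cong)
    fix k
    have "(\<lambda>z. r *\<^sub>R z) ` closed_segment 0 v = closed_segment 0 (r *\<^sub>R v)" for r :: real and v :: 'a
      using closed_segment_linear_image[of "\<lambda>z. r *\<^sub>R z" 0 v] by (simp add: linear_scale_self)
    moreover have "norm (x (Suc k)) *\<^sub>R sgn (x (Suc k)) = x (Suc k)"
      by (cases "x (Suc k) = 0") (simp_all add: sgn_div_norm)
    ultimately show "segment_or_ball x (if k < j then Suc k else 0)
        = (\<lambda>z. c k *\<^sub>R z) ` segment_or_ball y (if k < j then Suc k else 0)"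
      by (simp add: segment_or_ball_def c_def y_def)
  qed
  also have "\<dots> = (\<Prod>k<?d. c k) * zonotope_volume j y"
    unfolding zonotope_volume_def by (intro polar_volume_scale) (auto simp: convex_body_segment_or_ball c_def)
  also have "(\<Prod>k<?d. c k) = (\<Prod>k<j. norm (x (Suc k)))"
    using j by (intro prod.mono_neutral_cong_right) (auto simp: c_def)
  also have "\<dots> = (\<Prod>i\<in>{1..j}. norm (x i))" by (simp add: prod.atLeast1_atMost_eq)
  finally have "\<bar>zonotope_volume j x\<bar> = (\<Prod>i\<in>{1..j}. norm (x i)) * \<bar>zonotope_volume j y\<bar>"
    by (simp add: abs_mult abs_prod)
  also have "\<dots> \<le> (\<Prod>i\<in>{1..j}. norm (x i)) * ?C"
  proof (intro mult_left_mono prod_nonneg)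
    show "\<bar>zonotope_volume j y\<bar> \<le> ?C"
      unfolding zonotope_volume_def
    proof (intro polar_volume_bound convex_body_segment_or_ball)
      have "closed_segment 0 (sgn v) \<subseteq> cball 0 1" for v :: 'a
        by (intro closed_segment_subset) (auto simp: norm_sgn)
      then show "segment_or_ball y (if k < j then Suc k else 0) \<subseteq> cball 0 1" for k
        by (simp add: segment_or_ball_def y_def)
    qed simp
  qed auto
  finally show "\<bar>zonotope_volume j x\<bar> \<le> ?C * (\<Prod>i\<in>{1..j}. norm (x i))" by (simp add: mult.commute)
qed

text \<open>Moving \<open>a *\<^sub>R v\<close> to \<open>a *\<^sub>R w\<close> with the same
  \<open>a\<close> in the unit interval shows that two segments from \<open>0\<close> are at
  Hausdorff distance at most the distance of their end-points.\<close>

lemma zonotope_volume_tendsto: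
  fixes x :: "nat \<Rightarrow> 'a::euclidean_space"
  assumes lim: "\<And>i. i \<in> {1..j} \<Longrightarrow> (\<lambda>n. y n i) \<longlonglongrightarrow> x i"
  shows "(\<lambda>n. zonotope_volume j (y n)) \<longlonglongrightarrow> zonotope_volume j x"
  unfolding zonotope_volume_def
proof (rule polar_volume_tendsto)
  define r where "r n = (\<Sum>i\<in>{1..j}. norm (y n i - x i))" for n
  have "(\<lambda>n. \<Sum>i\<in>{1..j}. norm (y n i - x i)) \<longlonglongrightarrow> (\<Sum>i\<in>{1..j}. norm (x i - x i))"
    by (intro tendsto_intros lim)
  then show "r \<longlonglongrightarrow> 0" by (simp add: r_def[abs_def])
  show r: "0 \<le> r n" for n by (simp add: r_def sum_nonneg)
  have seg: "closed_segment 0 v \<subseteq> closed_segment 0 w + cball 0 s" if "norm (v - w) \<le> s" for v w :: 'a and s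
  proof
    fix z assume "z \<in> closed_segment 0 v"
    then obtain a where a: "0 \<le> a" "a \<le> 1" "z = a *\<^sub>R v" by (auto simp: mem_segment_zero)
    have "a * norm (v - w) \<le> s" using a that mult_left_le_one_le[of "norm (v - w)" a] by simp
    then have "a *\<^sub>R w + a *\<^sub>R (v - w) \<in> closed_segment 0 w + cball 0 s"
      using a by (intro set_plus_intro) (auto simp: mem_segment_zero)
    then show "z \<in> closed_segment 0 w + cball 0 s" by (simp add: a(3) algebra_simps)
  qed
  have nr: "norm (y n i - x i) \<le> r n" if "i \<in> {1..j}" for n i
    unfolding r_def using that by (intro member_le_sum) auto
  show "segment_or_ball (y n) (if k < j then Suc k else 0) \<subseteq> segment_or_ball x (if k < j then Suc k else 0) + cball 0 (r n)" for n k
    using set_plus_subset_self[OF r] by (auto simp: segment_or_ball_def intro!: subsetD[OF seg] nr)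
  show "segment_or_ball x (if k < j then Suc k else 0) \<subseteq> segment_or_ball (y n) (if k < j then Suc k else 0) + cball 0 (r n)" for n k
    using set_plus_subset_self[OF r] nr by (auto simp: segment_or_ball_def norm_minus_commute intro!: subsetD[OF seg])
qed (rule convex_body_segment_or_ball)+

section \<open>Finitely valued random vectors\<close>

lemma convex_body_case_option:
  "convex_body (case i of None \<Rightarrow> cball 0 1 | Some x \<Rightarrow> closed_segment 0 x)"
  by (cases i) (simp_all add: convex_body_cball convex_body_segment)

text \<open>Both bodies have the same support function: the weight of \<open>Some x\<close> is the
  probability of the value \<open>x\<close>. The ball, indexed by \<open>None\<close>, gets weight
  \<open>0\<close>; it is included so that every slot draws from one family, as the multilinear
  expansion requires.\<close>

lemma selection_expectation_finite_range:
  fixes \<xi> :: "'w \<Rightarrow> 'a::euclidean_space"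
  assumes M: "prob_space M" and rv: "\<xi> \<in> borel_measurable M" and F: "finite F"
    and ran: "\<And>\<omega>. \<omega> \<in> space M \<Longrightarrow> \<xi> \<omega> \<in> F"
  shows "minkowski_comb (insert None (Some ` F)) (\<lambda>i. LINT \<omega>|M. of_bool (i = Some (\<xi> \<omega>)))
      (\<lambda>i. case i of None \<Rightarrow> cball 0 1 | Some x \<Rightarrow> closed_segment 0 x)
    = selection_expectation M (\<lambda>\<omega>. closed_segment 0 (\<xi> \<omega>))"
proof (rule support_fun_inject)
  interpret prob_space M by fact
  have [measurable]: "\<xi> \<in> borel_measurable M" by fact
  obtain B where B: "\<forall>x\<in>F. norm x \<le> B" using finite_imp_bounded[OF F] by (auto simp: bounded_iff)
  have \<xi>: "integrable M \<xi>" using B ran by (intro integrable_const_bound[where B = B]) auto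
  show "convex_body (selection_expectation M (\<lambda>\<omega>. closed_segment 0 (\<xi> \<omega>)))"
    by (rule selection_expectation_segment(1)[OF \<xi>])
  let ?I = "insert None (Some ` F)"
  let ?K = "\<lambda>i. case i of None \<Rightarrow> cball 0 1 | Some x \<Rightarrow> closed_segment (0::'a) x"
  let ?t = "\<lambda>i. LINT \<omega>|M. (of_bool (i = Some (\<xi> \<omega>)) :: real)"
  show "convex_body (minkowski_comb ?I ?t ?K)"
    by (intro convex_body_minkowski_comb convex_body_case_option)
  fix u :: 'a
  have int: "integrable M (\<lambda>\<omega>. (of_bool (x = \<xi> \<omega>) :: real))" for x
    by (intro integrable_const_bound[where B = 1]) (auto simp: of_bool_def)
  have "support_fun (minkowski_comb ?I ?t ?K) u = (\<Sum>i\<in>?I. ?t i * support_fun (?K i) u)"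
    using F by (intro support_fun_minkowski_comb) (auto simp: convex_body_cball convex_body_segment)
  also have "\<dots> = (\<Sum>x\<in>F. (LINT \<omega>|M. of_bool (x = \<xi> \<omega>)) * max 0 (x \<bullet> u))"
    using F by (subst sum.insert) (auto simp: sum.reindex support_fun_segment)
  also have "\<dots> = (LINT \<omega>|M. (\<Sum>x\<in>F. of_bool (x = \<xi> \<omega>) * max 0 (x \<bullet> u)))"
    using int by (subst Bochner_Integration.integral_sum) auto
  also have "\<dots> = (LINT \<omega>|M. max 0 (\<xi> \<omega> \<bullet> u))"
  proof (intro Bochner_Integration.integral_cong refl)
    fix \<omega> assume "\<omega> \<in> space M"
    have "(\<Sum>x\<in>F. of_bool (x = \<xi> \<omega>) * max 0 (x \<bullet> u)) = (\<Sum>x\<in>F. if x = \<xi> \<omega> then max 0 (x \<bullet> u) else 0)"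
      by (intro sum.cong) auto
    then show "(\<Sum>x\<in>F. of_bool (x = \<xi> \<omega>) * max 0 (x \<bullet> u)) = max 0 (\<xi> \<omega> \<bullet> u)"
      using F ran[OF \<open>\<omega> \<in> space M\<close>] by simp
  qed
  also have "\<dots> = support_fun (selection_expectation M (\<lambda>\<omega>. closed_segment 0 (\<xi> \<omega>))) u"
    by (rule selection_expectation_segment(2)[OF \<xi>, symmetric])
  finally show "support_fun (minkowski_comb ?I ?t ?K) u
      = support_fun (selection_expectation M (\<lambda>\<omega>. closed_segment 0 (\<xi> \<omega>))) u" .
qed

text \<open>Slots count from \<open>0\<close> and the random vectors from \<open>1\<close>, hence
  \<open>Suc k\<close>.\<close>

definition expectation_or_ball :: "'w measure \<Rightarrow> nat \<Rightarrow> (nat \<Rightarrow> 'w \<Rightarrow> 'a::euclidean_space) \<Rightarrow> nat \<Rightarrow> 'a set" where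
  "expectation_or_ball M j \<xi> k =
    (if k < j then selection_expectation M (\<lambda>\<omega>. closed_segment 0 (\<xi> (Suc k) \<omega>)) else cball 0 1)"

text \<open>Both sides have multilinear expansions over the same bodies. On the left the weights
  \<open>W\<close> are indicators, on the right \<open>w\<close> holds their expectations, and by
  independence the expectation of a product of indicators is the product of the
  expectations.\<close>

lemma expectation_zonotope_volume_finite_range:
  fixes \<xi> :: "nat \<Rightarrow> 'w \<Rightarrow> 'a::euclidean_space"
  assumes M: "prob_space M" and j: "j \<le> DIM('a)"
    and ind: "prob_space.indep_vars M (\<lambda>_. borel) \<xi> {1..j}"
    and F: "finite F" and ran: "\<And>i \<omega>. i \<in> {1..j} \<Longrightarrow> \<omega> \<in> space M \<Longrightarrow> \<xi> i \<omega> \<in> F"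
  shows "(LINT \<omega>|M. zonotope_volume j (\<lambda>i. \<xi> i \<omega>)) = polar_volume (expectation_or_ball M j \<xi>)"
    and "(\<lambda>\<omega>. zonotope_volume j (\<lambda>i. \<xi> i \<omega>)) \<in> borel_measurable M"
proof -
  interpret prob_space M by fact
  let ?d = "DIM('a)"
  let ?I = "insert None (Some ` F)"
  let ?E = "{..<?d} \<rightarrow>\<^sub>E ?I"
  let ?K = "\<lambda>i. case i of None \<Rightarrow> cball 0 1 | Some x \<Rightarrow> closed_segment (0::'a) x"
  define W where "W \<omega> k i = (if k < j then of_bool (i = Some (\<xi> (Suc k) \<omega>)) else of_bool (None = i) :: real)" for \<omega> k i
  define w where "w k i = (if k < j then (LINT \<omega>|M. of_bool (i = Some (\<xi> (Suc k) \<omega>))) else of_bool (None = i) :: real)" for k i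
  define v where "v g = polar_volume (\<lambda>k. ?K (g k))" for g
  have rv: "\<xi> i \<in> borel_measurable M" if "i \<in> {1..j}" for i using ind that by (auto simp: indep_vars_def)
  have cb: "convex_body (?K i)" for i by (rule convex_body_case_option)
  have none: "minkowski_comb ?I (\<lambda>i. of_bool (None = i)) ?K = cball 0 1"
    using F cb by (subst minkowski_comb_single) (auto simp: convex_body_def)
  have some: "minkowski_comb ?I (\<lambda>i. of_bool (i = Some x)) ?K = closed_segment 0 x" if "x \<in> F" for x
    using F cb that minkowski_comb_single[of ?I "Some x" ?K] by (auto simp: convex_body_def eq_commute)
  have expand: "zonotope_volume j (\<lambda>i. \<xi> i \<omega>) = (\<Sum>g\<in>?E. (\<Prod>k<?d. W \<omega> k (g k)) * v g)" if \<omega>: "\<omega> \<in> space M" for \<omega>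
  proof -
    have "zonotope_volume j (\<lambda>i. \<xi> i \<omega>) = polar_volume (\<lambda>k. minkowski_comb ?I (W \<omega> k) ?K)"
      unfolding zonotope_volume_def
    proof (rule polar_volume_cong)
      fix k
      show "segment_or_ball (\<lambda>i. \<xi> i \<omega>) (if k < j then Suc k else 0) = minkowski_comb ?I (W \<omega> k) ?K"
        using ran[OF _ \<omega>, of "Suc k"]
        by (cases "k < j") (simp_all add: W_def[abs_def] segment_or_ball_def none some)
    qed
    also have "\<dots> = (\<Sum>g\<in>?E. (\<Prod>k<?d. W \<omega> k (g k)) * v g)"
      unfolding v_def using F cb by (intro polar_volume_multilinear) (auto simp: W_def)
    finally show ?thesis .
  qed
  have Y_meas: "(\<lambda>x. of_bool (g = Some x) :: real) \<in> borel_measurable borel" for g :: "'a option"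
    by (cases g) (auto simp: of_bool_def)
  have prodW: "(LINT \<omega>|M. (\<Prod>k<?d. W \<omega> k (g k))) = (\<Prod>k<?d. w k (g k))"
    and intW: "integrable M (\<lambda>\<omega>. \<Prod>k<?d. W \<omega> k (g k))" for g
  proof -
    define Y where "Y i x = (of_bool (g (i - 1) = Some x) :: real)" for i x
    have indY: "indep_vars (\<lambda>_. borel) (\<lambda>i \<omega>. Y i (\<xi> i \<omega>)) {1..j}"
      by (rule indep_vars_compose2[OF ind]) (simp add: Y_def[abs_def] Y_meas)
    have intY: "integrable M (\<lambda>\<omega>. Y i (\<xi> i \<omega>))" if "i \<in> {1..j}" for i
      using measurable_compose[OF rv[OF that] Y_meas[of "g (i - 1)"]]
      by (intro integrable_const_bound[where B = 1]) (auto simp: Y_def)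
    have split: "{..<?d} = {..<j} \<union> {j..<?d}" "{..<j} \<inter> {j..<?d} = {}" using j by auto
    have shift: "(\<Prod>i\<in>{1..j}. f i) = (\<Prod>k<j. f (Suc k))" for f :: "nat \<Rightarrow> real"
      by (simp add: prod.atLeast1_atMost_eq)
    \<comment> \<open>The slots beyond \<open>j\<close> hold balls, so their weights are
      deterministic and factor out of the expectation.\<close>
    define c where "c = (\<Prod>k\<in>{j..<?d}. of_bool (None = g k) :: real)"
    have W: "(\<Prod>k<?d. W \<omega> k (g k)) = (\<Prod>i\<in>{1..j}. Y i (\<xi> i \<omega>)) * c" for \<omega>
      unfolding split(1) c_def shift using split(2)
      by (subst prod.union_disjoint) (auto simp: W_def Y_def intro!: arg_cong2[where f = "(*)"] prod.cong)
    have w: "(\<Prod>k<?d. w k (g k)) = (\<Prod>i\<in>{1..j}. LINT \<omega>|M. Y i (\<xi> i \<omega>)) * c"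
      unfolding split(1) c_def shift using split(2)
      by (subst prod.union_disjoint) (auto simp: w_def Y_def intro!: arg_cong2[where f = "(*)"] prod.cong)
    show "(LINT \<omega>|M. (\<Prod>k<?d. W \<omega> k (g k))) = (\<Prod>k<?d. w k (g k))"
      unfolding W w using indep_vars_lebesgue_integral[OF _ indY intY] by simp
    show "integrable M (\<lambda>\<omega>. \<Prod>k<?d. W \<omega> k (g k))"
      unfolding W using indep_vars_integrable[OF _ indY intY] by simp
  qed
  have "(LINT \<omega>|M. zonotope_volume j (\<lambda>i. \<xi> i \<omega>)) = (LINT \<omega>|M. (\<Sum>g\<in>?E. (\<Prod>k<?d. W \<omega> k (g k)) * v g))"
    by (intro Bochner_Integration.integral_cong refl expand)
  also have "\<dots> = (\<Sum>g\<in>?E. (\<Prod>k<?d. w k (g k)) * v g)"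
    using intW by (subst Bochner_Integration.integral_sum) (auto simp: prodW)
  also have "\<dots> = polar_volume (\<lambda>k. minkowski_comb ?I (w k) ?K)"
    unfolding v_def using F cb by (intro polar_volume_multilinear[symmetric]) (auto simp: w_def)
  also have "\<dots> = polar_volume (expectation_or_ball M j \<xi>)"
  proof (rule polar_volume_cong)
    fix k
    show "minkowski_comb ?I (w k) ?K = expectation_or_ball M j \<xi> k"
    proof (cases "k < j")
      case True
      then have "Suc k \<in> {1..j}" by simp
      then show ?thesis
        using selection_expectation_finite_range[OF M rv F ran] True
        by (simp add: w_def[abs_def] expectation_or_ball_def)
    next
      case False
      then show ?thesis by (simp add: w_def[abs_def] expectation_or_ball_def none)
    qed
  qed
  finally show "(LINT \<omega>|M. zonotope_volume j (\<lambda>i. \<xi> i \<omega>)) = polar_volume (expectation_or_ball M j \<xi>)" .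
  have "(\<lambda>\<omega>. \<Sum>g\<in>?E. (\<Prod>k<?d. W \<omega> k (g k)) * v g) \<in> borel_measurable M"
    using borel_measurable_integrable[OF intW] by (intro borel_measurable_sum borel_measurable_times) auto
  then show "(\<lambda>\<omega>. zonotope_volume j (\<lambda>i. \<xi> i \<omega>)) \<in> borel_measurable M"
    by (subst measurable_cong[OF expand]) auto
qed

lemma expectation_zonotope_volume:
  fixes \<xi> :: "nat \<Rightarrow> 'w \<Rightarrow> 'a::euclidean_space"
  assumes M: "prob_space M" and j: "j \<le> DIM('a)"
    and ind: "prob_space.indep_vars M (\<lambda>_. borel) \<xi> {1..j}"
    and int: "\<And>i. i \<in> {1..j} \<Longrightarrow> integrable M (\<xi> i)"
  shows "polar_volume (expectation_or_ball M j \<xi>) = (LINT \<omega>|M. zonotope_volume j (\<lambda>i. \<xi> i \<omega>))"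
proof -
  interpret prob_space M by fact
  \<comment> \<open>Simple functions approximating the identity of the space itself: composing every
    \<open>\<xi> i\<close> with the same Borel map \<open>s n\<close> preserves independence and
    gives all of them values in one finite set \<open>F n\<close>.\<close>
  obtain s :: "nat \<Rightarrow> 'a \<Rightarrow> 'a" where s: "\<And>n. simple_function borel (s n)"
    "\<And>x. (\<lambda>n. s n x) \<longlonglongrightarrow> x" "\<And>n x. norm (s n x) \<le> 2 * norm x"
    using borel_measurable_implies_sequence_metric[of "\<lambda>x::'a. x" borel 0] by auto
  define F where "F n = range (s n)" for n
  have F: "finite (F n)" for n using simple_functionD(1)[OF s(1), of n] by (simp add: F_def)
  have [measurable]: "s n \<in> borel_measurable borel" for n
    by (rule borel_measurable_simple_function[OF s(1)])
  define \<eta> where "\<eta> n i \<omega> = s n (\<xi> i \<omega>)" for n i \<omega>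
  have rv[measurable]: "\<xi> i \<in> borel_measurable M" if "i \<in> {1..j}" for i using int[OF that] by auto
  have indn: "indep_vars (\<lambda>_. borel) (\<eta> n) {1..j}" for n
    unfolding \<eta>_def[abs_def] by (rule indep_vars_compose2[OF ind]) simp
  have \<eta>_meas: "\<eta> n i \<in> borel_measurable M" if "i \<in> {1..j}" for n i
    unfolding \<eta>_def[abs_def] using rv[OF that] by measurable
  have \<eta>_int: "integrable M (\<eta> n i)" if i: "i \<in> {1..j}" for n i
  proof (rule Bochner_Integration.integrable_bound)
    show "integrable M (\<lambda>\<omega>. 2 * norm (\<xi> i \<omega>))" using int[OF i] by auto
    show "AE \<omega> in M. norm (\<eta> n i \<omega>) \<le> norm (2 * norm (\<xi> i \<omega>))" using s(3) by (auto simp: \<eta>_def)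
  qed (rule \<eta>_meas[OF i])
  \<comment> \<open>As \<open>max 0 (x \<bullet> u)\<close> is Lipschitz in \<open>x\<close> with
    constant \<open>norm u\<close>, this distance in mean bounds the difference of the support
    functions and hence the Hausdorff distance of the two selection expectations.\<close>
  define \<delta> where "\<delta> n i = (LINT \<omega>|M. norm (\<eta> n i \<omega> - \<xi> i \<omega>))" for n i
  have \<delta>_lim: "(\<lambda>n. \<delta> n i) \<longlonglongrightarrow> 0" if i: "i \<in> {1..j}" for i
  proof -
    have "(\<lambda>n. LINT \<omega>|M. norm (\<eta> n i \<omega> - \<xi> i \<omega>)) \<longlonglongrightarrow> (LINT \<omega>|M. 0)"
    proof (rule integral_dominated_convergence)
      \<comment> \<open>The factor is \<open>2 + 1\<close>: the approximation is at most twice as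
        long as the vector.\<close>
      show "integrable M (\<lambda>\<omega>. 3 * norm (\<xi> i \<omega>))" using int[OF i] by auto
      show "AE \<omega> in M. (\<lambda>n. norm (\<eta> n i \<omega> - \<xi> i \<omega>)) \<longlonglongrightarrow> 0"
        using s(2) by (auto simp: \<eta>_def intro!: tendsto_norm_zero LIM_zero)
      show "AE \<omega> in M. norm (norm (\<eta> n i \<omega> - \<xi> i \<omega>)) \<le> 3 * norm (\<xi> i \<omega>)" for n
      proof (rule AE_I2)
        fix \<omega>
        have "norm (\<eta> n i \<omega> - \<xi> i \<omega>) \<le> norm (\<eta> n i \<omega>) + norm (\<xi> i \<omega>)" by (rule norm_triangle_ineq4)
        then show "norm (norm (\<eta> n i \<omega> - \<xi> i \<omega>)) \<le> 3 * norm (\<xi> i \<omega>)"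
          using s(3)[of n "\<xi> i \<omega>"] by (simp add: \<eta>_def)
      qed
    qed (use \<eta>_meas[OF i] rv[OF i] in measurable)
    then show ?thesis by (simp add: \<delta>_def)
  qed
  define r where "r n = (\<Sum>i\<in>{1..j}. \<delta> n i)" for n
  have \<delta>0: "0 \<le> \<delta> n i" for n i by (simp add: \<delta>_def)
  then have r0: "0 \<le> r n" for n by (simp add: r_def sum_nonneg)
  have r_lim: "r \<longlonglongrightarrow> 0"
    unfolding r_def[abs_def] by (rule tendsto_null_sum) (rule \<delta>_lim)
  have support: "\<bar>(LINT \<omega>|M. max 0 (\<eta> n i \<omega> \<bullet> u)) - (LINT \<omega>|M. max 0 (\<xi> i \<omega> \<bullet> u))\<bar> \<le> r n * norm u"
    if i: "i \<in> {1..j}" for n i u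
  proof -
    have i1: "integrable M (\<lambda>\<omega>. max 0 (\<eta> n i \<omega> \<bullet> u))" "integrable M (\<lambda>\<omega>. max 0 (\<xi> i \<omega> \<bullet> u))"
      using int[OF i] \<eta>_int[OF i] by (auto intro!: integrable_max)
    have "\<bar>(LINT \<omega>|M. max 0 (\<eta> n i \<omega> \<bullet> u)) - (LINT \<omega>|M. max 0 (\<xi> i \<omega> \<bullet> u))\<bar>
        = \<bar>LINT \<omega>|M. max 0 (\<eta> n i \<omega> \<bullet> u) - max 0 (\<xi> i \<omega> \<bullet> u)\<bar>"
      using i1 by simp
    also have "\<dots> \<le> (LINT \<omega>|M. \<bar>max 0 (\<eta> n i \<omega> \<bullet> u) - max 0 (\<xi> i \<omega> \<bullet> u)\<bar>)"
      by (rule integral_abs_bound)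
    also have "\<dots> \<le> (LINT \<omega>|M. norm (\<eta> n i \<omega> - \<xi> i \<omega>) * norm u)"
    proof (rule integral_mono)
      show "integrable M (\<lambda>\<omega>. \<bar>max 0 (\<eta> n i \<omega> \<bullet> u) - max 0 (\<xi> i \<omega> \<bullet> u)\<bar>)" using i1 by auto
      show "integrable M (\<lambda>\<omega>. norm (\<eta> n i \<omega> - \<xi> i \<omega>) * norm u)" using int[OF i] \<eta>_int[OF i] by auto
      fix \<omega>
      have "\<bar>max 0 (\<eta> n i \<omega> \<bullet> u) - max 0 (\<xi> i \<omega> \<bullet> u)\<bar> \<le> \<bar>\<eta> n i \<omega> \<bullet> u - \<xi> i \<omega> \<bullet> u\<bar>" by linarith
      also have "\<dots> \<le> norm (\<eta> n i \<omega> - \<xi> i \<omega>) * norm u"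
        unfolding inner_diff_left[symmetric] by (rule Cauchy_Schwarz_ineq2)
      finally show "\<bar>max 0 (\<eta> n i \<omega> \<bullet> u) - max 0 (\<xi> i \<omega> \<bullet> u)\<bar> \<le> norm (\<eta> n i \<omega> - \<xi> i \<omega>) * norm u" .
    qed
    also have "\<dots> = \<delta> n i * norm u" by (simp add: \<delta>_def)
    also have "\<dots> \<le> r n * norm u"
      unfolding r_def using i \<delta>0 by (intro mult_right_mono member_le_sum) auto
    finally show ?thesis .
  qed
  have cb: "convex_body (expectation_or_ball M j \<xi> k)" "convex_body (expectation_or_ball M j (\<eta> n) k)" for n k
    using selection_expectation_segment(1)[OF int] selection_expectation_segment(1)[OF \<eta>_int]
    by (auto simp: expectation_or_ball_def convex_body_cball)
  have sub: "expectation_or_ball M j (\<eta> n) k \<subseteq> expectation_or_ball M j \<xi> k + cball 0 (r n)"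
    "expectation_or_ball M j \<xi> k \<subseteq> expectation_or_ball M j (\<eta> n) k + cball 0 (r n)" for n k
  proof -
    have "\<bar>support_fun (expectation_or_ball M j (\<eta> n) k) u - support_fun (expectation_or_ball M j \<xi> k) u\<bar> \<le> r n * norm u" for u
      using support[of "Suc k" n u] selection_expectation_segment(2)[OF int, of "Suc k" u]
        selection_expectation_segment(2)[OF \<eta>_int, of "Suc k" n u] r0[of n]
      by (auto simp: expectation_or_ball_def)
    then have le: "support_fun (expectation_or_ball M j (\<eta> n) k) u \<le> support_fun (expectation_or_ball M j \<xi> k) u + r n * norm u"
      "support_fun (expectation_or_ball M j \<xi> k) u \<le> support_fun (expectation_or_ball M j (\<eta> n) k) u + r n * norm u" for u
      by (smt (verit))+
    show "expectation_or_ball M j (\<eta> n) k \<subseteq> expectation_or_ball M j \<xi> k + cball 0 (r n)"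
      "expectation_or_ball M j \<xi> k \<subseteq> expectation_or_ball M j (\<eta> n) k + cball 0 (r n)"
      by (rule support_fun_le_imp_subset[OF _ _ r0 le(1)] support_fun_le_imp_subset[OF _ _ r0 le(2)]; rule cb)+
  qed
  have lim1: "(\<lambda>n. polar_volume (expectation_or_ball M j (\<eta> n))) \<longlonglongrightarrow> polar_volume (expectation_or_ball M j \<xi>)"
    by (rule polar_volume_tendsto[OF cb r_lim r0 sub])
  obtain C where C: "C \<ge> 0" "\<And>x :: nat \<Rightarrow> 'a. \<bar>zonotope_volume j x\<bar> \<le> C * (\<Prod>i\<in>{1..j}. norm (x i))"
    using zonotope_volume_bound[OF j] by blast
  have fr: "polar_volume (expectation_or_ball M j (\<eta> n)) = (LINT \<omega>|M. zonotope_volume j (\<lambda>i. \<eta> n i \<omega>))"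
    "(\<lambda>\<omega>. zonotope_volume j (\<lambda>i. \<eta> n i \<omega>)) \<in> borel_measurable M" for n
    using expectation_zonotope_volume_finite_range[OF M j indn F, of n n] by (auto simp: \<eta>_def F_def)
  have ptw: "(\<lambda>n. zonotope_volume j (\<lambda>i. \<eta> n i \<omega>)) \<longlonglongrightarrow> zonotope_volume j (\<lambda>i. \<xi> i \<omega>)" for \<omega>
    by (rule zonotope_volume_tendsto) (simp add: \<eta>_def s(2))
  have lim2: "(\<lambda>n. LINT \<omega>|M. zonotope_volume j (\<lambda>i. \<eta> n i \<omega>)) \<longlonglongrightarrow> (LINT \<omega>|M. zonotope_volume j (\<lambda>i. \<xi> i \<omega>))"
  proof (rule integral_dominated_convergence)
    show "(\<lambda>\<omega>. zonotope_volume j (\<lambda>i. \<xi> i \<omega>)) \<in> borel_measurable M"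
      by (rule borel_measurable_LIMSEQ_real[OF ptw fr(2)])
    have "indep_vars (\<lambda>_. borel) (\<lambda>i \<omega>. norm (\<xi> i \<omega>)) {1..j}"
      by (rule indep_vars_compose2[OF ind]) simp
    then have "integrable M (\<lambda>\<omega>. \<Prod>i\<in>{1..j}. norm (\<xi> i \<omega>))"
      by (rule indep_vars_integrable[rotated]) (use int in auto)
    \<comment> \<open>The factor \<open>2 ^ j\<close> absorbs the length bound on the
      \<open>j\<close> approximations; independence made the product of the norms
      integrable.\<close>
    then show "integrable M (\<lambda>\<omega>. C * (2 ^ j * (\<Prod>i\<in>{1..j}. norm (\<xi> i \<omega>))))" by auto
    show "AE \<omega> in M. norm (zonotope_volume j (\<lambda>i. \<eta> n i \<omega>)) \<le> C * (2 ^ j * (\<Prod>i\<in>{1..j}. norm (\<xi> i \<omega>)))" for n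
    proof (rule AE_I2)
      fix \<omega>
      have "(\<Prod>i\<in>{1..j}. norm (\<eta> n i \<omega>)) \<le> (\<Prod>i\<in>{1..j}. 2 * norm (\<xi> i \<omega>))"
        using s(3) by (intro prod_mono) (auto simp: \<eta>_def)
      also have "\<dots> = 2 ^ j * (\<Prod>i\<in>{1..j}. norm (\<xi> i \<omega>))" by (simp add: prod.distrib)
      finally show "norm (zonotope_volume j (\<lambda>i. \<eta> n i \<omega>)) \<le> C * (2 ^ j * (\<Prod>i\<in>{1..j}. norm (\<xi> i \<omega>)))"
        using C(2)[of "\<lambda>i. \<eta> n i \<omega>"] C(1) by (auto intro: order_trans mult_left_mono)
    qed
  qed (use fr(2) ptw in auto)
  show ?thesis by (rule LIMSEQ_unique[OF lim1]) (use lim2 in \<open>simp add: fr(1)\<close>)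
qed

theorem theorem2p1:
  fixes M :: "'w measure" and \<xi> :: "nat \<Rightarrow> 'w \<Rightarrow> 'a::euclidean_space" and j :: nat
  assumes "prob_space M"
    and "j \<in> {1..DIM('a)}"
    and "prob_space.indep_vars M (\<lambda>_. borel) \<xi> {1..j}"
    and "\<forall>i\<in>{1..j}. integrable M (\<xi> i)"
  shows "mixed_volume
           (map (\<lambda>i. selection_expectation M (\<lambda>\<omega>. closed_segment 0 (\<xi> i \<omega>))) [1..<Suc j]
            @ replicate (DIM('a) - j) (cball 0 1))
         = fact (DIM('a) - j) / fact DIM('a) * unit_ball_vol (real (DIM('a) - j))
           * prob_space.expectation M (\<lambda>\<omega>. parallelepiped_volume j (\<lambda>i. \<xi> i \<omega>))"
proof -
  have j: "j \<le> DIM('a)" using assms(2) by simp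
  let ?Ks = "map (\<lambda>i. selection_expectation M (\<lambda>\<omega>. closed_segment 0 (\<xi> i \<omega>))) [1..<Suc j]
            @ replicate (DIM('a) - j) (cball 0 1)"
  have "mixed_volume ?Ks = polar_volume ((!) ?Ks)"
  proof (rule mixed_volume_eq_polar_volume)
    show "length ?Ks = DIM('a)" using assms(2) by simp
    show "\<forall>K\<in>set ?Ks. convex_body K"
      using assms(4) by (auto intro!: selection_expectation_segment(1) convex_body_cball)
  qed
  also have "\<dots> = polar_volume (expectation_or_ball M j \<xi>)"
    by (rule polar_volume_cong) (auto simp: expectation_or_ball_def nth_append simp del: upt_Suc)
  also have "\<dots> = (LINT \<omega>|M. zonotope_volume j (\<lambda>i. \<xi> i \<omega>))"
    using assms j by (intro expectation_zonotope_volume) auto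
  \<comment> \<open>The deterministic identity applies to the realized vectors for each
    \<open>\<omega>\<close>, so the integrands coincide everywhere.\<close>
  also have "\<dots> = (LINT \<omega>|M. fact (DIM('a) - j) / fact DIM('a) * unit_ball_vol (real (DIM('a) - j))
      * parallelepiped_volume j (\<lambda>i. \<xi> i \<omega>))"
    unfolding zonotope_volume_def polar_volume_segments_ball[OF j] ..
  finally show ?thesis by simp
qed

end
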